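(* For every integer $n\ge 1$, the characteristic polynomial of the sunflower hypergraph $\mathcal{S}(n,1,3)$ is $$\phi_{\mathcal{S}(n,1,3)}(\lambda) = \lambda^{(2n-2)4^n}\prod_{r=0}^n (\lambda^3-r)^{\binom{n}{r}3^r}.$$
   Context: Sunflower hypergraphs: for integers $m>0$ and $0<q<k$, let $S$ be a set of $q$ vertices ("seeds") and let $E_1,\ldots,E_m$ be pairwise disjoint sets (also disjoint from $S$) of $k-q$ vertices each ("petals"). The sunflower $\mathcal{S}(m,q,k)$ is the $k$-uniform hypergraph on vertex set $S\cup E_1\cup\cdots\cup E_m$ whose edges are the sets $S\cup E_i$, $1\le i\le m$. Thus $\mathcal{S}(n,1,3)$ has $2n+1$ vertices $v_0$ and $v_{i,1},v_{i,2}$ ($1\le i\le n$), and edges $\{v_0,v_{i,1},v_{i,2}\}$ for $1\le i\le n$. The characteristic polynomial of a $k$-uniform hypergraph is that of its normalized adjacency hypermatrix (entry $1/(k-1)!$ at each ordered $k$-tuple whose entries form an edge, and $0$ elsewhere). That is, it is the resultant of the forms $F_v = \lambda x_v^{k-1} - \sum_{e\ni v}\prod_{u\in e\setminus\{v\}} x_u$, one for each vertex $v$, in the variables $x_v$. For $\mathcal{S}(n,1,3)$ these are the $2n+1$ quadratic forms $$F_0 = \lambda x_0^2 - \sum_{i=1}^n x_{i,1}x_{i,2},\qquad F_{i,1} = \lambda x_{i,1}^2 - x_0x_{i,2},\qquad F_{i,2} = \lambda x_{i,2}^2 - x_0x_{i,1}\quad(1\le i\le n),$$ and $\phi_{\mathcal{S}(n,1,3)}(\lambda)=\operatorname{Res}(F_0,F_{1,1},F_{1,2},\ldots,F_{n,1},F_{n,2})$.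 Here $\operatorname{Res}$ is the classical multivariate resultant of $N$ homogeneous forms in $N$ variables: the irreducible integer polynomial in the coefficients vanishing exactly when the forms have a common nonzero zero over an algebraically closed field, normalized so that the resultant of the pure powers $x_1^{d_1},\ldots,x_N^{d_N}$ of the variables is $1$. *)

theory Defs
  imports
    Complex_Main
    "HOL-Library.Poly_Mapping"
    "HOL-Computational_Algebra.Factorial_Ring"
    "HOL-Computational_Algebra.Polynomial"
begin

section \<open>Multivariate polynomials and forms\<close>

type_synonym 'v monomial = "'v \<Rightarrow>\<^sub>0 nat"

type_synonym ('v, 'a) mpoly = "'v monomial \<Rightarrow>\<^sub>0 'a"

definition mpoly_vars :: "('v, 'a::zero) mpoly \<Rightarrow> 'v set" where
  "mpoly_vars p = (\<Union>m\<in>Poly_Mapping.keys p. Poly_Mapping.keys m)"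

text \<open>The argument \<open>h\<close> maps the coefficients into the ring in which the polynomial is evaluated.\<close>

definition mpoly_eval ::
    "('a::zero \<Rightarrow> 'b::comm_ring_1) \<Rightarrow> ('v \<Rightarrow> 'b) \<Rightarrow> ('v, 'a) mpoly \<Rightarrow> 'b" where
  "mpoly_eval h x p =
    (\<Sum>m\<in>Poly_Mapping.keys p.
       h (Poly_Mapping.lookup p m) *
       (\<Prod>v\<in>Poly_Mapping.keys m. x v ^ Poly_Mapping.lookup m v))"

definition monomials_of_degree :: "'v set \<Rightarrow> nat \<Rightarrow> 'v monomial set" where
  "monomials_of_degree V d =
    {m. Poly_Mapping.keys m \<subseteq> V \<and> (\<Sum>v\<in>Poly_Mapping.keys m. Poly_Mapping.lookup m v) = d}"

definition forms :: "'v set \<Rightarrow> nat \<Rightarrow> ('v, 'a::zero) mpoly set" where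
  "forms V d = {p. Poly_Mapping.keys p \<subseteq> monomials_of_degree V d}"

section \<open>The classical multivariate resultant\<close>

text \<open>
  A system of forms is a family \<open>F\<close> with one form \<open>F v\<close>, of degree \<open>d v\<close>, for each variable
  \<open>v \<in> V\<close>.  The indeterminate \<open>(v, m)\<close> stands for the coefficient of the monomial \<open>m\<close> in \<open>F v\<close>.
\<close>

definition coeff_vars :: "'v set \<Rightarrow> ('v \<Rightarrow> nat) \<Rightarrow> ('v \<times> 'v monomial) set" where
  "coeff_vars V d = (SIGMA v:V. monomials_of_degree V (d v))"

definition form_coeffs :: "('v \<Rightarrow> ('v, 'a::zero) mpoly) \<Rightarrow> 'v \<times> 'v monomial \<Rightarrow> 'a" where
  "form_coeffs F = (\<lambda>(v, m). Poly_Mapping.lookup (F v) m)"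

definition pure_power :: "'v \<Rightarrow> nat \<Rightarrow> ('v, 'a::zero_neq_one) mpoly" where
  "pure_power v d = Poly_Mapping.single (Poly_Mapping.single v d) 1"

definition has_nonzero_common_zero ::
    "'v set \<Rightarrow> ('v \<Rightarrow> ('v, 'a::comm_ring_1) mpoly) \<Rightarrow> bool" where
  "has_nonzero_common_zero V F \<longleftrightarrow>
    (\<exists>x. (\<exists>v\<in>V. x v \<noteq> 0) \<and> (\<forall>v\<in>V. mpoly_eval (\<lambda>c. c) x (F v) = 0))"

text \<open>
  The algebraically closed field is that of the complex numbers: an irreducible integer polynomial
  is determined up to sign by its complex zeros, and the normalization fixes the sign.  As the forms
  and the variables are indexed by the same set, no ordering of either has to be chosen.
  The definite description below is meaningful for finite nonempty \<open>V\<close> and positive degrees.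
\<close>

definition is_resultant_poly ::
    "'v set \<Rightarrow> ('v \<Rightarrow> nat) \<Rightarrow> ('v \<times> 'v monomial, int) mpoly \<Rightarrow> bool" where
  "is_resultant_poly V d R \<longleftrightarrow>
    mpoly_vars R \<subseteq> coeff_vars V d \<and>
    irreducible R \<and>
    (\<forall>F :: 'v \<Rightarrow> ('v, complex) mpoly. (\<forall>v\<in>V. F v \<in> forms V (d v)) \<longrightarrow>
       (mpoly_eval of_int (form_coeffs F) R = 0 \<longleftrightarrow> has_nonzero_common_zero V F)) \<and>
    mpoly_eval (\<lambda>c. c) (form_coeffs (\<lambda>v. pure_power v (d v))) R = 1"

definition resultant_poly ::
    "'v set \<Rightarrow> ('v \<Rightarrow> nat) \<Rightarrow> ('v \<times> 'v monomial, int) mpoly" where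
  "resultant_poly V d = (THE R. is_resultant_poly V d R)"

definition multi_resultant ::
    "'v set \<Rightarrow> ('v \<Rightarrow> nat) \<Rightarrow> ('v \<Rightarrow> ('v, 'a::comm_ring_1) mpoly) \<Rightarrow> 'a" where
  "multi_resultant V d F = mpoly_eval of_int (form_coeffs F) (resultant_poly V d)"

section \<open>Hypergraphs\<close>

text \<open>
  A hypergraph is a pair of a vertex set and an edge set.  The forms below have coefficients in the
  ring of integer polynomials, whose indeterminate \<open>[:0, 1:]\<close> plays the role of \<open>\<lambda>\<close>:
  \[ F_v = \lambda x_v^{k-1} - \sum_{e \ni v} \prod_{u \in e - \{v\}} x_u. \]
  The factor \<open>1 / (k-1)!\<close> of the normalized adjacency hypermatrix cancels against the
  \<open>(k-1)!\<close> orderings of \<open>e - {v}\<close>.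
\<close>

type_synonym 'v hypergraph = "'v set \<times> 'v set set"

definition char_form :: "nat \<Rightarrow> 'v hypergraph \<Rightarrow> 'v \<Rightarrow> ('v, int poly) mpoly" where
  "char_form k H v =
    Poly_Mapping.single (Poly_Mapping.single v (k - 1)) [:0, 1:] -
    (\<Sum>e\<in>{e \<in> snd H. v \<in> e}.
       Poly_Mapping.single (\<Sum>u\<in>e - {v}. Poly_Mapping.single u 1) 1)"

definition hypergraph_char_poly :: "nat \<Rightarrow> 'v hypergraph \<Rightarrow> int poly" where
  "hypergraph_char_poly k H = multi_resultant (fst H) (\<lambda>_. k - 1) (char_form k H)"

datatype sunflower_vertex = Seed nat | Petal nat nat

definition seeds :: "nat \<Rightarrow> sunflower_vertex set" where
  "seeds q = Seed ` {1..q}"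

definition petal :: "nat \<Rightarrow> nat \<Rightarrow> nat \<Rightarrow> sunflower_vertex set" where
  "petal q k i = Petal i ` {1..k - q}"

text \<open>Meaningful for \<open>0 < m\<close> and \<open>0 < q < k\<close>; the hypergraph is then \<open>k\<close>-uniform.\<close>

definition sunflower :: "nat \<Rightarrow> nat \<Rightarrow> nat \<Rightarrow> sunflower_vertex hypergraph" where
  "sunflower m q k =
    (seeds q \<union> (\<Union>i\<in>{1..m}. petal q k i),
     (\<lambda>i. seeds q \<union> petal q k i) ` {1..m})"

end

theory Submission
  imports
    Defs
    "HOL-Library.Product_Lexorder"
    "HOL-Combinatorics.Permutations"
    "HOL-Computational_Algebra.Fundamental_Theorem_Algebra"
    "HOL-Analysis.Continuum_Not_Denumerable"
begin

text \<open>
  Systems of forms with a common zero are parametrized by affine spaces, so the integer polynomials in the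
  coefficients that vanish on them form a prime ideal. It contains Macaulay's determinants, and no nonzero
  element of it is free of the coefficient of a pure power. By Gauss's lemma it is therefore generated by a
  single irreducible polynomial, the resultant; the projective Nullstellensatz shows that the resultant
  vanishes only at systems with a common zero.

  The Macaulay determinants bound the degree of the resultant in the coefficients of each form, and
  root counting turns this bound into a Poisson formula: if the forms other than \<open>F v\<close> have as many
  common zeros \<open>x\<close> with \<open>x v = 1\<close> as the bound allows, then the resultant is the product of the values
  \<open>F v x\<close>, up to a factor that does not depend on \<open>F v\<close>. For the sunflower and the seed \<open>v\<close> there are
  \<open>4 ^ n\<close> such zeros: in each petal the coordinates are \<open>(0, 0)\<close> or \<open>(\<omega> / \<lambda>, \<omega>\<^sup>2 / \<lambda>)\<close> with \<open>\<omega>\<^sup>3 = 1\<close>, and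
  if \<open>r\<close> petals are nonzero then \<open>F v x = \<lambda> - r / \<lambda>\<^sup>2\<close>.
\<close>

section \<open>Evaluation of polynomials in several variables\<close>

text \<open>\<open>resultant_poly\<close> is a definite description, so nothing can be said about it
  before exactly one polynomial is known to satisfy \<open>is_resultant_poly\<close>. Uniqueness
  rests on divisibility: every candidate vanishes on the systems with a common zero, hence is a
  multiple of the generator; irreducibility makes the cofactor a unit, and the normalization makes
  this unit 1. The Macaulay determinant supplies the normalization: its value 1 at the pure powers
  forces the value 1 or -1 on its prime factor. Primes are found among the polynomials in the
  finitely many coefficients of the forms, whereas \<open>irreducible\<close> refers to the whole
  polynomial type; hence divisibility relative to a subring. The Poisson formula leaves its constant
  factor open: the resultant with \<open>F v\<close> replaced by a pure power. It is found by
  deforming the other forms to pure powers and scaling, which needs the exact degree of the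
  resultant in each group of coefficients, not only the bound. All values are computed at nonzero
  complex \<lambda>, since the zeros of the sunflower have \<lambda> in the denominator, and are
  then carried back to integer polynomials.\<close>

abbreviation "lookup \<equiv> Poly_Mapping.lookup"
abbreviation "keys \<equiv> Poly_Mapping.keys"
abbreviation "single \<equiv> Poly_Mapping.single"

text \<open>Ring homomorphisms as a locale predicate, so that the inclusion of the integers,
  evaluation at a point and substitution into one-variable polynomials all go through the same
  evaluation lemmas.\<close>

locale coeff_hom =
  fixes h :: "'a::comm_ring_1 \<Rightarrow> 'b::comm_ring_1"
  assumes h_one: "h 1 = 1"
    and h_add: "h (a + b) = h a + h b"
    and h_mult: "h (a * b) = h a * h b"
begin

lemma h_zero: "h 0 = 0"
  using h_add[of 0 0] by simp

lemma h_minus: "h (- a) = - h a"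
  using h_add[of a "- a"] by (simp add: h_zero eq_neg_iff_add_eq_0 add.commute)

lemma h_diff: "h (a - b) = h a - h b"
  using h_add[of a "- b"] by (simp add: h_minus)

lemma h_sum: "h (sum f A) = (\<Sum>i\<in>A. h (f i))"
  by (induction A rule: infinite_finite_induct) (auto simp: h_add h_zero)

lemma h_prod: "h (prod f A) = (\<Prod>i\<in>A. h (f i))"
  by (induction A rule: infinite_finite_induct) (auto simp: h_mult h_one)

lemma h_power: "h (a ^ n) = h a ^ n"
  by (induction n) (auto simp: h_mult h_one)

end

text \<open>Compatibility with \<open>pCons\<close> gives additivity and multiplicativity by
  induction. It serves for substituting a variable into a complex polynomial (\<open>at_var\<close>)
  and for specializing \<lambda> in the final theorem.\<close>

lemma (in coeff_hom) coeff_hom_poly_map_poly: "coeff_hom (\<lambda>p. poly (map_poly h p) x)"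
proof -
  let ?\<phi> = "\<lambda>p. poly (map_poly h p) x"
  have pCons: "?\<phi> (pCons a p) = h a + x * ?\<phi> p" for a p
    by (cases "a = 0 \<and> p = 0") (auto simp: map_poly_pCons h_zero)
  have add: "?\<phi> (p + q) = ?\<phi> p + ?\<phi> q" for p q
    by (induction p q rule: poly_induct2) (auto simp: pCons h_add algebra_simps)
  have smult: "?\<phi> (smult c p) = h c * ?\<phi> p" for c p
    by (induction p) (auto simp: pCons h_mult algebra_simps)
  have mult: "?\<phi> (p * q) = ?\<phi> p * ?\<phi> q" for p q
    by (induction p) (auto simp: add smult pCons h_zero algebra_simps)
  show ?thesis
    by unfold_locales (auto simp: add mult one_pCons pCons h_one)
qed

lemma coeff_hom_of_int: "coeff_hom (of_int :: int \<Rightarrow> 'a::comm_ring_1)"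
  by unfold_locales auto

lemma coeff_hom_id: "coeff_hom (\<lambda>c::'a::comm_ring_1. c)"
  by unfold_locales auto

lemma coeff_hom_poly: "coeff_hom (\<lambda>p::'a::comm_ring_1 poly. poly p a)"
  by unfold_locales auto

lemma coeff_hom_const_poly: "coeff_hom (\<lambda>c::'a::comm_ring_1. [:c:])"
  by unfold_locales (auto simp: one_pCons)

definition monomial_eval :: "('v \<Rightarrow> 'b::comm_ring_1) \<Rightarrow> 'v monomial \<Rightarrow> 'b" where
  "monomial_eval x m = (\<Prod>v\<in>keys m. x v ^ lookup m v)"

lemma monomial_eval_superset:
  assumes "finite S" "keys m \<subseteq> S"
  shows "monomial_eval x m = (\<Prod>v\<in>S. x v ^ lookup m v)"
  unfolding monomial_eval_def using assms
  by (intro prod.mono_neutral_left) (auto simp: in_keys_iff)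

lemma monomial_eval_zero [simp]: "monomial_eval x 0 = 1"
  by (simp add: monomial_eval_def)

lemma monomial_eval_single [simp]: "monomial_eval x (single v k) = x v ^ k"
  by (cases "k = 0") (auto simp: monomial_eval_def)

lemma monomial_eval_add: "monomial_eval x (m + m') = monomial_eval x m * monomial_eval x m'"
proof -
  let ?S = "keys m \<union> keys m'"
  have "keys (m + m') \<subseteq> ?S"
    by (rule keys_add)
  then show ?thesis
    by (simp add: monomial_eval_superset[of ?S] lookup_add power_add prod.distrib)
qed

lemma mpoly_eval_altdef:
  "mpoly_eval h x p = (\<Sum>m\<in>keys p. h (lookup p m) * monomial_eval x m)"
  by (simp add: mpoly_eval_def monomial_eval_def)

lemma poly_mapping_sum_single:
  "p = (\<Sum>m\<in>keys p. single m (lookup p m))"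
  by (rule poly_mapping_eqI) (simp add: lookup_sum lookup_single when_def sum.delta in_keys_iff)

lemma poly_mapping_sum_single_superset:
  assumes "finite S" "keys p \<subseteq> S"
  shows "p = (\<Sum>m\<in>S. single m (lookup p m))"
  using assms
  by (intro poly_mapping_eqI) (auto simp: lookup_sum lookup_single when_def sum.delta in_keys_iff)

context coeff_hom
begin

lemma mpoly_eval_superset:
  assumes "finite S" "keys p \<subseteq> S"
  shows "mpoly_eval h x p = (\<Sum>m\<in>S. h (lookup p m) * monomial_eval x m)"
  unfolding mpoly_eval_altdef using assms
  by (intro sum.mono_neutral_left) (auto simp: in_keys_iff h_zero)

lemma mpoly_eval_single [simp]:
  "mpoly_eval h x (single m c) = h c * monomial_eval x m"
  by (subst mpoly_eval_superset[of "{m}"]) (auto simp: h_zero)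

lemma mpoly_eval_zero [simp]: "mpoly_eval h x 0 = 0"
  by (simp add: mpoly_eval_def)

lemma mpoly_eval_one [simp]: "mpoly_eval h x 1 = 1"
  by (simp add: mpoly_eval_altdef h_one)

lemma mpoly_eval_add: "mpoly_eval h x (p + q) = mpoly_eval h x p + mpoly_eval h x q"
proof -
  let ?S = "keys p \<union> keys q"
  have "keys (p + q) \<subseteq> ?S"
    by (rule keys_add)
  then show ?thesis
    by (simp add: mpoly_eval_superset[of ?S] lookup_add h_add algebra_simps sum.distrib)
qed

lemma mpoly_eval_sum: "mpoly_eval h x (sum f A) = (\<Sum>i\<in>A. mpoly_eval h x (f i))"
  by (induction A rule: infinite_finite_induct) (auto simp: mpoly_eval_add)

lemma mpoly_eval_mult: "mpoly_eval h x (p * q) = mpoly_eval h x p * mpoly_eval h x q"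
proof -
  have "mpoly_eval h x (p * q) = mpoly_eval h x
     ((\<Sum>m\<in>keys p. single m (lookup p m)) *
      (\<Sum>m\<in>keys q. single m (lookup q m)))"
    by (metis poly_mapping_sum_single)
  also have "\<dots> = mpoly_eval h x p * mpoly_eval h x q"
    unfolding mpoly_eval_altdef[of h x p] mpoly_eval_altdef[of h x q]
    by (simp add: sum_product mpoly_eval_sum mult_single h_mult monomial_eval_add mult_ac)
  finally show ?thesis .
qed

lemma coeff_hom_mpoly_eval: "coeff_hom (mpoly_eval h x)"
  by unfold_locales (simp_all add: mpoly_eval_add mpoly_eval_mult)

lemma hom_mpoly_eval:
  "h (mpoly_eval g x p) = mpoly_eval (\<lambda>c. h (g c)) (\<lambda>v. h (x v)) p"
  by (simp add: mpoly_eval_def h_sum h_mult h_prod h_power)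

lemma hom_monomial_eval: "h (monomial_eval x m) = monomial_eval (\<lambda>v. h (x v)) m"
  by (simp add: monomial_eval_def h_prod h_power)

lemma hom_of_int: "h (of_int k) = of_int k"
proof -
  have nat: "h (of_nat n) = of_nat n" for n
    by (induction n) (auto simp: h_add h_zero h_one)
  show ?thesis
    by (cases k) (auto simp: nat h_minus h_diff h_one)
qed

end

lemma mpoly_eval_cong:
  assumes "\<And>v. v \<in> mpoly_vars p \<Longrightarrow> x v = y v"
  shows "mpoly_eval h x p = mpoly_eval h y p"
  unfolding mpoly_eval_def
  by (intro sum.cong refl arg_cong2[where f = "(*)"] prod.cong)
    (metis UN_I assms mpoly_vars_def)

abbreviation eval_int :: "('v \<Rightarrow> 'b::comm_ring_1) \<Rightarrow> ('v, int) mpoly \<Rightarrow> 'b" where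
  "eval_int \<equiv> mpoly_eval of_int"

interpretation eval_int: coeff_hom "of_int :: int \<Rightarrow> 'b::comm_ring_1"
  by (rule coeff_hom_of_int)

interpretation eval_id: coeff_hom "\<lambda>c::'b::comm_ring_1. c"
  by (rule coeff_hom_id)

interpretation eval_int_hom: coeff_hom "eval_int x" for x :: "'v \<Rightarrow> 'b::comm_ring_1"
  by (rule eval_int.coeff_hom_mpoly_eval)

text \<open>Homomorphisms fix the images of the integers, so only the point is transformed. All
  arguments with coefficients depending on a parameter are carried by this rule.\<close>

lemma (in coeff_hom) hom_eval_int: "h (eval_int x p) = eval_int (\<lambda>v. h (x v)) p"
  by (simp add: hom_mpoly_eval hom_of_int)

definition mvar :: "'v \<Rightarrow> ('v, 'a::comm_ring_1) mpoly" where
  "mvar v = single (single v 1) 1"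

lemma (in coeff_hom) mpoly_eval_mvar [simp]: "mpoly_eval h x (mvar v) = x v"
  by (simp add: mvar_def h_one)

lemma single_eq_monomial_eval_mvar:
  "single m (c::'a::comm_ring_1) = single 0 c * monomial_eval mvar m"
proof -
  have pw: "mvar v ^ k = single (single v k) (1::'a)" for v :: 'b and k
  proof (induction k)
    case (Suc k)
    have "single v (Suc k) = single v 1 + single v k"
      by (simp flip: single_add)
    then show ?case
      unfolding power_Suc Suc.IH by (metis mult_1 mult_single mvar_def)
  qed simp
  have pr: "(\<Prod>v\<in>S. mvar v ^ f v) = single (\<Sum>v\<in>S. single v (f v)) (1::'a)"
    if "finite S" for S :: "'b set" and f
    using that
    by (induction S) (auto simp: pw mult_single)
  show ?thesis
    unfolding monomial_eval_def
    using poly_mapping_sum_single[of m, symmetric] by (subst pr) (simp_all add: mult_single)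
qed

lemma single_zero_int: "single 0 k = of_int k"
  by (metis id_apply of_int_eq_id single_of_int)

text \<open>The variables form the generic point. A polynomial into which a new parameter has been
  inserted is recovered by setting the parameter to 1 at this point.\<close>

lemma eval_int_mvar: "eval_int mvar p = p"
proof -
  have "eval_int mvar p = (\<Sum>m\<in>keys p. single m (lookup p m))"
    unfolding mpoly_eval_altdef
    by (intro sum.cong refl, subst single_eq_monomial_eval_mvar) (simp add: single_zero_int)
  then show ?thesis using poly_mapping_sum_single[of p, symmetric] by simp
qed

section \<open>Polynomials in a given set of variables\<close>

definition mpolys :: "'v set \<Rightarrow> ('v, 'a::zero) mpoly set" where
  "mpolys V = {p. mpoly_vars p \<subseteq> V}"

lemma mpolys_iff: "p \<in> mpolys V \<longleftrightarrow> (\<forall>m\<in>keys p. keys m \<subseteq> V)"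
  by (auto simp: mpolys_def mpoly_vars_def)

lemma mpolys_mono: "V \<subseteq> W \<Longrightarrow> mpolys V \<subseteq> mpolys W"
  by (auto simp: mpolys_def)

lemma mpolys_single: "keys m \<subseteq> V \<Longrightarrow> single m c \<in> mpolys V"
  by (auto simp: mpolys_iff)

lemma mpolys_zero: "0 \<in> mpolys V" by (auto simp: mpolys_iff)

lemma mpolys_one: "1 \<in> mpolys V" by (auto simp: mpolys_iff)

lemma mpolys_mvar: "v \<in> V \<Longrightarrow> mvar v \<in> mpolys V"
  unfolding mvar_def by (rule mpolys_single) auto

lemma mpolys_add: "p \<in> mpolys V \<Longrightarrow> q \<in> mpolys V \<Longrightarrow> p + q \<in> mpolys V"
  using keys_add[of p q] by (auto simp: mpolys_iff)

lemma mpolys_uminus: "p \<in> mpolys V \<Longrightarrow> - p \<in> mpolys V"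
  for p :: "('v, 'a::comm_ring_1) mpoly"
  by (auto simp: mpolys_iff in_keys_iff)

lemma mpolys_diff: "p \<in> mpolys V \<Longrightarrow> q \<in> mpolys V \<Longrightarrow> p - q \<in> mpolys V"
  for p :: "('v, 'a::comm_ring_1) mpoly"
  using mpolys_add[of p V "- q"] mpolys_uminus[of q V] by simp

lemma mpolys_mult: "p \<in> mpolys V \<Longrightarrow> q \<in> mpolys V \<Longrightarrow> p * q \<in> mpolys V"
proof -
  assume p: "p \<in> mpolys V" and q: "q \<in> mpolys V"
  show "p * q \<in> mpolys V"
    unfolding mpolys_iff
  proof
    fix m assume "m \<in> keys (p * q)"
    then obtain a b where "m = a + b" "a \<in> keys p" "b \<in> keys q"
      using keys_mult by blast
    then show "keys m \<subseteq> V"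
      using p q keys_add[of a b] unfolding mpolys_iff by blast
  qed
qed

lemma mpolys_sum: "(\<And>i. i \<in> A \<Longrightarrow> f i \<in> mpolys V) \<Longrightarrow> sum f A \<in> mpolys V"
  by (induction A rule: infinite_finite_induct) (auto intro: mpolys_zero mpolys_add)

lemma mpolys_prod: "(\<And>i. i \<in> A \<Longrightarrow> f i \<in> mpolys V) \<Longrightarrow> prod f A \<in> mpolys V"
  for f :: "'i \<Rightarrow> ('v, 'a::comm_ring_1) mpoly"
  by (induction A rule: infinite_finite_induct) (auto intro: mpolys_one mpolys_mult)

lemma mpolys_power: "p \<in> mpolys V \<Longrightarrow> p ^ n \<in> mpolys V"
  for p :: "('v, 'a::comm_ring_1) mpoly"
  by (induction n) (auto intro: mpolys_one mpolys_mult)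

lemma mpolys_of_int: "of_int k \<in> mpolys V"
  unfolding single_of_int[symmetric] by (rule mpolys_single) auto

lemma finite_mpoly_vars: "finite (mpoly_vars p)"
  by (auto simp: mpoly_vars_def)

lemma mpolys_empty: "mpolys {} = range (of_int :: int \<Rightarrow> ('v, int) mpoly)"
proof (intro equalityI subsetI)
  fix p :: "('v, int) mpoly" assume "p \<in> mpolys {}"
  then have "keys p \<subseteq> {0}"
    by (auto simp: mpolys_iff)
  then have "p = single 0 (lookup p 0)"
    using poly_mapping_sum_single_superset[of "{0}" p] by simp
  then have "p = of_int (lookup p 0)"
    by (simp add: single_zero_int)
  then show "p \<in> range of_int" by blast
qed (auto intro: mpolys_of_int)

section \<open>Factorial subrings and Gauss's lemma\<close>

text \<open>Relative to a carrier set instead of a type class: the rings in the induction over the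
  variables are subsets of one polynomial type, not types of their own.\<close>

definition dvd_in :: "'a::idom set \<Rightarrow> 'a \<Rightarrow> 'a \<Rightarrow> bool" where
  "dvd_in A a b \<longleftrightarrow> (\<exists>c\<in>A. b = a * c)"

definition unit_in :: "'a::idom set \<Rightarrow> 'a \<Rightarrow> bool" where
  "unit_in A a \<longleftrightarrow> a \<in> A \<and> dvd_in A a 1"

definition prime_in :: "'a::idom set \<Rightarrow> 'a \<Rightarrow> bool" where
  "prime_in A p \<longleftrightarrow> p \<in> A \<and> p \<noteq> 0 \<and> \<not> unit_in A p \<and>
    (\<forall>a\<in>A. \<forall>b\<in>A. dvd_in A p (a * b) \<longrightarrow> dvd_in A p a \<or> dvd_in A p b)"

definition irreducible_in :: "'a::idom set \<Rightarrow> 'a \<Rightarrow> bool" where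
  "irreducible_in A p \<longleftrightarrow> p \<in> A \<and> p \<noteq> 0 \<and> \<not> unit_in A p \<and>
    (\<forall>a\<in>A. \<forall>b\<in>A. p = a * b \<longrightarrow> unit_in A a \<or> unit_in A b)"

text \<open>A domain is factorial exactly if each nonzero element is a unit times a product of
  primes. This form of factoriality allows induction over the factors, and primality makes
  uniqueness automatic.\<close>

inductive_set prime_products :: "'a::idom set \<Rightarrow> 'a set" for A where
  unit: "unit_in A u \<Longrightarrow> u \<in> prime_products A"
| mult: "prime_in A p \<Longrightarrow> a \<in> prime_products A \<Longrightarrow> p * a \<in> prime_products A"

locale subring_of =
  fixes A :: "'a::idom set"
  assumes zero_mem: "0 \<in> A" and one_mem: "1 \<in> A"
    and add_mem: "a \<in> A \<Longrightarrow> b \<in> A \<Longrightarrow> a + b \<in> A"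
    and uminus_mem: "a \<in> A \<Longrightarrow> - a \<in> A"
    and mult_mem: "a \<in> A \<Longrightarrow> b \<in> A \<Longrightarrow> a * b \<in> A"
begin

lemma diff_mem: "a \<in> A \<Longrightarrow> b \<in> A \<Longrightarrow> a - b \<in> A"
  using add_mem[of a "- b"] uminus_mem by simp

lemma sum_mem: "(\<And>i. i \<in> S \<Longrightarrow> f i \<in> A) \<Longrightarrow> sum f S \<in> A"
  by (induction S rule: infinite_finite_induct) (auto intro: zero_mem add_mem)

lemma dvd_in_add: "dvd_in A p a \<Longrightarrow> dvd_in A p b \<Longrightarrow> dvd_in A p (a + b)"
  unfolding dvd_in_def by (metis add_mem distrib_left)

lemma dvd_in_diff: "dvd_in A p a \<Longrightarrow> dvd_in A p b \<Longrightarrow> dvd_in A p (a - b)"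
  unfolding dvd_in_def by (metis diff_mem right_diff_distrib)

lemma dvd_in_mult: "dvd_in A p a \<Longrightarrow> b \<in> A \<Longrightarrow> dvd_in A p (a * b)"
  unfolding dvd_in_def by (metis mult_mem mult.assoc)

lemma dvd_in_mult2: "dvd_in A p a \<Longrightarrow> b \<in> A \<Longrightarrow> dvd_in A p (b * a)"
  using dvd_in_mult[of p a b] by (simp add: mult.commute)

lemma dvd_in_sum: "(\<And>i. i \<in> S \<Longrightarrow> dvd_in A p (f i)) \<Longrightarrow> dvd_in A p (sum f S)"
proof (induction S rule: infinite_finite_induct)
  case (insert x S)
  then show ?case by (auto intro: dvd_in_add)
qed (use zero_mem in \<open>force simp: dvd_in_def\<close>)+

lemma unit_in_dvd: "unit_in A u \<Longrightarrow> dvd_in A a u \<Longrightarrow> a \<in> A \<Longrightarrow> unit_in A a"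
proof -
  assume u: "unit_in A u" "dvd_in A a u" and a: "a \<in> A"
  from u(1) obtain v where v: "v \<in> A" "1 = u * v" unfolding unit_in_def dvd_in_def by blast
  from u(2) obtain c where c: "c \<in> A" "u = a * c" unfolding dvd_in_def by blast
  have "1 = a * (c * v)" unfolding v(2) c(2) by (rule mult.assoc)
  then show "unit_in A a" unfolding unit_in_def dvd_in_def using a c(1) v(1) mult_mem by blast
qed

lemma unit_in_one: "unit_in A 1"
  unfolding unit_in_def dvd_in_def using one_mem by (metis mult_1)

lemma unit_in_mult: "unit_in A u \<Longrightarrow> unit_in A v \<Longrightarrow> unit_in A (u * v)"
proof -
  assume "unit_in A u" "unit_in A v"
  then obtain u' v' where "u' \<in> A" "v' \<in> A" "u \<in> A" "v \<in> A" "u * u' = 1" "v * v' = 1"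
    unfolding unit_in_def dvd_in_def by metis
  moreover have "u * v * (u' * v') = (u * u') * (v * v')" by (simp only: mult_ac)
  ultimately have "1 = u * v * (u' * v')" "u' * v' \<in> A" "u * v \<in> A"
    by (simp_all only: mult_mem mult_1)
  then show ?thesis unfolding unit_in_def dvd_in_def by blast
qed

lemma prime_products_mult:
  "a \<in> prime_products A \<Longrightarrow> b \<in> prime_products A \<Longrightarrow> a * b \<in> prime_products A"
proof (induction a rule: prime_products.induct)
  case (unit u)
  from unit(2,1) show ?case
  proof (induction b rule: prime_products.induct)
    case (unit v)
    then show ?case by (intro prime_products.unit unit_in_mult)
  next
    case (mult p a)
    then have "p * (u * a) \<in> prime_products A" using prime_products.mult by blast
    then show ?case by (simp add: mult_ac)
  qed
next
  case (mult p a)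
  then show ?case by (simp add: mult.assoc prime_products.mult)
qed

lemma prime_products_mem: "a \<in> prime_products A \<Longrightarrow> a \<in> A"
  by (induction rule: prime_products.induct) (auto simp: unit_in_def prime_in_def mult_mem)

lemma prime_in_irreducible:
  assumes "prime_in A p" "a \<in> A" "b \<in> A" "p = a * b"
  shows "unit_in A a \<or> unit_in A b"
proof -
  have p0: "p \<noteq> 0" using assms by (auto simp: prime_in_def)
  have "dvd_in A p (a * b)"
    using assms by (metis dvd_in_def mult_1_right one_mem)
  with assms have "dvd_in A p a \<or> dvd_in A p b" unfolding prime_in_def by blast
  then show ?thesis
  proof
    assume "dvd_in A p a"
    then obtain c where c: "c \<in> A" "a = p * c" by (auto simp: dvd_in_def)
    then have "p * (b * c) = p * 1" using assms(4) by (metis mult.assoc mult.commute mult_1_right)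
    then have "b * c = 1" using p0 by (metis mult_left_cancel)
    then show ?thesis using c assms unfolding unit_in_def dvd_in_def by metis
  next
    assume "dvd_in A p b"
    then obtain c where c: "c \<in> A" "b = p * c" by (auto simp: dvd_in_def)
    then have "p * (a * c) = p * 1" using assms(4) by (metis mult.assoc mult.commute mult_1_right)
    then have "a * c = 1" using p0 by (metis mult_left_cancel)
    then show ?thesis using c assms unfolding unit_in_def dvd_in_def by metis
  qed
qed

end

locale factorial_subring = subring_of +
  assumes factor: "a \<in> A \<Longrightarrow> a \<noteq> 0 \<Longrightarrow> a \<in> prime_products A"

section \<open>One-variable polynomials over a factorial subring\<close>

definition polys_over :: "'a::zero set \<Rightarrow> 'a poly set" where
  "polys_over A = {p. \<forall>i. coeff p i \<in> A}"

context subring_of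
begin

abbreviation "AX \<equiv> polys_over A"

lemma subring_polys_over: "subring_of AX"
proof
  show "1 \<in> AX"
    unfolding polys_over_def mem_Collect_eq coeff_1 using one_mem zero_mem by simp
  show "p * q \<in> AX" if "p \<in> AX" "q \<in> AX" for p q
    using that unfolding polys_over_def mem_Collect_eq coeff_mult by (blast intro: sum_mem mult_mem)
qed (auto simp: polys_over_def zero_mem add_mem uminus_mem)

interpretation P: subring_of "AX"
  by (rule subring_polys_over)

lemma const_polys_over: "[:c:] \<in> AX \<longleftrightarrow> c \<in> A"
  by (auto simp: polys_over_def coeff_pCons zero_mem split: nat.split)

lemma monom_polys_over: "c \<in> A \<Longrightarrow> monom c k \<in> AX"
  by (auto simp: polys_over_def zero_mem)

lemma lead_coeff_mem: "p \<in> AX \<Longrightarrow> lead_coeff p \<in> A"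
  by (auto simp: polys_over_def)

lemma const_dvd_in_iff:
  assumes "f \<in> AX"
  shows "dvd_in AX [:c:] f \<longleftrightarrow> (\<forall>i. dvd_in A c (coeff f i))"
proof
  assume "dvd_in AX [:c:] f"
  then obtain q where "q \<in> AX" "f = [:c:] * q" by (auto simp: dvd_in_def)
  then show "\<forall>i. dvd_in A c (coeff f i)"
    by (auto simp: dvd_in_def polys_over_def)
next
  assume "\<forall>i. dvd_in A c (coeff f i)"
  then obtain g where g: "\<And>i. g i \<in> A" "\<And>i. coeff f i = c * g i"
    unfolding dvd_in_def by metis
  let ?q = "\<Sum>i\<le>degree f. monom (g i) i"
  have "?q \<in> AX"
    by (intro P.sum_mem monom_polys_over g)
  moreover have "f = [:c:] * ?q"
  proof (rule poly_eqI)
    fix i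
    show "coeff f i = coeff ([:c:] * ?q) i"
      using g(2)[of i] coeff_eq_0[of f i] by (auto simp: coeff_sum)
  qed
  ultimately show "dvd_in AX [:c:] f" by (auto simp: dvd_in_def)
qed

text \<open>Gauss's lemma. If \<open>i\<close> and \<open>j\<close> are the least indices at which
  \<open>p\<close> fails to divide a coefficient of \<open>f\<close> and of \<open>g\<close>, then
  \<open>p\<close> divides every term of the coefficient \<open>i + j\<close> of the product except
  one.\<close>

lemma prime_in_const:
  assumes p: "prime_in A p"
  shows "prime_in AX [:p:]"
proof -
  have pA: "p \<in> A" "p \<noteq> 0" "\<not> unit_in A p" using p by (auto simp: prime_in_def)
  have "\<not> unit_in AX [:p:]"
  proof
    assume "unit_in AX [:p:]"
    then have "dvd_in AX [:p:] 1" by (auto simp: unit_in_def)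
    then have "dvd_in A p (coeff 1 0)"
      using const_dvd_in_iff[OF P.one_mem] by blast
    then show False using pA by (auto simp: unit_in_def)
  qed
  moreover have "dvd_in AX [:p:] f \<or> dvd_in AX [:p:] g"
    if fg: "f \<in> AX" "g \<in> AX" "dvd_in AX [:p:] (f * g)" for f g
  proof (rule ccontr)
    assume "\<not> ?thesis"
    then have "\<exists>i. \<not> dvd_in A p (coeff f i)" "\<exists>i. \<not> dvd_in A p (coeff g i)"
      using const_dvd_in_iff fg by auto
    then obtain i j where i: "\<not> dvd_in A p (coeff f i)" "\<And>k. k < i \<Longrightarrow> dvd_in A p (coeff f k)"
      and j: "\<not> dvd_in A p (coeff g j)" "\<And>k. k < j \<Longrightarrow> dvd_in A p (coeff g k)"
      using exists_least_iff[of "\<lambda>i. \<not> dvd_in A p (coeff f i)"]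
        exists_least_iff[of "\<lambda>i. \<not> dvd_in A p (coeff g i)"] by blast
    have mem: "coeff f k \<in> A" "coeff g k \<in> A" for k using fg by (auto simp: polys_over_def)
    have "dvd_in A p (coeff (f * g) (i + j))"
      using fg const_dvd_in_iff P.mult_mem by blast
    also have "coeff (f * g) (i + j) = (\<Sum>k\<le>i + j. coeff f k * coeff g (i + j - k))"
      by (rule coeff_mult)
    also have "\<dots> = coeff f i * coeff g j + (\<Sum>k\<in>{..i + j} - {i}. coeff f k * coeff g (i + j - k))"
      by (subst sum.remove[of _ i]) auto
    finally have "dvd_in A p (coeff f i * coeff g j +
        (\<Sum>k\<in>{..i + j} - {i}. coeff f k * coeff g (i + j - k)))" .
    moreover have "dvd_in A p (\<Sum>k\<in>{..i + j} - {i}. coeff f k * coeff g (i + j - k))"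
    proof (rule dvd_in_sum)
      fix k assume k: "k \<in> {..i + j} - {i}"
      show "dvd_in A p (coeff f k * coeff g (i + j - k))"
      proof (cases "k < i")
        case True
        then show ?thesis using i mem by (intro dvd_in_mult) auto
      next
        case False
        then have "i + j - k < j" using k by auto
        then show ?thesis using j mem by (intro dvd_in_mult2) auto
      qed
    qed
    ultimately have "dvd_in A p (coeff f i * coeff g j)"
      using dvd_in_diff by fastforce
    then show False using p i(1) j(1) mem unfolding prime_in_def by blast
  qed
  ultimately show ?thesis
    using pA by (auto simp: prime_in_def const_polys_over)
qed

text \<open>Content 1 expressed without greatest common divisors: over a factorial subring every
  nonzero constant that is not a unit has a prime divisor, so excluding prime constants excludes all
  of them.\<close>

definition primitive :: "'a poly \<Rightarrow> bool" where
  "primitive f \<longleftrightarrow> f \<in> AX \<and> f \<noteq> 0 \<and>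
     (\<forall>p. prime_in A p \<longrightarrow> \<not> dvd_in AX [:p:] f)"

text \<open>Multiplying by the leading coefficient of \<open>h\<close> before each subtraction
  replaces division in a field of fractions; \<open>c\<close> collects these multipliers.\<close>

lemma pseudo_division:
  assumes h: "h \<in> AX" "h \<noteq> 0" and f: "f \<in> AX"
  shows "\<exists>c\<in>A. \<exists>q\<in>AX. c \<noteq> 0 \<and> ([:c:] * f - q * h = 0 \<or> degree ([:c:] * f - q * h) < degree h)"
  using f
proof (induction "degree f" arbitrary: f rule: less_induct)
  case less
  show ?case
  proof (cases "degree f < degree h")
    case True
    then show ?thesis
      by (intro bexI[of _ 1] bexI[of _ 0]) (auto simp: zero_mem one_mem P.zero_mem one_pCons[symmetric])
  next
    case False
    let ?m = "monom (lead_coeff f) (degree f - degree h)"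
    let ?f = "[:lead_coeff h:] * f - ?m * h"
    have m: "?m \<in> AX" and l: "lead_coeff h \<in> A" "lead_coeff h \<noteq> 0"
      using less h by (auto intro!: monom_polys_over lead_coeff_mem)
    then have fP: "?f \<in> AX"
      by (intro P.diff_mem P.mult_mem) (auto simp: const_polys_over h less)
    show ?thesis
    proof (cases "?f = 0")
      case True
      then show ?thesis using l m by (intro bexI[of _ "lead_coeff h"] bexI[of _ ?m]) auto
    next
      case nz: False
      have "degree (?m * h) \<le> degree f"
        using degree_mult_le[of ?m h] degree_monom_le[of "lead_coeff f" "degree f - degree h"] False
        by linarith
      then have "degree ?f \<le> degree f"
        by (intro degree_diff_le) auto
      moreover have "coeff ?f (degree f) = 0"
        using False coeff_monom_mult[of "lead_coeff f" "degree f - degree h" h "degree f"]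
        by (simp add: mult.commute)
      ultimately have "degree ?f < degree f"
        using nz by (metis le_neq_implies_less leading_coeff_0_iff)
      from less(1)[OF this fP] obtain c q where cq: "c \<in> A" "q \<in> AX" "c \<noteq> 0"
        "[:c:] * ?f - q * h = 0 \<or> degree ([:c:] * ?f - q * h) < degree h" by blast
      have eq: "[:c * lead_coeff h:] * f - ([:c:] * ?m + q) * h = [:c:] * ?f - q * h"
        by (simp add: algebra_simps smult_diff_right)
      show ?thesis
        using cq l m unfolding eq[symmetric]
        by (intro bexI[of _ "c * lead_coeff h"] bexI[of _ "[:c:] * ?m + q"])
          (auto intro!: mult_mem P.add_mem P.mult_mem simp: const_polys_over simp del: mult_pCons_left)
    qed
  qed
qed

end

context factorial_subring
begin

interpretation P: subring_of "AX"
  by (rule subring_polys_over)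

lemma primitive_part:
  assumes "f \<in> AX" "f \<noteq> 0"
  shows "\<exists>c\<in>A. \<exists>g. c \<noteq> 0 \<and> f = [:c:] * g \<and> primitive g"
proof -
  have *: "(\<forall>f\<in>AX. f \<noteq> 0 \<longrightarrow> (\<forall>c\<in>A. dvd_in AX [:c:] f \<longrightarrow> dvd_in A c l)
      \<longrightarrow> (\<exists>c\<in>A. \<exists>g. c \<noteq> 0 \<and> f = [:c:] * g \<and> primitive g))"
    if "l \<in> prime_products A" for l
    using that
  proof (induction l rule: prime_products.induct)
    case (unit u)
    show ?case
    proof (intro ballI impI)
      fix f assume f: "f \<in> AX" "f \<noteq> 0"
        "\<forall>c\<in>A. dvd_in AX [:c:] f \<longrightarrow> dvd_in A c u"
      have "primitive f"
        using f unit unfolding primitive_def prime_in_def by (metis unit_in_dvd)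
      then show "\<exists>c\<in>A. \<exists>g. c \<noteq> 0 \<and> f = [:c:] * g \<and> primitive g"
        by (intro bexI[of _ 1] exI[of _ f]) (auto simp: one_mem)
    qed
  next
    case (mult p a)
    have p: "p \<in> A" "p \<noteq> 0" using mult by (auto simp: prime_in_def)
    have aA: "a \<in> A" using mult prime_products_mem by blast
    show ?case
    proof (intro ballI impI)
      fix f assume f: "f \<in> AX" "f \<noteq> 0"
        "\<forall>c\<in>A. dvd_in AX [:c:] f \<longrightarrow> dvd_in A c (p * a)"
      show "\<exists>c\<in>A. \<exists>g. c \<noteq> 0 \<and> f = [:c:] * g \<and> primitive g"
      proof (cases "dvd_in AX [:p:] f")
        case True
        then obtain f1 where f1: "f1 \<in> AX" "f = [:p:] * f1" by (auto simp: dvd_in_def)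
        have "dvd_in A c a" if c: "c \<in> A" "dvd_in AX [:c:] f1" for c
        proof -
          obtain g where g: "g \<in> AX" "f1 = [:c:] * g" using c by (auto simp: dvd_in_def)
          have "dvd_in AX [:p * c:] f"
            using g f1 by (auto simp: dvd_in_def mult_ac)
          with f(3) c p have "dvd_in A (p * c) (p * a)" using mult_mem by blast
          then show ?thesis using p by (auto simp: dvd_in_def)
        qed
        with mult(3) f1 f(2) obtain c g where "c \<in> A" "c \<noteq> 0" "f1 = [:c:] * g" "primitive g"
          by (metis mult_zero_right)
        then show ?thesis using f1 p
          by (intro bexI[of _ "p * c"] exI[of _ g]) (auto simp: mult_mem mult.commute)
      next
        case False
        have "dvd_in A c a" if c: "c \<in> A" "dvd_in AX [:c:] f" for c
        proof -
          from f(3) c obtain x where x: "x \<in> A" "p * a = c * x" by (auto simp: dvd_in_def)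
          then have "dvd_in A p (c * x)" using aA unfolding dvd_in_def by metis
          then have "dvd_in A p c \<or> dvd_in A p x" using mult(1) c x by (auto simp: prime_in_def)
          moreover have "\<not> dvd_in A p c"
          proof
            assume "dvd_in A p c"
            then obtain y where "y \<in> A" "c = p * y" by (auto simp: dvd_in_def)
            moreover obtain g where "g \<in> AX" "f = [:c:] * g"
              using c by (auto simp: dvd_in_def)
            ultimately have "f = [:p:] * ([:y:] * g)" "[:y:] * g \<in> AX"
              using P.mult_mem[of "[:y:]" g] const_polys_over[of y] by (auto simp: mult.commute)
            then show False using False unfolding dvd_in_def by blast
          qed
          ultimately obtain y where "y \<in> A" "x = p * y" by (auto simp: dvd_in_def)
          with x p have "y \<in> A" "a = c * y" by (auto simp: mult.left_commute)
          then show ?thesis by (auto simp: dvd_in_def)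
        qed
        with mult(3) f show ?thesis by blast
      qed
    qed
  qed
  have "\<forall>c\<in>A. dvd_in AX [:c:] f \<longrightarrow> dvd_in A c (lead_coeff f)"
    using const_dvd_in_iff assms by blast
  moreover have "lead_coeff f \<in> prime_products A"
    using assms factor[OF lead_coeff_mem] by auto
  ultimately show ?thesis using * assms by blast
qed

text \<open>The primes of \<open>r\<close> are removed one at a time: each divides
  \<open>f * q\<close> but not the primitive \<open>f\<close>, hence divides \<open>q\<close> by
  Gauss's lemma.\<close>

lemma primitive_cancel:
  assumes f: "primitive f" and "r \<in> A" "r \<noteq> 0"
    and "q \<in> AX" "b \<in> AX" "f * q = [:r:] * b"
  shows "dvd_in AX f b"
proof -
  have "r \<in> prime_products A" using factor assms by blast
  then show ?thesis using assms(4-6)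
  proof (induction r arbitrary: q b rule: prime_products.induct)
    case (unit u)
    then obtain v where v: "v \<in> A" "u * v = 1" unfolding unit_in_def dvd_in_def by metis
    have "b = [:v * u:] * b" using v by (simp add: mult.commute)
    also have "\<dots> = [:v:] * ([:u:] * b)" by (simp add: mult.commute)
    also have "\<dots> = f * ([:v:] * q)" using unit by (metis mult.left_commute)
    finally show ?case
      unfolding dvd_in_def using v unit const_polys_over P.mult_mem by blast
  next
    case (mult p a)
    have p: "p \<noteq> 0" using mult(1) by (auto simp: prime_in_def)
    have aA: "a \<in> A" using mult prime_products_mem by blast
    have "f * q = [:p:] * ([:a:] * b)" using mult by (simp add: mult.commute)
    then have "dvd_in AX [:p:] (f * q)"
      using mult aA unfolding dvd_in_def by (metis P.mult_mem const_polys_over)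
    then have "dvd_in AX [:p:] f \<or> dvd_in AX [:p:] q"
      using prime_in_const[OF mult(1)] f mult(4) unfolding prime_in_def primitive_def by blast
    then have "dvd_in AX [:p:] q"
      using f mult(1) by (auto simp: primitive_def)
    then obtain q' where q': "q' \<in> AX" "q = [:p:] * q'" by (auto simp: dvd_in_def)
    have "[:p:] * (f * q') = [:p:] * ([:a:] * b)"
      using \<open>f * q = [:p:] * ([:a:] * b)\<close> q' by (simp only: mult.left_commute)
    then have "f * q' = [:a:] * b" using p by (metis mult_left_cancel pCons_eq_0_iff)
    then show ?case using mult.IH[of q' b] q' mult by blast
  qed
qed

lemma unit_in_polys_degree:
  assumes "unit_in AX f" shows "degree f = 0"
proof -
  obtain g where "1 = f * g" using assms by (auto simp: unit_in_def dvd_in_def)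
  then show ?thesis by (metis degree_1 degree_mult_eq add_is_0 mult_zero_left mult_zero_right zero_neq_one)
qed

text \<open>A Bezout relation with cleared denominators. Take a nonzero element \<open>h\<close> of
  least degree in the ideal generated by \<open>f\<close> and \<open>g\<close>. If \<open>h\<close>
  is not constant, pseudo-division shows that its primitive part divides both; by irreducibility it
  is associated to \<open>f\<close>, and \<open>f\<close> would divide \<open>g\<close>.\<close>

lemma elimination:
  assumes f: "primitive f" "irreducible_in AX f" "degree f > 0"
    and g: "g \<in> AX" and ndvd: "\<not> dvd_in AX f g"
  shows "\<exists>u\<in>AX. \<exists>v\<in>AX. \<exists>r\<in>A. r \<noteq> 0 \<and> u * f + v * g = [:r:]"
proof -
  define J where "J = {h. \<exists>u\<in>AX. \<exists>v\<in>AX. h = u * f + v * g}"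
  have fP: "f \<in> AX" "f \<noteq> 0" using f by (auto simp: primitive_def)
  have JP: "J \<subseteq> AX"
    unfolding J_def using fP g by (auto intro!: P.add_mem P.mult_mem)
  have fJ: "f \<in> J" and gJ: "g \<in> J"
    unfolding J_def using bexI[OF bexI[OF _ P.zero_mem] P.one_mem, of "\<lambda>u v. f = u * f + v * g"]
      bexI[OF bexI[OF _ P.one_mem] P.zero_mem, of "\<lambda>u v. g = u * f + v * g"] by auto
  have Jcomb: "c * k - q * h \<in> J" if "k \<in> J" "h \<in> J" "c \<in> AX" "q \<in> AX" for c k q h
  proof -
    from that obtain u v u' v' where "u \<in> AX" "v \<in> AX" "u' \<in> AX"
      "v' \<in> AX" "k = u * f + v * g" "h = u' * f + v' * g"
      unfolding J_def by blast
    then have "c * k - q * h = (c * u - q * u') * f + (c * v - q * v') * g"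
      "c * u - q * u' \<in> AX" "c * v - q * v' \<in> AX"
      using that by (auto intro!: P.diff_mem P.mult_mem simp: algebra_simps)
    then show ?thesis unfolding J_def by blast
  qed
  obtain h where h: "h \<in> J" "h \<noteq> 0" "\<And>k. k \<in> J \<Longrightarrow> k \<noteq> 0 \<Longrightarrow> degree h \<le> degree k"
    using ex_has_least_nat[of "\<lambda>h. h \<in> J \<and> h \<noteq> 0" f degree] fJ fP by auto
  have hP: "h \<in> AX" using h JP by auto
  show ?thesis
  proof (cases "degree h = 0")
    case True
    then obtain r where "h = [:r:]" using degree_eq_zeroE by blast
    moreover from this have "r \<in> A" "r \<noteq> 0" using h hP const_polys_over by auto
    moreover obtain u v where "u \<in> AX" "v \<in> AX" "h = u * f + v * g"
      using h unfolding J_def by blast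
    ultimately show ?thesis by metis
  next
    case False
    obtain c0 h' where h': "c0 \<in> A" "c0 \<noteq> 0" "h = [:c0:] * h'" "primitive h'"
      using primitive_part[OF hP h(2)] by blast
    have h'P: "h' \<in> AX" using h' by (auto simp: primitive_def)
    have dvd: "dvd_in AX h' k" if k: "k \<in> J" for k
    proof -
      obtain c q where cq: "c \<in> A" "q \<in> AX" "c \<noteq> 0"
        "[:c:] * k - q * h = 0 \<or> degree ([:c:] * k - q * h) < degree h"
        using pseudo_division[OF hP h(2)] k JP by blast
      have "[:c:] * k - q * h \<in> J"
        using Jcomb k h cq const_polys_over by blast
      with cq(4) h(3) have "[:c:] * k - q * h = 0" by (meson not_less)
      then have "h' * ([:c0:] * q) = [:c:] * k"
        using h'(3) by (simp add: mult_ac)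
      then show ?thesis
        using primitive_cancel[OF h'(4) cq(1,3)] cq(2) h'(1) k JP const_polys_over P.mult_mem by blast
    qed
    obtain w where w: "w \<in> AX" "f = h' * w" using dvd[OF fJ] by (auto simp: dvd_in_def)
    have "degree h' > 0" using False h' by auto
    then have "\<not> unit_in AX h'" using unit_in_polys_degree by fastforce
    with f(2) w h'P have "unit_in AX w" unfolding irreducible_in_def by blast
    then obtain w' where "w' \<in> AX" "w * w' = 1" unfolding unit_in_def dvd_in_def by metis
    then have "h' = f * w'" using w by (simp add: mult.assoc)
    moreover obtain x where "x \<in> AX" "g = h' * x" using dvd[OF gJ] by (auto simp: dvd_in_def)
    ultimately have "dvd_in AX f g"
      unfolding dvd_in_def using \<open>w' \<in> AX\<close> by (metis P.mult_mem mult.assoc)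
    then show ?thesis using ndvd by blast
  qed
qed

text \<open>If \<open>f\<close> does not divide \<open>a\<close>, the relation
  \<open>u * f + v * a = [:r:]\<close> multiplied by \<open>b\<close> shows that \<open>f\<close>
  divides \<open>[:r:] * b\<close>; primitivity cancels the constant.\<close>

lemma primitive_irreducible_prime:
  assumes f: "primitive f" "irreducible_in AX f" "degree f > 0"
  shows "prime_in AX f"
proof -
  have "dvd_in AX f a \<or> dvd_in AX f b"
    if ab: "a \<in> AX" "b \<in> AX" "dvd_in AX f (a * b)" for a b
  proof (rule ccontr)
    assume *: "\<not> ?thesis"
    then obtain u v r where r: "u \<in> AX" "v \<in> AX" "r \<in> A" "r \<noteq> 0"
      "u * f + v * a = [:r:]" using elimination[OF f ab(1)] by blast
    obtain x where x: "x \<in> AX" "a * b = f * x" using ab by (auto simp: dvd_in_def)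
    have "[:r:] * b = u * f * b + v * (a * b)" using r(5) by (metis distrib_right mult.assoc)
    also have "\<dots> = f * (u * b + v * x)" unfolding x by (simp add: algebra_simps)
    finally have "dvd_in AX f b"
      using primitive_cancel[OF f(1) r(3,4) _ ab(2), of "u * b + v * x"] r x ab
      by (auto intro: P.add_mem P.mult_mem)
    with * show False by blast
  qed
  then show ?thesis using f(2) by (auto simp: prime_in_def irreducible_in_def)
qed

lemma const_prime_products:
  "a \<in> prime_products A \<Longrightarrow> [:a:] \<in> prime_products AX"
proof (induction rule: prime_products.induct)
  case (unit u)
  then obtain v where "v \<in> A" "u * v = 1" "u \<in> A" unfolding unit_in_def dvd_in_def by metis
  then have "[:u:] * [:v:] = 1" "[:v:] \<in> AX" "[:u:] \<in> AX"
    by (auto simp: const_polys_over one_pCons mult.commute)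
  then show ?case by (metis prime_products.unit unit_in_def dvd_in_def)
next
  case (mult p a)
  then have "[:p:] * [:a:] \<in> prime_products AX"
    by (intro prime_products.mult prime_in_const)
  then show ?case by (simp add: mult.commute)
qed

text \<open>Induction on the degree works because a constant factor of a primitive polynomial is a
  unit: in a factorization into nonunits both factors have positive, hence smaller, degree.\<close>

lemma primitive_prime_products:
  "primitive f \<Longrightarrow> f \<in> prime_products AX"
proof (induction "degree f" arbitrary: f rule: less_induct)
  case less
  have f: "f \<in> AX" "f \<noteq> 0" using less(2) by (auto simp: primitive_def)
  show ?case
  proof (cases "degree f = 0")
    case True
    then obtain a where a: "f = [:a:]" using degree_eq_zeroE by blast
    then show ?thesis using f const_polys_over factor const_prime_products by auto
  next
    case False
    show ?thesis
    proof (cases "irreducible_in AX f")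
      case True
      then have "prime_in AX f" using primitive_irreducible_prime less False by blast
      then have "f * 1 \<in> prime_products AX"
        by (intro prime_products.mult prime_products.unit P.unit_in_one)
      then show ?thesis by simp
    next
      case red: False
      have "\<not> unit_in AX f" using False unit_in_polys_degree[of f] by auto
      with red f obtain g h where gh: "g \<in> AX" "h \<in> AX" "f = g * h"
        "\<not> unit_in AX g" "\<not> unit_in AX h"
        unfolding irreducible_in_def by blast
      have pos: "degree g > 0" if gh: "g \<in> AX" "h \<in> AX" "f = g * h"
        "\<not> unit_in AX g" for g h
      proof (rule ccontr)
        assume "\<not> degree g > 0"
        then obtain a where a: "g = [:a:]" using degree_eq_zeroE by blast
        then have "a \<in> A" "a \<noteq> 0" using gh f const_polys_over by auto
        then have "a \<in> prime_products A" using factor by blast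
        then show False
        proof (cases rule: prime_products.cases)
          case unit
          then obtain b where b: "b \<in> A" "a * b = 1" unfolding unit_in_def dvd_in_def by metis
          then have "g * [:b:] = 1" by (simp add: a one_pCons mult.commute)
          then have "unit_in AX g"
            unfolding unit_in_def dvd_in_def using const_polys_over b(1) gh(1) by metis
          then show False using gh by blast
        next
          case (mult p b)
          then have "b \<in> A" using prime_products_mem by blast
          then have "[:b:] * h \<in> AX" using gh const_polys_over P.mult_mem by blast
          moreover have "f = [:p:] * ([:b:] * h)" unfolding gh(3) a mult(1) by (simp add: mult.commute)
          ultimately have "dvd_in AX [:p:] f" unfolding dvd_in_def by blast
          then show False using less(2) mult by (auto simp: primitive_def)
        qed
      qed
      have prim: "primitive g" if gh: "g \<in> AX" "h \<in> AX" "f = g * h" for g h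
        using less(2) gh P.dvd_in_mult unfolding primitive_def by (metis mult_zero_left)
      have d: "degree f = degree g + degree h"
        using gh f degree_mult_eq by fastforce
      have "degree g > 0" "degree h > 0"
        using pos[of g h] pos[of h g] gh by (auto simp: mult.commute)
      with d have "degree g < degree f" "degree h < degree f" by auto
      then have "g \<in> prime_products AX" "h \<in> prime_products AX"
        using less(1) prim[of g h] prim[of h g] gh by (auto simp: mult.commute)
      then show ?thesis unfolding gh(3) by (rule P.prime_products_mult)
    qed
  qed
qed

theorem factorial_polys_over: "factorial_subring AX"
proof
  fix f :: "'a poly" assume f: "f \<in> AX" "f \<noteq> 0"
  then obtain c g where c: "c \<in> A" "c \<noteq> 0" "f = [:c:] * g" "primitive g"
    using primitive_part by blast
  then show "f \<in> prime_products AX"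
    using factor const_prime_products primitive_prime_products P.prime_products_mult by blast
qed

end

section \<open>Transport to integer polynomials in finitely many variables\<close>

locale inj_hom_on = subring_of B + coeff_hom \<phi>
  for B :: "'b::idom set" and \<phi> :: "'b \<Rightarrow> 'a::idom" +
  assumes inj: "inj_on \<phi> B"
begin

lemma subring_image: "subring_of (\<phi> ` B)"
proof
  show "1 \<in> \<phi> ` B" using one_mem h_one by (metis image_eqI)
  show "0 \<in> \<phi> ` B" using zero_mem h_zero by (metis image_eqI)
  show "- a \<in> \<phi> ` B" if "a \<in> \<phi> ` B" for a
    using that uminus_mem h_minus by (metis image_iff)
  show "a + b \<in> \<phi> ` B" "a * b \<in> \<phi> ` B" if "a \<in> \<phi> ` B" "b \<in> \<phi> ` B" for a b
    using that add_mem h_add mult_mem h_mult by (smt (verit, ccfv_threshold) image_iff)+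
qed

lemma dvd_in_image:
  assumes "a \<in> B" "b \<in> B" shows "dvd_in (\<phi> ` B) (\<phi> a) (\<phi> b) \<longleftrightarrow> dvd_in B a b"
proof
  assume "dvd_in (\<phi> ` B) (\<phi> a) (\<phi> b)"
  then obtain c where c: "c \<in> B" "\<phi> b = \<phi> (a * c)" by (auto simp: dvd_in_def h_mult)
  then have "b = a * c" using inj assms mult_mem by (metis inj_onD)
  then show "dvd_in B a b" using c by (auto simp: dvd_in_def)
qed (auto simp: dvd_in_def h_mult)

lemma unit_in_image: "a \<in> B \<Longrightarrow> unit_in (\<phi> ` B) (\<phi> a) \<longleftrightarrow> unit_in B a"
  using dvd_in_image[of a 1] one_mem by (auto simp: unit_in_def h_one)

lemma image_zero_iff: "a \<in> B \<Longrightarrow> \<phi> a = 0 \<longleftrightarrow> a = 0"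
  using inj zero_mem h_zero by (metis inj_onD)

lemma prime_in_image: "prime_in B p \<Longrightarrow> prime_in (\<phi> ` B) (\<phi> p)"
  unfolding prime_in_def
  by (auto simp: unit_in_image image_zero_iff h_mult[symmetric] dvd_in_image mult_mem)

lemma prime_products_image: "a \<in> prime_products B \<Longrightarrow> \<phi> a \<in> prime_products (\<phi> ` B)"
proof (induction rule: prime_products.induct)
  case (unit u)
  then show ?case by (intro prime_products.unit) (auto simp: unit_in_image unit_in_def[of B])
next
  case (mult p a)
  then show ?case by (auto simp: h_mult intro!: prime_products.mult prime_in_image)
qed

lemma factorial_image:
  assumes "factorial_subring B" shows "factorial_subring (\<phi> ` B)"
proof -
  interpret F: factorial_subring B by fact
  interpret S: subring_of "\<phi> ` B" by (rule subring_image)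
  show ?thesis
  proof
    fix a assume "a \<in> \<phi> ` B" "a \<noteq> 0"
    then show "a \<in> prime_products (\<phi> ` B)"
      using F.factor prime_products_image image_zero_iff by blast
  qed
qed

end

lemma factorial_int: "factorial_subring (UNIV :: int set)"
proof -
  interpret subring_of "UNIV :: int set" by unfold_locales auto
  show ?thesis
  proof
    fix a :: int assume "a \<noteq> 0"
    then show "a \<in> prime_products UNIV"
    proof (induction a rule: prime_divisors_induct)
      case (unit x)
      then show ?case
        by (intro prime_products.unit) (auto simp: unit_in_def dvd_in_def dvd_def)
    next
      case (factor p x)
      then have p: "p \<noteq> 0" "\<not> p dvd 1" "\<And>a b. p dvd a * b \<Longrightarrow> p dvd a \<or> p dvd b"
        using prime_elem_def prime_def by metis+
      have dvd_eq: "dvd_in UNIV u v \<longleftrightarrow> u dvd v" for u v :: int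
        by (simp add: dvd_in_def dvd_def)
      from p have "prime_in UNIV p"
        by (simp add: prime_in_def unit_in_def dvd_eq)
      then show ?case using factor by (intro prime_products.mult) auto
    qed auto
  qed
qed

lemma subring_mpolys: "subring_of (mpolys V :: ('x::linorder, int) mpoly set)"
  by unfold_locales (auto intro: mpolys_zero mpolys_one mpolys_add mpolys_uminus mpolys_mult)

text \<open>Reads a polynomial as a one-variable polynomial in \<open>x\<close>. It is a left
  inverse of the substitution of \<open>mvar x\<close>, which is how that substitution is seen to be
  injective.\<close>

definition split_var :: "'x::linorder \<Rightarrow> ('x, int) mpoly \<Rightarrow> ('x, int) mpoly poly" where
  "split_var x = eval_int (\<lambda>i. if i = x then [:0, 1:] else [:mvar i:])"

lemma split_var_mpolys:
  assumes "p \<in> mpolys V" "x \<notin> V"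
  shows "split_var x p = [:p:]"
proof -
  have "split_var x p = eval_int (\<lambda>i. [:mvar i:]) p"
    unfolding split_var_def using assms by (intro mpoly_eval_cong) (auto simp: mpolys_def)
  also have "\<dots> = [:eval_int mvar p:]"
    by (rule coeff_hom.hom_eval_int[OF coeff_hom_const_poly, symmetric])
  finally show ?thesis by (simp add: eval_int_mvar)
qed

lemma split_var_poly:
  assumes "q \<in> polys_over (mpolys V)" "x \<notin> V"
  shows "split_var x (poly q (mvar x)) = q"
proof -
  have "split_var x (poly q (mvar x)) =
      (\<Sum>i\<le>degree q. split_var x (coeff q i) * split_var x (mvar x) ^ i)"
    unfolding poly_altdef split_var_def
    by (simp only: eval_int_hom.h_sum eval_int_hom.h_mult eval_int_hom.h_power)
  also have "split_var x (mvar x) = [:0, 1:]" by (simp add: split_var_def)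
  also have "(\<Sum>i\<le>degree q. split_var x (coeff q i) * [:0, 1:] ^ i) = (\<Sum>i\<le>degree q. monom (coeff q i) i)"
  proof (intro sum.cong refl)
    fix i
    have "coeff q i \<in> mpolys V" using assms by (auto simp: polys_over_def)
    then have "split_var x (coeff q i) = [:coeff q i:]"
      using split_var_mpolys assms(2) by blast
    then show "split_var x (coeff q i) * [:0, 1:] ^ i = monom (coeff q i) i"
      by (simp add: monom_altdef)
  qed
  finally show ?thesis by (simp add: poly_as_sum_of_monoms)
qed

lemma inj_hom_split_var:
  assumes "x \<notin> V"
  shows "inj_hom_on (polys_over (mpolys V)) (\<lambda>q. poly q (mvar x :: ('x::linorder, int) mpoly))"
proof -
  interpret subring_of "mpolys V :: ('x, int) mpoly set" by (rule subring_mpolys)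
  interpret P: subring_of "polys_over (mpolys V :: ('x, int) mpoly set)" by (rule subring_polys_over)
  show ?thesis
  proof unfold_locales
    show "inj_on (\<lambda>q. poly q (mvar x)) (polys_over (mpolys V :: ('x, int) mpoly set))"
      using split_var_poly assms by (intro inj_on_inverseI[where g = "split_var x"]) blast
  qed auto
qed

lemma mpolys_insert:
  fixes x :: "'x::linorder"
  shows "mpolys (insert x V) = (\<lambda>q. poly q (mvar x)) ` polys_over (mpolys V :: ('x, int) mpoly set)"
proof (intro equalityI subsetI)
  interpret subring_of "mpolys V :: ('x, int) mpoly set" by (rule subring_mpolys)
  interpret P: subring_of "polys_over (mpolys V :: ('x, int) mpoly set)" by (rule subring_polys_over)
  fix p :: "('x, int) mpoly" assume p: "p \<in> mpolys (insert x V)"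
  \<comment> \<open>Monomials are sorted by their exponent of \<open>x\<close>: the part of
    \<open>m\<close> free of \<open>x\<close> goes into the coefficient with index
    \<open>lookup m x\<close>.\<close>
  define q where "q = (\<Sum>m\<in>keys p.
    monom (single (Poly_Mapping.update x 0 m) (lookup p m)) (lookup m x))"
  have "q \<in> polys_over (mpolys V)"
    unfolding q_def
    by (intro P.sum_mem monom_polys_over mpolys_single) (use p in \<open>auto simp: mpolys_iff keys_update\<close>)
  moreover have "single (Poly_Mapping.update x 0 m) c * mvar x ^ lookup m x
      = single m (c::int)" for m c
  proof -
    have "Poly_Mapping.update x 0 m + single x (lookup m x) = m"
      by (rule poly_mapping_eqI) (auto simp: lookup_add lookup_update lookup_single when_def)
    moreover have "mvar x ^ k = single (single x k) (1::int)" for k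
      using single_eq_monomial_eval_mvar[of "single x k" "1::int"] by simp
    ultimately show ?thesis by (simp add: mult_single)
  qed
  then have "poly q (mvar x) = p"
    unfolding q_def poly_sum poly_monom using poly_mapping_sum_single[of p] by simp
  ultimately show "p \<in> (\<lambda>q. poly q (mvar x)) ` polys_over (mpolys V)" by blast
next
  fix p :: "('x, int) mpoly" assume "p \<in> (\<lambda>q. poly q (mvar x)) ` polys_over (mpolys V)"
  then obtain q where q: "q \<in> polys_over (mpolys V)" "p = poly q (mvar x)" by blast
  have "coeff q i \<in> mpolys (insert x V)" for i
    using q(1) mpolys_mono[of V "insert x V"] by (auto simp: polys_over_def)
  then show "p \<in> mpolys (insert x V)"
    unfolding q(2) poly_altdef by (intro mpolys_sum mpolys_mult mpolys_power mpolys_mvar) auto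
qed

lemma factorial_mpolys:
  assumes "finite V"
  shows "factorial_subring (mpolys V :: ('x::linorder, int) mpoly set)"
  using assms
proof (induction V)
  case empty
  interpret inj_hom_on "UNIV :: int set" "of_int :: int \<Rightarrow> ('x, int) mpoly"
    by unfold_locales (auto intro: injI)
  show ?case unfolding mpolys_empty using factorial_image factorial_int by blast
next
  case (insert x V)
  then interpret F: factorial_subring "mpolys V :: ('x, int) mpoly set" by blast
  interpret I: inj_hom_on "polys_over (mpolys V)" "\<lambda>q. poly q (mvar x :: ('x, int) mpoly)"
    by (rule inj_hom_split_var) fact
  show ?case unfolding mpolys_insert by (rule I.factorial_image) (rule F.factorial_polys_over)
qed

lemma prime_in_mpolys_insert:
  fixes p :: "('x::linorder, int) mpoly"
  assumes "x \<notin> V" "prime_in (mpolys V) p"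
  shows "prime_in (mpolys (insert x V)) p"
proof -
  interpret subring_of "mpolys V :: ('x, int) mpoly set" by (rule subring_mpolys)
  interpret I: inj_hom_on "polys_over (mpolys V)" "\<lambda>q. poly q (mvar x :: ('x, int) mpoly)"
    by (rule inj_hom_split_var) fact
  show ?thesis
    using I.prime_in_image[OF prime_in_const[OF assms(2)]] by (simp add: mpolys_insert)
qed

text \<open>Bridges the gap to \<open>irreducible\<close>, which speaks of all polynomials of the
  type. Each equation involves only finitely many further variables, and adjoining them one by one
  keeps a prime prime by Gauss's lemma.\<close>

lemma prime_in_mpolys_UNIV:
  fixes p :: "('x::linorder, int) mpoly"
  assumes "prime_in (mpolys V) p"
  shows "prime_in UNIV p"
proof -
  have *: "prime_in (mpolys (V \<union> W)) p" if "finite W" for W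
    using that
  proof (induction W)
    case (insert x W)
    then show ?case using prime_in_mpolys_insert[of x "V \<union> W" p] by (cases "x \<in> V") (auto simp: insert_absorb)
  qed (use assms in simp)
  have all: "\<exists>W. finite W \<and> a \<in> mpolys (V \<union> W) \<and> b \<in> mpolys (V \<union> W) \<and> c \<in> mpolys (V \<union> W)"
    for a b c :: "('x, int) mpoly"
    by (intro exI[of _ "mpoly_vars a \<union> mpoly_vars b \<union> mpoly_vars c"])
      (auto simp: mpolys_def finite_mpoly_vars)
  have "\<not> unit_in UNIV p"
  proof
    assume "unit_in UNIV p"
    then obtain c where c: "1 = p * c" by (auto simp: unit_in_def dvd_in_def)
    obtain W where "finite W" "p \<in> mpolys (V \<union> W)" "c \<in> mpolys (V \<union> W)" using all[of p p c] by blast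
    then have "unit_in (mpolys (V \<union> W)) p" using c unfolding unit_in_def dvd_in_def by blast
    then show False using *[OF \<open>finite W\<close>] unfolding prime_in_def by blast
  qed
  moreover have "dvd_in UNIV p a \<or> dvd_in UNIV p b" if "dvd_in UNIV p (a * b)" for a b
  proof -
    from that obtain c where c: "a * b = p * c" by (auto simp: dvd_in_def)
    obtain W where "finite W" "a \<in> mpolys (V \<union> W)" "b \<in> mpolys (V \<union> W)" "c \<in> mpolys (V \<union> W)"
      using all[of a b c] by blast
    then have "dvd_in (mpolys (V \<union> W)) p a \<or> dvd_in (mpolys (V \<union> W)) p b"
      using *[OF \<open>finite W\<close>] c unfolding prime_in_def dvd_in_def by blast
    then show ?thesis unfolding dvd_in_def by blast
  qed
  ultimately show ?thesis using assms by (auto simp: prime_in_def)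
qed

text \<open>The relation of \<open>elimination\<close> with \<open>x\<close> as the main variable. A
  prime that involves \<open>x\<close> has positive degree in \<open>x\<close> and is both
  irreducible and primitive.\<close>

lemma mpolys_elimination:
  fixes R G :: "('x::linorder, int) mpoly"
  assumes "finite V" "x \<notin> V" and R: "prime_in (mpolys (insert x V)) R" "R \<notin> mpolys V"
    and G: "G \<in> mpolys (insert x V)" "\<not> dvd_in (mpolys (insert x V)) R G"
  shows "\<exists>u\<in>mpolys (insert x V). \<exists>v\<in>mpolys (insert x V). \<exists>r\<in>mpolys V. r \<noteq> 0 \<and> u * R + v * G = r"
proof -
  interpret F: factorial_subring "mpolys V :: ('x, int) mpoly set"
    using assms(1) by (rule factorial_mpolys)
  interpret P: subring_of "polys_over (mpolys V :: ('x, int) mpoly set)" by (rule F.subring_polys_over)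
  interpret S: subring_of "mpolys (insert x V) :: ('x, int) mpoly set" by (rule subring_mpolys)
  interpret I: inj_hom_on "polys_over (mpolys V)" "\<lambda>q. poly q (mvar x :: ('x, int) mpoly)"
    by (rule inj_hom_split_var) fact
  have "R \<in> mpolys (insert x V)" using R by (auto simp: prime_in_def)
  then obtain f g where f: "f \<in> polys_over (mpolys V)" "R = poly f (mvar x)"
    and g: "g \<in> polys_over (mpolys V)" "G = poly g (mvar x)"
    using G unfolding mpolys_insert by blast
  have deg: "degree f > 0"
  proof (rule ccontr)
    assume "\<not> degree f > 0"
    then obtain a where "f = [:a:]" using degree_eq_zeroE by blast
    then show False using f R(2) F.const_polys_over by auto
  qed
  have unit_iff: "unit_in (mpolys (insert x V)) (poly a (mvar x)) \<longleftrightarrow> unit_in (polys_over (mpolys V)) a"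
    if "a \<in> polys_over (mpolys V)" for a :: "('x, int) mpoly poly"
    using I.unit_in_image[OF that] by (simp add: mpolys_insert)
  have irr: "irreducible_in (polys_over (mpolys V)) f"
    unfolding irreducible_in_def
  proof (intro conjI ballI impI)
    show "f \<noteq> 0" using deg by auto
    show "\<not> unit_in (polys_over (mpolys V)) f" using R f unit_iff by (auto simp: prime_in_def)
    fix a b assume ab: "a \<in> polys_over (mpolys V)" "b \<in> polys_over (mpolys V)" "f = a * b"
    then have "R = poly a (mvar x) * poly b (mvar x)" using f by simp
    moreover have "poly a (mvar x) \<in> mpolys (insert x V)" "poly b (mvar x) \<in> mpolys (insert x V)"
      using ab unfolding mpolys_insert by blast+
    ultimately have "unit_in (mpolys (insert x V)) (poly a (mvar x)) \<or>
        unit_in (mpolys (insert x V)) (poly b (mvar x))"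
      using S.prime_in_irreducible R(1) by blast
    then show "unit_in (polys_over (mpolys V)) a \<or> unit_in (polys_over (mpolys V)) b"
      using ab unit_iff by blast
  qed (rule f(1))
  have "F.primitive f"
    unfolding F.primitive_def
  proof (intro conjI allI impI notI)
    fix p assume p: "prime_in (mpolys V) p" "dvd_in (polys_over (mpolys V)) [:p:] f"
    then obtain w where w: "w \<in> polys_over (mpolys V)" "f = [:p:] * w" by (auto simp: dvd_in_def)
    \<comment> \<open>By irreducibility the cofactor \<open>w\<close> of the nonunit
      \<open>p\<close> is a unit, so \<open>f\<close> would be constant in \<open>x\<close>.\<close>
    have p': "prime_in (polys_over (mpolys V)) [:p:]" using F.prime_in_const[OF p(1)] .
    then have "[:p:] \<in> polys_over (mpolys V)" "\<not> unit_in (polys_over (mpolys V)) [:p:]"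
      unfolding prime_in_def by blast+
    then have "unit_in (polys_over (mpolys V)) w" using irr w unfolding irreducible_in_def by blast
    then have "degree w = 0" by (rule F.unit_in_polys_degree)
    then show False using deg w by (auto split: if_splits)
  qed (use f deg in auto)
  moreover have "\<not> dvd_in (polys_over (mpolys V)) f g"
    using I.dvd_in_image[OF f(1) g(1)] G(2) f g by (simp add: mpolys_insert)
  ultimately obtain u v r where uv: "u \<in> polys_over (mpolys V)" "v \<in> polys_over (mpolys V)"
    "r \<in> mpolys V" "r \<noteq> 0" "u * f + v * g = [:r:]"
    using F.elimination[OF _ irr deg g(1)] by blast
  have "poly u (mvar x) * R + poly v (mvar x) * G = poly (u * f + v * g) (mvar x)"
    by (simp add: f g)
  also have "\<dots> = r" using uv(5) by simp
  finally show ?thesis using uv unfolding mpolys_insert by blast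
qed

text \<open>One variable at a time: by induction some coefficient with respect to the last variable
  is nonzero at a point of the others, and the remaining one-variable polynomial has only finitely
  many roots.\<close>

lemma eval_int_nonzero:
  fixes p :: "('x::linorder, int) mpoly"
  assumes "p \<noteq> 0"
  shows "\<exists>y :: 'x \<Rightarrow> complex. eval_int y p \<noteq> 0"
proof -
  have "\<exists>y :: 'x \<Rightarrow> complex. eval_int y p \<noteq> 0" if "finite V" "p \<in> mpolys V" "p \<noteq> 0" for V
    using that
  proof (induction V arbitrary: p)
    case empty
    then obtain k where "p = of_int k" unfolding mpolys_empty by blast
    then show ?case using empty by (simp add: eval_int_hom.hom_of_int)
  next
    case (insert x V)
    then obtain q where q: "q \<in> polys_over (mpolys V)" "p = poly q (mvar x)"
      unfolding mpolys_insert by blast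
    then have "q \<noteq> 0" using insert by auto
    then obtain i where i: "coeff q i \<noteq> 0" using leading_coeff_0_iff by blast
    have cV: "coeff q j \<in> mpolys V" for j using q by (auto simp: polys_over_def)
    obtain y :: "'x \<Rightarrow> complex" where y: "eval_int y (coeff q i) \<noteq> 0"
      using insert.IH[OF cV i] by blast
    define Q where "Q = map_poly (eval_int y) q"
    have cQ: "coeff Q j = eval_int y (coeff q j)" for j
      unfolding Q_def by (rule coeff_map_poly) simp
    then have "Q \<noteq> 0" using y by auto
    then obtain z where z: "poly Q z \<noteq> 0"
      by (metis (mono_tags, lifting) UNIV_I infinite_UNIV_char_0 poly_roots_finite mem_Collect_eq
          rev_finite_subset subsetI)
    have dQ: "degree Q \<le> degree q" by (rule degree_le) (simp add: cQ coeff_eq_0)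
    have "eval_int (y(x := z)) p = (\<Sum>j\<le>degree q. eval_int (y(x := z)) (coeff q j) * z ^ j)"
      unfolding q(2) poly_altdef
      by (simp add: eval_int_hom.h_sum eval_int_hom.h_mult eval_int_hom.h_power)
    also have "\<dots> = (\<Sum>j\<le>degree q. coeff Q j * z ^ j)"
    proof (intro sum.cong refl arg_cong2[where f = "(*)"])
      fix j
      show "eval_int (y(x := z)) (coeff q j) = coeff Q j"
        unfolding cQ using cV[of j] insert.hyps(2)
        by (intro mpoly_eval_cong) (auto simp: mpolys_def)
    qed
    also have "\<dots> = poly Q z"
      unfolding poly_altdef using dQ
      by (intro sum.mono_neutral_right) (auto simp: coeff_eq_0)
    finally show ?case using z by metis
  qed
  from this[OF finite_mpoly_vars _ assms] show ?thesis by (auto simp: mpolys_def)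
qed

section \<open>Systems of forms with a common zero\<close>

definition mdeg :: "'v monomial \<Rightarrow> nat" where
  "mdeg m = (\<Sum>v\<in>keys m. lookup m v)"

lemma mdeg_superset:
  assumes "finite S" "keys m \<subseteq> S"
  shows "mdeg m = (\<Sum>v\<in>S. lookup m v)"
  unfolding mdeg_def using assms by (intro sum.mono_neutral_left) (auto simp: in_keys_iff)

lemma mdeg_zero [simp]: "mdeg 0 = 0"
  by (simp add: mdeg_def)

lemma mdeg_single [simp]: "mdeg (single v k) = k"
  by (simp add: mdeg_def)

lemma mdeg_add: "mdeg (m + m') = mdeg m + mdeg m'"
proof -
  let ?S = "keys m \<union> keys m'"
  have "keys (m + m') \<subseteq> ?S" by (rule keys_add)
  then show ?thesis by (simp add: mdeg_superset[of ?S] lookup_add sum.distrib)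
qed

lemma keys_add_nat: "keys (m + m') = keys m \<union> keys m'"
  for m m' :: "'v monomial"
  by (auto simp: in_keys_iff lookup_add)

lemma monomials_of_degree_iff:
  "m \<in> monomials_of_degree V k \<longleftrightarrow> keys m \<subseteq> V \<and> mdeg m = k"
  by (simp add: monomials_of_degree_def mdeg_def)

lemma monomials_of_degree_add:
  "m \<in> monomials_of_degree V k \<Longrightarrow> m' \<in> monomials_of_degree V l \<Longrightarrow>
   m + m' \<in> monomials_of_degree V (k + l)"
  by (auto simp: monomials_of_degree_iff keys_add_nat mdeg_add)

lemma monomials_of_degree_single: "v \<in> V \<Longrightarrow> single v k \<in> monomials_of_degree V k"
  by (auto simp: monomials_of_degree_iff)

lemma finite_monomials_of_degree:
  assumes "finite V" shows "finite (monomials_of_degree V k)"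
proof (rule finite_subset)
  show "finite ((\<lambda>f. \<Sum>v\<in>V. single v (f v)) ` (V \<rightarrow>\<^sub>E {..k}))"
    using assms by (intro finite_imageI finite_PiE) auto
  show "monomials_of_degree V k \<subseteq> (\<lambda>f. \<Sum>v\<in>V. single v (f v)) ` (V \<rightarrow>\<^sub>E {..k})"
  proof
    fix m assume m: "m \<in> monomials_of_degree V k"
    let ?f = "restrict (lookup m) V"
    have "m = (\<Sum>v\<in>V. single v (lookup m v))"
      using assms m by (intro poly_mapping_sum_single_superset) (auto simp: monomials_of_degree_iff)
    also have "\<dots> = (\<Sum>v\<in>V. single v (?f v))"
      by (intro sum.cong) auto
    finally have "m = (\<Sum>v\<in>V. single v (?f v))" .
    moreover have "lookup m v \<le> k" if "v \<in> V" for v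
    proof -
      have "k = (\<Sum>v\<in>V. lookup m v)"
        using m assms by (metis monomials_of_degree_iff mdeg_superset)
      then show ?thesis using assms that member_le_sum by fastforce
    qed
    then have "?f \<in> V \<rightarrow>\<^sub>E {..k}" by auto
    ultimately show "m \<in> (\<lambda>f. \<Sum>v\<in>V. single v (f v)) ` (V \<rightarrow>\<^sub>E {..k})" by blast
  qed
qed

lemma monomial_eval_scale: "monomial_eval (\<lambda>u. c * x u) m = c ^ mdeg m * monomial_eval x m"
  by (simp add: monomial_eval_def mdeg_def power_mult_distrib prod.distrib power_sum)

lemma mvar_nonzero: "mvar v \<noteq> (0 :: ('v, 'a::comm_ring_1) mpoly)"
  unfolding mvar_def by (metis lookup_single_eq lookup_zero zero_neq_one)

type_synonym 'v coeff_index = "'v \<times> 'v monomial"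

locale form_system =
  fixes V :: "'v::linorder set" and d :: "'v \<Rightarrow> nat"
  assumes finite_V: "finite V" and nonempty_V: "V \<noteq> {}" and d_pos: "v \<in> V \<Longrightarrow> d v > 0"
begin

abbreviation "CV \<equiv> coeff_vars V d"

lemma finite_CV: "finite CV"
  unfolding coeff_vars_def using finite_V finite_monomials_of_degree by blast

text \<open>A system is given by the point \<open>y\<close> of its coefficients in any ring. The
  same formula then covers complex systems, curves of systems (coefficients in a polynomial ring)
  and the generic system \<open>mvar\<close>.\<close>

definition form_val :: "('v coeff_index \<Rightarrow> 'b::comm_ring_1) \<Rightarrow> 'v \<Rightarrow> ('v \<Rightarrow> 'b) \<Rightarrow> 'b" where
  "form_val y v x = (\<Sum>m\<in>monomials_of_degree V (d v). y (v, m) * monomial_eval x m)"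

definition is_zero :: "('v coeff_index \<Rightarrow> 'b::comm_ring_1) \<Rightarrow> ('v \<Rightarrow> 'b) \<Rightarrow> bool" where
  "is_zero y x \<longleftrightarrow> (\<forall>v\<in>V. form_val y v x = 0)"

definition has_zero :: "('v coeff_index \<Rightarrow> complex) \<Rightarrow> bool" where
  "has_zero y \<longleftrightarrow> (\<exists>x. (\<exists>v\<in>V. x v \<noteq> 0) \<and> is_zero y x)"

text \<open>The index of the coefficient of \<open>x\<^sub>i ^ d v\<close> in \<open>F v\<close>:
  the variable is the first argument, the form the second.\<close>

definition pure :: "'v \<Rightarrow> 'v \<Rightarrow> 'v coeff_index" where
  "pure i v = (v, single i (d v))"

lemma pure_in_CV: "i \<in> V \<Longrightarrow> v \<in> V \<Longrightarrow> pure i v \<in> CV"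
  by (auto simp: pure_def coeff_vars_def monomials_of_degree_single)

text \<open>The solution of \<open>F x = 0\<close> for the coefficients of the pure powers of the \<open>i\<close>-th variable
  parametrizes the systems having a zero \<open>x\<close> with \<open>x i = 1\<close>.\<close>

definition fit :: "'v \<Rightarrow> ('v coeff_index \<Rightarrow> 'b::comm_ring_1) \<Rightarrow> ('v \<Rightarrow> 'b) \<Rightarrow> 'v coeff_index \<Rightarrow> 'b" where
  "fit i y x = (\<lambda>k. if fst k \<in> V \<and> k = pure i (fst k) then y k - form_val y (fst k) x else y k)"

lemma form_val_cong:
  assumes "\<And>m. m \<in> monomials_of_degree V (d v) \<Longrightarrow> y (v, m) = y' (v, m)"
  shows "form_val y v x = form_val y' v x"
  unfolding form_val_def using assms by (intro sum.cong) auto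

lemma form_val_fit:
  assumes "i \<in> V" "v \<in> V" "x i = 1"
  shows "form_val (fit i y x) v x = 0"
proof -
  let ?M = "monomials_of_degree V (d v)" and ?p = "single i (d v)"
  have p: "?p \<in> ?M" using assms by (intro monomials_of_degree_single)
  have fin: "finite ?M" using finite_monomials_of_degree finite_V by blast
  have "form_val (fit i y x) v x = fit i y x (v, ?p) * monomial_eval x ?p +
      (\<Sum>m\<in>?M - {?p}. fit i y x (v, m) * monomial_eval x m)"
    unfolding form_val_def using p fin by (subst sum.remove[of _ ?p]) auto
  also have "\<dots> = (y (v, ?p) - form_val y v x) * monomial_eval x ?p +
      (\<Sum>m\<in>?M - {?p}. y (v, m) * monomial_eval x m)"
    using assms by (simp add: fit_def pure_def)
  also have "\<dots> = (y (v, ?p) * monomial_eval x ?p +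
      (\<Sum>m\<in>?M - {?p}. y (v, m) * monomial_eval x m)) - form_val y v x"
    using assms by simp
  also have "y (v, ?p) * monomial_eval x ?p +
      (\<Sum>m\<in>?M - {?p}. y (v, m) * monomial_eval x m) = form_val y v x"
    unfolding form_val_def using p fin by (subst (2) sum.remove[of _ ?p]) auto
  finally show ?thesis by simp
qed

lemma is_zero_fit: "i \<in> V \<Longrightarrow> x i = 1 \<Longrightarrow> is_zero (fit i y x) x"
  by (simp add: is_zero_def form_val_fit)

lemma fit_zero: "is_zero y x \<Longrightarrow> fit i y x = y"
  by (rule ext) (auto simp: fit_def is_zero_def)

lemma form_val_scale: "form_val y v (\<lambda>u. c * x u) = c ^ d v * form_val y v x"
  unfolding form_val_def sum_distrib_left
  by (intro sum.cong refl) (simp add: monomial_eval_scale monomials_of_degree_iff)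

lemma is_zero_scale: "is_zero y x \<Longrightarrow> is_zero y (\<lambda>u. c * x u)"
  by (simp add: is_zero_def form_val_scale)

lemma hom_form_val:
  assumes "coeff_hom h"
  shows "h (form_val y v x) = form_val (\<lambda>k. h (y k)) v (\<lambda>u. h (x u))"
proof -
  interpret coeff_hom h by fact
  show ?thesis by (simp add: form_val_def h_sum h_mult hom_monomial_eval)
qed

lemma hom_fit:
  assumes "coeff_hom h"
  shows "h (fit i y x k) = fit i (\<lambda>k. h (y k)) (\<lambda>u. h (x u)) k"
  using hom_form_val[OF assms] coeff_hom.h_diff[OF assms] by (auto simp: fit_def)

lemma has_zeroI: "is_zero y x \<Longrightarrow> v \<in> V \<Longrightarrow> x v \<noteq> 0 \<Longrightarrow> has_zero y"
  unfolding has_zero_def by blast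

lemma has_zeroE:
  assumes "has_zero y"
  obtains x i where "i \<in> V" "x i = 1" "is_zero y x"
proof -
  obtain x i where x: "i \<in> V" "x i \<noteq> 0" "is_zero y x"
    using assms unfolding has_zero_def by blast
  then have "is_zero y (\<lambda>u. inverse (x i) * x u)" by (intro is_zero_scale)
  then show ?thesis using x by (intro that[of i "\<lambda>u. inverse (x i) * x u"]) auto
qed

definition vanishing :: "('v coeff_index, int) mpoly \<Rightarrow> bool" where
  "vanishing G \<longleftrightarrow> (\<forall>y. has_zero y \<longrightarrow> eval_int y G = 0)"

text \<open>Interpolate the zeros and the coefficients linearly, then correct the coefficients by
  \<open>fit\<close>. Both zeros have \<open>i\<close>-th coordinate 1, so this holds along the
  whole line, and \<open>fit\<close> leaves the end points alone because they already have the
  prescribed zero.\<close>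

lemma line_in_zeros:
  fixes y0 y1 :: "'v coeff_index \<Rightarrow> complex"
  assumes i: "i \<in> V" and z0: "is_zero y0 x0" "x0 i = 1" and z1: "is_zero y1 x1" "x1 i = 1"
  obtains Y X where "\<And>s. is_zero (\<lambda>k. poly (Y k) s) (\<lambda>u. poly (X u) s)" "\<And>s. poly (X i) s = 1"
    "\<And>k. poly (Y k) 0 = y0 k" "\<And>k. poly (Y k) 1 = y1 k"
    "\<And>u. poly (X u) 0 = x0 u" "\<And>u. poly (X u) 1 = x1 u"
proof -
  define X where "X = (\<lambda>u. [:x0 u, x1 u - x0 u:])"
  define Y where "Y = fit i (\<lambda>k. [:y0 k, y1 k - y0 k:]) X"
  have Y: "(\<lambda>k. poly (Y k) s) = fit i (\<lambda>k. y0 k + s * (y1 k - y0 k)) (\<lambda>u. poly (X u) s)" for s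
    unfolding Y_def hom_fit[OF coeff_hom_poly] by simp
  have X: "poly (X u) s = x0 u + s * (x1 u - x0 u)" for u s by (simp add: X_def)
  show ?thesis
  proof (rule that[of Y X])
    show Xi: "poly (X i) s = 1" for s using z0 z1 by (simp add: X)
    show "is_zero (\<lambda>k. poly (Y k) s) (\<lambda>u. poly (X u) s)" for s
      unfolding Y using i Xi by (rule is_zero_fit)
    show "poly (Y k) 0 = y0 k" for k
      using fun_cong[OF Y[of 0], of k] fit_zero[OF z0(1)] by (simp add: X)
    show "poly (Y k) 1 = y1 k" for k
      using fun_cong[OF Y[of 1], of k] fit_zero[OF z1(1)] by (simp add: X)
  qed (auto simp: X)
qed

lemma poly_eval_int: "poly (eval_int Y G) s = eval_int (\<lambda>k. poly (Y k) s) G"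
  by (rule coeff_hom.hom_eval_int[OF coeff_hom_poly])

lemma ex_nonroot: "(p :: complex poly) \<noteq> 0 \<Longrightarrow> \<exists>s. poly p s \<noteq> 0"
  using poly_all_0_iff_0 by blast

text \<open>Two systems joined by a polynomial curve of systems with zeros give the claim, since a
  product of nonzero polynomials in the parameter has a nonroot. The zeros may be normalized at
  different coordinates \<open>i\<close> and \<open>j\<close>; the first is therefore moved to a
  zero with nonzero \<open>j\<close>-th coordinate.\<close>

lemma vanishing_prime:
  assumes "vanishing (G * H)"
  shows "vanishing G \<or> vanishing H"
proof (rule ccontr)
  assume "\<not> ?thesis"
  then obtain y0 y1 where y: "has_zero y0" "eval_int y0 G \<noteq> 0" "has_zero y1" "eval_int y1 H \<noteq> 0"
    by (auto simp: vanishing_def)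
  obtain x0 i where i: "i \<in> V" "x0 i = 1" "is_zero y0 x0" using y(1) by (rule has_zeroE)
  obtain x1 j where j: "j \<in> V" "x1 j = 1" "is_zero y1 x1" using y(3) by (rule has_zeroE)
  have "\<exists>(y2 :: _ \<Rightarrow> complex) x2. is_zero y2 x2 \<and> x2 j \<noteq> 0 \<and> eval_int y2 G \<noteq> 0"
  proof -
    \<comment> \<open>A target with both coordinates equal to 1: on the way to it, \<open>G\<close>
      is nonzero at the start and \<open>X j\<close> at the end, so both are nonzero at some common
      parameter.\<close>
    let ?x = "x0(j := 1)"
    have x: "?x i = 1" using i by auto
    obtain Y X where YX: "\<And>s. is_zero (\<lambda>k. poly (Y k) s) (\<lambda>u. poly (X u) s)" "\<And>s. poly (X i) s = 1"
      "\<And>k. poly (Y k) 0 = y0 k" "\<And>k. poly (Y k) 1 = fit i y0 ?x k"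
      "\<And>u. poly (X u) 0 = x0 u" "\<And>u. poly (X u) 1 = ?x u"
      by (rule line_in_zeros[OF i(1) i(3,2) is_zero_fit[where x = ?x and y = y0, OF i(1) x] x]) (rule that)
    have "eval_int Y G \<noteq> 0" using poly_eval_int[of Y G 0] y(2) YX(3) by auto
    moreover have "X j \<noteq> 0" using YX(6)[of j] by auto
    ultimately obtain s where "poly (eval_int Y G * X j) s \<noteq> 0" using ex_nonroot by (metis no_zero_divisors)
    then show ?thesis
      using YX(1)[of s]
      by (intro exI[of _ "\<lambda>k. poly (Y k) s"] exI[of _ "\<lambda>u. poly (X u) s"]) (simp add: poly_eval_int)
  qed
  then obtain y2 :: "_ \<Rightarrow> complex" and x2 where z2: "is_zero y2 x2" "x2 j \<noteq> 0" "eval_int y2 G \<noteq> 0" by blast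
  \<comment> \<open>Rescaled so that both zeros have \<open>j\<close>-th coordinate 1.\<close>
  let ?x = "\<lambda>u. inverse (x2 j) * x2 u"
  have x: "is_zero y2 ?x" "?x j = 1" using z2 is_zero_scale by auto
  obtain Y X where YX: "\<And>s. is_zero (\<lambda>k. poly (Y k) s) (\<lambda>u. poly (X u) s)" "\<And>s. poly (X j) s = 1"
      "\<And>k. poly (Y k) 0 = y2 k" "\<And>k. poly (Y k) 1 = y1 k"
      "\<And>u. poly (X u) 0 = ?x u" "\<And>u. poly (X u) 1 = x1 u"
    by (rule line_in_zeros[OF j(1) x j(3,2)]) (rule that)
  have "eval_int Y G \<noteq> 0" using poly_eval_int[of Y G 0] z2 YX(3) by auto
  moreover have "eval_int Y H \<noteq> 0" using poly_eval_int[of Y H 1] y(4) YX(4) by auto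
  ultimately obtain s where s: "poly (eval_int Y G * eval_int Y H) s \<noteq> 0"
    using ex_nonroot by (metis no_zero_divisors)
  have "has_zero (\<lambda>k. poly (Y k) s)" using YX(1,2)[of s] j(1) by (intro has_zeroI) auto
  then have "eval_int (\<lambda>k. poly (Y k) s) (G * H) = 0" using assms by (auto simp: vanishing_def)
  then show False using s by (simp add: poly_eval_int eval_int_hom.h_mult eval_int.mpoly_eval_mult)
qed

end

lemma (in subring_of) eval_int_mem:
  assumes "\<And>k. k \<in> mpoly_vars p \<Longrightarrow> f k \<in> A"
  shows "eval_int f p \<in> A"
proof -
  have of_nat: "of_nat n \<in> A" for n
    by (induction n) (auto intro: zero_mem one_mem add_mem)
  have of_int: "of_int k \<in> A" for k
    by (cases k) (auto intro!: of_nat uminus_mem one_mem simp del: of_nat_Suc simp: of_nat_Suc[symmetric])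
  have power: "a ^ n \<in> A" if "a \<in> A" for a n
    using that by (induction n) (auto intro: one_mem mult_mem)
  have prod: "prod g S \<in> A" if "\<And>i. i \<in> S \<Longrightarrow> g i \<in> A" for g :: "'c \<Rightarrow> 'a" and S
    using that by (induction S rule: infinite_finite_induct) (auto intro: one_mem mult_mem)
  show ?thesis
    unfolding mpoly_eval_def
    by (intro sum_mem mult_mem of_int prod power) (use assms in \<open>auto simp: mpoly_vars_def\<close>)
qed

context form_system
begin

text \<open>Scaling all coefficients of \<open>F v\<close>, \<open>v \<noteq> i\<close>, by \<open>\<eta>\<close> except those of \<open>x\<^sub>i ^ d\<close> and \<open>x\<^sub>i ^ (d - 1) x\<^sub>v\<close>
  gives systems that can be solved explicitly up to order \<open>\<eta>\<close>; the lowest order term of \<open>G\<close> in \<open>\<eta>\<close>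
  would then have to vanish.\<close>

lemma vanishing_free_of_pure:
  assumes i: "i \<in> V" and G: "G \<in> mpolys (CV - {pure i i})" and van: "vanishing G"
  shows "G = 0"
proof (rule ccontr)
  assume G0: "G \<noteq> 0"
  define t where "t = pure i i"
  define V' where "V' = V - {i}"
  \<comment> \<open>With \<open>x\<^sub>i = 1\<close> this coefficient multiplies
    \<open>x\<^sub>v\<close> alone; at \<eta> = 0 it leaves a linear equation for
    \<open>x\<^sub>v\<close>.\<close>
  define A where "A v = (v, single i (d v - 1) + single v (1::nat))" for v
  define Ot where "Ot = {k\<in>CV. fst k \<in> V' \<and> k \<noteq> A (fst k) \<and> k \<noteq> pure i (fst k)}"
  have tO: "t \<notin> Ot" by (auto simp: t_def Ot_def pure_def V'_def)
  interpret S: subring_of "mpolys (CV - {t}) :: ('v coeff_index, int) mpoly set"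
    by (rule subring_mpolys)
  interpret P: subring_of "polys_over (mpolys (CV - {t})) :: ('v coeff_index, int) mpoly poly set"
    by (rule S.subring_polys_over)
  \<comment> \<open>The indeterminate of the outer polynomial is the scaling parameter
    \<eta>.\<close>
  define g :: "('v coeff_index, int) mpoly poly" where "g = eval_int (\<lambda>k. if k \<in> Ot then [:0, mvar k:] else [:mvar k:]) G"
  have gP: "g \<in> polys_over (mpolys (CV - {t}))"
    unfolding g_def
  proof (rule P.eval_int_mem)
    fix k assume "k \<in> mpoly_vars G"
    then have "mvar k \<in> (mpolys (CV - {t}) :: ('v coeff_index, int) mpoly set)"
      using G by (intro mpolys_mvar) (auto simp: mpolys_def t_def)
    then have "coeff [:mvar k:] j \<in> (mpolys (CV - {t}) :: ('v coeff_index, int) mpoly set)"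
      "coeff [:0, mvar k:] j \<in> (mpolys (CV - {t}) :: ('v coeff_index, int) mpoly set)"
      for j :: nat
      by (auto simp: coeff_pCons mpolys_zero split: nat.split)
    then show "(if k \<in> Ot then [:0, mvar k:] else [:mvar k:]) \<in>
        polys_over (mpolys (CV - {t}) :: ('v coeff_index, int) mpoly set)"
      unfolding polys_over_def by auto
  qed
  have "poly g 1 = eval_int mvar G"
    unfolding g_def coeff_hom.hom_eval_int[OF coeff_hom_poly] by (intro mpoly_eval_cong) auto
  then have "g \<noteq> 0" using G0 by (auto simp: eval_int_mvar)
  \<comment> \<open>Division by the largest power of \<eta>: the constant coefficient of
    \<open>g'\<close> is the lowest order term of \<open>G\<close>.\<close>
  then obtain j g' where g': "g = [:0, 1:] ^ j * g'" "\<not> [:0, 1:] dvd g'"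
    using order_decomp[of g 0] by auto
  then have c0: "coeff g' 0 \<noteq> 0" using poly_eq_0_iff_dvd[of g' 0] by (simp add: poly_0_coeff_0)
  have g'P: "g' \<in> polys_over (mpolys (CV - {t}))"
  proof -
    have "coeff g' n = coeff g (n + j)" for n
      unfolding g'(1) monom_altdef[of 1 j, simplified, symmetric] by (simp add: coeff_monom_mult)
    then show ?thesis using gP by (auto simp: polys_over_def)
  qed
  have "coeff g' 0 * (\<Prod>v\<in>V'. mvar (A v)) \<noteq> 0"
    using c0 finite_V by (auto simp: V'_def mvar_nonzero)
  then obtain y0 :: "'v coeff_index \<Rightarrow> complex" where y0: "eval_int y0 (coeff g' 0 * (\<Prod>v\<in>V'. mvar (A v))) \<noteq> 0"
    using eval_int_nonzero by blast
  then have y0c: "eval_int y0 (coeff g' 0) \<noteq> 0" and y0A: "\<And>v. v \<in> V' \<Longrightarrow> y0 (A v) \<noteq> 0"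
    using finite_V by (auto simp: eval_int_hom.h_prod eval_int.mpoly_eval_mult V'_def)
  \<comment> \<open>The solution at \<eta> = 0 with \<open>x\<^sub>i = 1\<close>. It is kept for all
    \<eta>; the contribution \<open>\<eta> * \<sigma> v\<close> of the scaled terms is compensated
    in the coefficient of the pure power.\<close>
  define x where "x v = (if v = i then 1 else - y0 (pure i v) / y0 (A v))" for v
  define \<sigma> where "\<sigma> v = (\<Sum>m\<in>{m\<in>monomials_of_degree V (d v). (v, m) \<in> Ot}. y0 (v, m) * monomial_eval x m)" for v
  \<comment> \<open>\<open>G\<close> does not involve the index \<open>t\<close>, so
    \<open>t\<close> is free to carry the parameter \<eta>.\<close>
  define Y where "Y k = (if k = t then [:0, 1:] else if fst k \<in> V' \<and> k = pure i (fst k)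
    then [:y0 k, - \<sigma> (fst k):] else [:y0 k:])" for k
  define h where "h = eval_int Y (poly g' (mvar t))"
  have "poly h \<eta> = 0" if \<eta>: "\<eta> \<noteq> 0" for \<eta>
  proof -
    define y where "y k = (if k \<in> Ot then \<eta> * y0 k else poly (Y k) \<eta>)" for k
    \<comment> \<open>The form \<open>F i\<close> is made to vanish at \<open>x\<close> by its
      coefficient \<open>t\<close>, a change that \<open>G\<close> does not see.\<close>
    define z where "z = y(t := y t - form_val y i x)"
    have "form_val z v x = 0" if v: "v \<in> V" for v
    proof (cases "v = i")
      case True
      have "form_val z v x = form_val (fit i y x) v x"
        by (rule form_val_cong) (auto simp: z_def fit_def t_def True pure_def i)
      then show ?thesis using form_val_fit[OF i v, of x y] by (simp add: x_def)
    next
      case False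
      then have vV': "v \<in> V'" using v by (auto simp: V'_def)
      let ?M = "monomials_of_degree V (d v)"
      let ?a = "single i (d v - 1) + single v (1::nat)"
      let ?p = "single i (d v)"
      have "lookup ?a v = 1" "lookup ?p v = 0"
        using False by (auto simp: lookup_add lookup_single)
      then have ap: "?a \<noteq> ?p" by (metis zero_neq_one)
      have aM: "?a \<in> ?M"
        using monomials_of_degree_add[OF monomials_of_degree_single[OF i, of "d v - 1"]
            monomials_of_degree_single[OF v, of 1]] d_pos[OF v] by simp
      have pM: "?p \<in> ?M" using i by (rule monomials_of_degree_single)
      have fin: "finite ?M" using finite_monomials_of_degree finite_V by blast
      let ?R = "{m\<in>?M. (v, m) \<in> Ot}"
      have R: "?R = ?M - {?a} - {?p}"
        using vV' v by (auto simp: Ot_def A_def pure_def coeff_vars_def)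
      have "form_val z v x = z (v, ?a) * monomial_eval x ?a + (z (v, ?p) * monomial_eval x ?p
          + (\<Sum>m\<in>?R. z (v, m) * monomial_eval x m))"
        unfolding form_val_def R using aM pM ap fin
        by (subst sum.remove[of ?M ?a], simp, simp, subst sum.remove[of "?M - {?a}" ?p]) auto
      also have "(\<Sum>m\<in>?R. z (v, m) * monomial_eval x m) = \<eta> * \<sigma> v"
        unfolding \<sigma>_def sum_distrib_left
        by (intro sum.cong refl) (use tO in \<open>auto simp: z_def y_def\<close>)
      also have "z (v, ?a) = y0 (A v)"
        using False ap by (auto simp: z_def y_def Y_def A_def t_def pure_def Ot_def)
      also have "z (v, ?p) = y0 (pure i v) - \<eta> * \<sigma> v"
        using False vV' by (auto simp: z_def y_def Y_def t_def pure_def Ot_def)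
      also have "monomial_eval x ?a = x v" by (simp add: monomial_eval_add x_def[of i])
      also have "monomial_eval x ?p = 1" by (simp add: x_def)
      also have "x v = - y0 (pure i v) / y0 (A v)" using False by (simp add: x_def)
      finally show ?thesis using y0A[OF vV'] by simp
    qed
    then have "is_zero z x" by (simp add: is_zero_def)
    then have "has_zero z" using i by (intro has_zeroI[of z x i]) (auto simp: x_def)
    then have "eval_int z G = 0" using van by (auto simp: vanishing_def)
    moreover have "eval_int z G = eval_int y G"
      using G by (intro mpoly_eval_cong) (auto simp: z_def mpolys_def t_def)
    moreover have "eval_int y G = eval_int (\<lambda>k. poly (Y k) \<eta>) (poly g (mvar t))"
    proof -
      have Yt: "poly (Y t) \<eta> = \<eta>" by (simp add: Y_def)
      have YO: "poly (Y k) \<eta> = y0 k" if "k \<in> Ot" for k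
      proof -
        have "k \<noteq> t" "k \<noteq> pure i (fst k)" using that tO by (auto simp: Ot_def)
        then show ?thesis by (simp add: Y_def)
      qed
      have "eval_int (\<lambda>k. poly (Y k) \<eta>) (poly g (mvar t)) =
        eval_int (\<lambda>k. poly (Y k) \<eta>) (eval_int (\<lambda>k. if k \<in> Ot then mvar t * mvar k else mvar k) G)"
        unfolding g_def coeff_hom.hom_eval_int[OF coeff_hom_poly]
        by (intro arg_cong[of _ _ "eval_int _"] mpoly_eval_cong) auto
      also have "\<dots> = eval_int y G"
        unfolding eval_int_hom.hom_eval_int
        using YO by (intro mpoly_eval_cong) (simp add: y_def eval_int.mpoly_eval_mult Yt)
      finally show ?thesis by simp
    qed
    moreover have "eval_int (\<lambda>k. poly (Y k) \<eta>) (poly g (mvar t)) = \<eta> ^ j * poly h \<eta>"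
      unfolding g'(1) h_def poly_eval_int
      by (simp add: eval_int.mpoly_eval_mult eval_int_hom.h_power Y_def)
    ultimately show ?thesis using \<eta> by simp
  qed
  \<comment> \<open>The extra factor takes care of \<eta> = 0, where the division by a power of
    \<eta> says nothing.\<close>
  then have "poly ([:0, 1:] * h) \<eta> = 0" for \<eta> by (cases "\<eta> = 0") auto
  then have "h = 0" using ex_nonroot by (metis no_zero_divisors pCons_eq_0_iff zero_neq_one)
  moreover have "poly h 0 = eval_int y0 (coeff g' 0)"
  proof -
    obtain q where "poly g' (mvar t) = coeff g' 0 + mvar t * poly q (mvar t)"
      by (cases g') auto
    then have "poly h 0 = eval_int (\<lambda>k. poly (Y k) 0) (coeff g' 0)"
      unfolding h_def poly_eval_int
      by (simp add: eval_int.mpoly_eval_add eval_int.mpoly_eval_mult Y_def)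
    also have "\<dots> = eval_int y0 (coeff g' 0)"
      using g'P by (intro mpoly_eval_cong) (auto simp: Y_def polys_over_def mpolys_def)
    finally show ?thesis .
  qed
  ultimately show False using y0c by simp
qed

end

section \<open>Macaulay minors\<close>

text \<open>The Leibniz formula over an arbitrary finite index set, because rows and columns will be
  indexed by monomials.\<close>

definition det_on :: "'i set \<Rightarrow> ('i \<Rightarrow> 'i \<Rightarrow> 'a::comm_ring_1) \<Rightarrow> 'a" where
  "det_on S A = (\<Sum>p | p permutes S. of_int (sign p) * (\<Prod>i\<in>S. A i (p i)))"

lemma det_on_cong:
  assumes "\<And>i j. i \<in> S \<Longrightarrow> j \<in> S \<Longrightarrow> A i j = B i j"
  shows "det_on S A = det_on S B"
  unfolding det_on_def
  by (intro sum.cong refl arg_cong2[where f = "(*)"] prod.cong)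
    (use assms permutes_in_image in fastforce)

lemma (in coeff_hom) hom_det_on: "h (det_on S A) = det_on S (\<lambda>i j. h (A i j))"
  by (simp add: det_on_def h_sum h_mult h_prod hom_of_int)

lemma det_on_identity:
  assumes "finite S"
  shows "det_on S (\<lambda>i j. if i = j then 1 else 0) = (1 :: 'a::comm_ring_1)"
proof -
  have "(\<Prod>i\<in>S. if i = p i then 1 else (0::'a)) = (if p = id then 1 else 0)" if "p permutes S" for p
  proof (cases "p = id")
    case False
    then obtain i where "p i \<noteq> i" by (auto simp: fun_eq_iff)
    moreover from this have "i \<in> S" using that by (auto simp: permutes_def)
    ultimately show ?thesis using False assms by (auto intro!: prod_zero bexI[of _ i])
  qed auto
  then have "det_on S (\<lambda>i j. if i = j then 1 else 0) =
      (\<Sum>p | p permutes S. if p = id then 1 else (0::'a))"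
    unfolding det_on_def by (intro sum.cong refl) auto
  also have "\<dots> = 1"
    using finite_permutations[OF assms] by (simp add: permutes_id)
  finally show ?thesis .
qed

text \<open>Composition with the transposition of \<open>j\<close> and \<open>k\<close> permutes the
  terms and reverses their signs, so the determinant equals its negative.\<close>

lemma det_on_equal_columns:
  fixes A :: "'i \<Rightarrow> 'i \<Rightarrow> 'a::{idom, ring_char_0}"
  assumes "finite S" "j \<in> S" "k \<in> S" "j \<noteq> k" "\<And>i. i \<in> S \<Longrightarrow> A i j = A i k"
  shows "det_on S A = 0"
proof -
  let ?t = "Transposition.transpose j k"
  have t: "?t permutes S" using assms by (intro permutes_swap_id)
  have "det_on S A = (\<Sum>p | p permutes S. of_int (sign (?t \<circ> p)) * (\<Prod>i\<in>S. A i ((?t \<circ> p) i)))"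
    unfolding det_on_def by (subst setum_permutations_compose_left[OF t]) simp
  also have "\<dots> = (\<Sum>p | p permutes S. - (of_int (sign p) * (\<Prod>i\<in>S. A i (p i))))"
  proof (intro sum.cong refl)
    fix p assume "p \<in> {p. p permutes S}"
    then have "permutation p" using assms(1) permutes_imp_permutation by blast
    then have "sign (?t \<circ> p) = - sign p"
      using assms(1,4) permutes_imp_permutation[OF assms(1) t] by (simp add: sign_compose sign_swap_id)
    moreover have "(\<Prod>i\<in>S. A i ((?t \<circ> p) i)) = (\<Prod>i\<in>S. A i (p i))"
      using assms(5) by (intro prod.cong) (auto simp: Transposition.transpose_def)
    ultimately show "of_int (sign (?t \<circ> p)) * (\<Prod>i\<in>S. A i ((?t \<circ> p) i)) =
      - (of_int (sign p) * (\<Prod>i\<in>S. A i (p i)))" by simp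
  qed
  also have "\<dots> = - det_on S A" by (simp add: det_on_def sum_negf)
  finally show ?thesis by (simp add: eq_neg_iff_add_eq_0)
qed

lemma det_on_column_sum:
  assumes "finite S" "j \<in> S"
  shows "det_on S (\<lambda>i l. if l = j then \<Sum>k\<in>K. w k * B k i else A i l) =
    (\<Sum>k\<in>K. w k * det_on S (\<lambda>i l. if l = j then B k i else A i l))"
proof -
  have "(\<Prod>i\<in>S. if p i = j then \<Sum>k\<in>K. w k * B k i else A i (p i)) =
    (\<Sum>k\<in>K. w k * (\<Prod>i\<in>S. if p i = j then B k i else A i (p i)))" if p: "p permutes S" for p
  proof -
    obtain i0 where i0: "i0 \<in> S" "p i0 = j" using p assms(2) by (metis imageE permutes_image)
    have other: "p i \<noteq> j" if "i \<noteq> i0" for i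
      using that i0 p permutes_inj injD by metis
    have split: "(\<Prod>i\<in>S. if p i = j then F i else A i (p i)) = F i0 * (\<Prod>i\<in>S - {i0}. A i (p i))"
      for F :: "'a \<Rightarrow> 'b"
    proof -
      have "(\<Prod>i\<in>S. if p i = j then F i else A i (p i)) =
        F i0 * (\<Prod>i\<in>S - {i0}. if p i = j then F i else A i (p i))"
        using assms(1) i0 by (subst prod.remove[of S i0]) auto
      also have "(\<Prod>i\<in>S - {i0}. if p i = j then F i else A i (p i)) = (\<Prod>i\<in>S - {i0}. A i (p i))"
        using other by (intro prod.cong) auto
      finally show ?thesis .
    qed
    show ?thesis unfolding split by (simp add: sum_distrib_right mult.assoc)
  qed
  then have "det_on S (\<lambda>i l. if l = j then \<Sum>k\<in>K. w k * B k i else A i l) =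
    (\<Sum>p | p permutes S. \<Sum>k\<in>K. w k * (of_int (sign p) * (\<Prod>i\<in>S. if p i = j then B k i else A i (p i))))"
    unfolding det_on_def by (intro sum.cong refl) (auto simp: sum_distrib_left mult_ac)
  also have "\<dots> = (\<Sum>k\<in>K. w k * det_on S (\<lambda>i l. if l = j then B k i else A i l))"
    unfolding det_on_def sum_distrib_left by (rule sum.swap)
  finally show ?thesis .
qed

text \<open>Replace column \<open>j\<close> by the combination of all columns with weights
  \<open>w\<close>. By linearity and the vanishing for equal columns this multiplies the determinant
  by \<open>w j\<close>, while the new column is zero.\<close>

lemma det_on_kernel:
  fixes A :: "'i \<Rightarrow> 'i \<Rightarrow> 'a::{idom, ring_char_0}"
  assumes fin: "finite S" and j: "j \<in> S" "w j \<noteq> 0"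
    and ker: "\<And>i. i \<in> S \<Longrightarrow> (\<Sum>k\<in>S. w k * A i k) = 0"
  shows "det_on S A = 0"
proof -
  let ?B = "\<lambda>k i l. if l = j then A i k else A i l"
  have "det_on S (?B k) = (if k = j then det_on S A else 0)" if "k \<in> S" for k
  proof (cases "k = j")
    case True
    then have "?B k = A" by (auto simp: fun_eq_iff)
    then show ?thesis using True by simp
  next
    case False
    then have "det_on S (?B k) = 0" using that j fin by (intro det_on_equal_columns[of S j k]) auto
    then show ?thesis using False by simp
  qed
  then have "(\<Sum>k\<in>S. w k * det_on S (?B k)) = (\<Sum>k\<in>S. if k = j then w k * det_on S A else 0)"
    by (intro sum.cong) auto
  then have "w j * det_on S A = (\<Sum>k\<in>S. w k * det_on S (?B k))"
    using fin j by simp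
  also have "\<dots> = det_on S (\<lambda>i l. if l = j then \<Sum>k\<in>S. w k * A i k else A i l)"
    by (rule det_on_column_sum[symmetric]) (use fin j in auto)
  \<comment> \<open>The zero column is written as a combination with weight 0, so that linearity in
    the column applies once more.\<close>
  also have "\<dots> = det_on S (\<lambda>i l. if l = j then \<Sum>k\<in>{j}. 0 * 1 else A i l)"
    by (rule det_on_cong) (use ker in auto)
  also have "\<dots> = (\<Sum>k\<in>{j}. 0 * det_on S (\<lambda>i l. if l = j then 1 else A i l))"
    by (rule det_on_column_sum) (use fin j in auto)
  finally show ?thesis using j by simp
qed

text \<open>Multilinearity in the rows: the expansion runs over all ways \<open>f\<close> to choose
  one summand in each row.\<close>

lemma det_on_row_combination:
  assumes "finite S" "finite R"
  shows "det_on S (\<lambda>i j. \<Sum>r\<in>R. g i r * B r j) =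
    (\<Sum>f\<in>S \<rightarrow>\<^sub>E R. (\<Prod>i\<in>S. g i (f i)) * det_on S (\<lambda>i j. B (f i) j))"
proof -
  have "det_on S (\<lambda>i j. \<Sum>r\<in>R. g i r * B r j) =
    (\<Sum>p | p permutes S. \<Sum>f\<in>S \<rightarrow>\<^sub>E R. (\<Prod>i\<in>S. g i (f i)) *
       (of_int (sign p) * (\<Prod>i\<in>S. B (f i) (p i))))"
    unfolding det_on_def
    by (intro sum.cong refl, subst prod_sum_PiE[OF assms(1)])
      (auto simp: assms sum_distrib_left prod.distrib mult_ac)
  also have "\<dots> = (\<Sum>f\<in>S \<rightarrow>\<^sub>E R. (\<Prod>i\<in>S. g i (f i)) * det_on S (\<lambda>i j. B (f i) j))"
    unfolding det_on_def sum_distrib_left by (rule sum.swap)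
  finally show ?thesis .
qed

lemma degree_det_on_le:
  fixes A :: "'i \<Rightarrow> 'i \<Rightarrow> 'a::comm_ring_1 poly"
  assumes "finite S" "\<And>i j. i \<in> S \<Longrightarrow> j \<in> S \<Longrightarrow> degree (A i j) \<le> e i"
  shows "degree (det_on S A) \<le> (\<Sum>i\<in>S. e i)"
  unfolding det_on_def
proof (rule degree_sum_le)
  fix p assume p: "p \<in> {p. p permutes S}"
  have "degree (of_int (sign p) * (\<Prod>i\<in>S. A i (p i))) \<le>
      degree (of_int (sign p) :: 'a poly) + degree (\<Prod>i\<in>S. A i (p i))"
    by (rule degree_mult_le)
  also have "\<dots> = degree (\<Prod>i\<in>S. A i (p i))" by simp
  also have "\<dots> \<le> (\<Sum>i\<in>S. degree (A i (p i)))"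
    using degree_prod_sum_le[OF assms(1), of "\<lambda>i. A i (p i)"] by (simp add: o_def)
  also have "\<dots> \<le> (\<Sum>i\<in>S. e i)"
    using p permutes_in_image assms(2) by (intro sum_mono) fastforce
  finally show "degree (of_int (sign p) * (\<Prod>i\<in>S. A i (p i))) \<le> (\<Sum>i\<in>S. e i)" .
qed (use assms finite_permutations in auto)

section \<open>The Macaulay matrix and its maximal minors\<close>

context form_system
begin

abbreviation "Mon \<equiv> monomials_of_degree V"

lemma finite_Mon: "finite (Mon q)"
  using finite_monomials_of_degree finite_V by blast

text \<open>An entry of the Macaulay matrix: row \<open>(u, k)\<close> lists the coefficients of the
  product of the monomial \<open>k\<close> with \<open>F u\<close>, and column \<open>m\<close> is a
  monomial.\<close>

definition shifted_coeff :: "('v coeff_index \<Rightarrow> 'b::comm_ring_1) \<Rightarrow> 'v coeff_index \<Rightarrow> 'v monomial \<Rightarrow> 'b" where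
  "shifted_coeff y r m = (\<Sum>k\<in>Mon (d (fst r)). if snd r + k = m then y (fst r, k) else 0)"

definition shifts :: "nat \<Rightarrow> ('v coeff_index) set" where
  "shifts q = {(u, k). u \<in> V \<and> d u \<le> q \<and> k \<in> Mon (q - d u)}"

text \<open>A square matrix with the row \<open>f m\<close> in place \<open>m\<close>. Since
  \<open>f\<close> may be any function, all choices of rows, also with repetitions, are covered at
  once.\<close>

definition minor :: "nat \<Rightarrow> ('v monomial \<Rightarrow> 'v coeff_index) \<Rightarrow> ('v coeff_index \<Rightarrow> 'b::comm_ring_1) \<Rightarrow> 'b" where
  "minor q f y = det_on (Mon q) (\<lambda>m. shifted_coeff y (f m))"

lemma finite_shifts: "finite (shifts q)"
proof (rule finite_subset)
  show "shifts q \<subseteq> (SIGMA u:V. Mon (q - d u))" by (auto simp: shifts_def)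
qed (use finite_V finite_Mon in auto)

lemma hom_minor:
  assumes "coeff_hom h"
  shows "h (minor q f y) = minor q f (\<lambda>k. h (y k))"
proof -
  interpret coeff_hom h by fact
  show ?thesis
    unfolding minor_def hom_det_on shifted_coeff_def h_sum
    by (simp add: if_distrib[of h] h_zero cong: if_cong)
qed

text \<open>\<open>minor q f mvar\<close> is the minor of the generic system, an integer polynomial
  in the coefficients.\<close>

lemma eval_int_minor: "eval_int y (minor q f mvar) = minor q f y"
  unfolding hom_minor[OF eval_int.coeff_hom_mpoly_eval] by simp

lemma shifted_coeff_sum:
  assumes "(u, k) \<in> shifts q"
  shows "(\<Sum>m\<in>Mon q. monomial_eval x m * shifted_coeff y (u, k) m) = monomial_eval x k * form_val y u x"
proof -
  have mem: "k + l \<in> Mon q" if "l \<in> Mon (d u)" for l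
    using assms monomials_of_degree_add[of k V "q - d u" l "d u"] that by (auto simp: shifts_def)
  have "(\<Sum>m\<in>Mon q. monomial_eval x m * shifted_coeff y (u, k) m) =
    (\<Sum>l\<in>Mon (d u). \<Sum>m\<in>Mon q. if k + l = m then monomial_eval x m * y (u, l) else 0)"
    unfolding shifted_coeff_def sum_distrib_left
    by (subst sum.swap) (auto intro!: sum.cong)
  also have "\<dots> = (\<Sum>l\<in>Mon (d u). monomial_eval x (k + l) * y (u, l))"
    using mem finite_Mon by (intro sum.cong refl) simp
  also have "\<dots> = monomial_eval x k * form_val y u x"
    unfolding form_val_def sum_distrib_left by (simp add: monomial_eval_add mult_ac)
  finally show ?thesis .
qed

text \<open>At a common zero \<open>x\<close> the values of all monomials at \<open>x\<close> form a
  vector annihilated by each row; it is nonzero because the entry of \<open>x\<^sub>i ^ q\<close> is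
  1.\<close>

lemma vanishing_minor:
  assumes "\<And>m. m \<in> Mon q \<Longrightarrow> f m \<in> shifts q"
  shows "vanishing (minor q f mvar)"
  unfolding vanishing_def
proof (intro allI impI)
  fix y :: "'v coeff_index \<Rightarrow> complex" assume "has_zero y"
  then obtain x i where x: "i \<in> V" "x i = 1" "is_zero y x" by (rule has_zeroE)
  have "minor q f y = 0"
    unfolding minor_def
  proof (rule det_on_kernel[OF finite_Mon])
    show "single i q \<in> Mon q" using x by (intro monomials_of_degree_single)
    show "monomial_eval x (single i q) \<noteq> 0" using x by simp
    fix m assume m: "m \<in> Mon q"
    obtain u k where uk: "f m = (u, k)" by fastforce
    then have "u \<in> V" using assms[OF m] by (auto simp: shifts_def)
    then show "(\<Sum>k\<in>Mon q. monomial_eval x k * shifted_coeff y (f m) k) = 0"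
      using shifted_coeff_sum[of u k q x y] assms[OF m] x(3) unfolding uk by (simp add: is_zero_def)
  qed
  then show "eval_int y (minor q f mvar) = 0" by (simp add: eval_int_minor)
qed

lemma minor_mpolys:
  assumes "\<And>m. m \<in> Mon q \<Longrightarrow> f m \<in> shifts q"
  shows "minor q f mvar \<in> (mpolys CV :: ('v coeff_index, int) mpoly set)"
  unfolding minor_def det_on_def
proof (intro mpolys_sum mpolys_mult mpolys_prod mpolys_of_int)
  fix p m assume "p \<in> {p. p permutes Mon q}" "m \<in> Mon q"
  then have "fst (f m) \<in> V" using assms[of m] by (cases "f m") (auto simp: shifts_def)
  then show "shifted_coeff mvar (f m) (p m) \<in> (mpolys CV :: ('v coeff_index, int) mpoly set)"
    unfolding shifted_coeff_def
    by (intro mpolys_sum) (auto simp: mpolys_zero coeff_vars_def intro!: mpolys_mvar)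
qed

text \<open>If combinations of the rows give the identity matrix, its determinant 1 expands into
  multiples of minors, which cannot all be zero.\<close>

lemma nonzero_minor:
  fixes y :: "'v coeff_index \<Rightarrow> 'b::comm_ring_1"
  assumes "\<And>m m'. m \<in> Mon q \<Longrightarrow> m' \<in> Mon q \<Longrightarrow>
    (\<Sum>r\<in>shifts q. g m r * shifted_coeff y r m') = (if m = m' then 1 else 0)"
  shows "\<exists>f. (\<forall>m\<in>Mon q. f m \<in> shifts q) \<and> minor q f y \<noteq> 0"
proof (rule ccontr)
  assume *: "\<not> ?thesis"
  have "1 = det_on (Mon q) (\<lambda>m m'. if m = m' then 1 else (0::'b))"
    using det_on_identity[OF finite_Mon] by metis
  also have "\<dots> = det_on (Mon q) (\<lambda>m m'. \<Sum>r\<in>shifts q. g m r * shifted_coeff y r m')"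
    by (rule det_on_cong) (simp add: assms)
  also have "\<dots> = (\<Sum>f\<in>Mon q \<rightarrow>\<^sub>E shifts q. (\<Prod>i\<in>Mon q. g i (f i)) * minor q f y)"
    unfolding minor_def by (rule det_on_row_combination[OF finite_Mon finite_shifts])
  also have "\<dots> = 0"
  proof (intro sum.neutral ballI)
    fix f assume "f \<in> Mon q \<rightarrow>\<^sub>E shifts q"
    then have "minor q f y = 0" using * by blast
    then show "(\<Prod>i\<in>Mon q. g i (f i)) * minor q f y = 0" by simp
  qed
  finally show False by simp
qed

text \<open>The coefficients of the system \<open>x\<^sub>v ^ d v\<close>, at which the resultant is
  normalized.\<close>

definition pure_point :: "'v coeff_index \<Rightarrow> 'b::comm_ring_1" where
  "pure_point k = (if k = pure (fst k) (fst k) then 1 else 0)"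

text \<open>All coefficients of \<open>F v\<close> are multiplied by a new indeterminate, whose
  powers record the degree in this group of coefficients.\<close>

definition grading :: "'v \<Rightarrow> ('v coeff_index, int) mpoly \<Rightarrow> ('v coeff_index, int) mpoly poly" where
  "grading v = eval_int (\<lambda>k. if fst k = v then [:0, mvar k:] else [:mvar k:])"

text \<open>The least degree at which the pigeonhole principle makes every monomial in
  \<open>V\<close> divisible by some \<open>x\<^sub>u ^ d u\<close>.\<close>

definition macaulay_degree :: nat where
  "macaulay_degree = (\<Sum>v\<in>V. d v - 1) + 1"

text \<open>Macaulay's choice of rows: \<open>m\<close> is written as a monomial times some
  \<open>x\<^sub>u ^ d u\<close>, and this power is replaced by \<open>F u\<close>. The index
  \<open>v\<close> is the last resort, so that \<open>F v\<close> enters as few rows as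
  possible.\<close>

definition macaulay_row :: "'v \<Rightarrow> 'v monomial \<Rightarrow> 'v coeff_index" where
  "macaulay_row v m = (let u = if \<exists>u\<in>V - {v}. d u \<le> lookup m u
      then SOME u. u \<in> V - {v} \<and> d u \<le> lookup m u else v
    in (u, m - single u (d u)))"

lemma macaulay_row_cases:
  assumes v: "v \<in> V" and m: "m \<in> Mon macaulay_degree"
  obtains u where "u \<in> V" "macaulay_row v m = (u, m - single u (d u))"
    "d u \<le> lookup m u" "u = v \<longleftrightarrow> (\<forall>w\<in>V - {v}. lookup m w < d w)"
proof (cases "\<exists>u\<in>V - {v}. d u \<le> lookup m u")
  case True
  define u where "u = (SOME u. u \<in> V - {v} \<and> d u \<le> lookup m u)"
  have u: "u \<in> V - {v} \<and> d u \<le> lookup m u"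
    unfolding u_def by (rule someI_ex) (use True in blast)
  have "macaulay_row v m = (u, m - single u (d u))"
    unfolding macaulay_row_def u_def using True by (simp only: if_True Let_def)
  then show ?thesis
    using u by (intro that[of u]) (auto simp: not_less)
next
  case False
  have "d v \<le> lookup m v"
  proof (rule ccontr)
    assume *: "\<not> ?thesis"
    have "lookup m w \<le> d w - 1" if "w \<in> V" for w
    proof -
      have "lookup m w < d w" using False * that by (metis DiffI not_le singletonD)
      then show ?thesis by simp
    qed
    then have "(\<Sum>w\<in>V. lookup m w) \<le> (\<Sum>w\<in>V. d w - 1)" by (intro sum_mono)
    moreover have "macaulay_degree = (\<Sum>w\<in>V. lookup m w)"
      using m mdeg_superset[of V m] finite_V by (auto simp: monomials_of_degree_iff)
    ultimately show False by (simp add: macaulay_degree_def)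
  qed
  moreover have "macaulay_row v m = (v, m - single v (d v))"
    unfolding macaulay_row_def using False by (simp only: if_False Let_def)
  ultimately show ?thesis using v False by (intro that[of v]) (auto simp: not_le)
qed

lemma monomial_diff_add:
  "d u \<le> lookup m u \<Longrightarrow> m - single u (d u) + single u (d u) = m"
  for m :: "'v monomial"
  by (rule poly_mapping_eqI) (auto simp: lookup_add lookup_minus lookup_single when_def)

lemma macaulay_row_shifts:
  assumes v: "v \<in> V" and m: "m \<in> Mon macaulay_degree"
  shows "macaulay_row v m \<in> shifts macaulay_degree"
proof -
  obtain u where u: "u \<in> V" "macaulay_row v m = (u, m - single u (d u))"
    "d u \<le> lookup m u" using macaulay_row_cases[OF assms] by blast
  let ?k = "m - single u (d u)"
  have m_eq: "?k + single u (d u) = m" using u(3) by (rule monomial_diff_add)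
  then have "mdeg ?k + d u = macaulay_degree"
    using m by (metis mdeg_add mdeg_single monomials_of_degree_iff)
  moreover have "keys ?k \<subseteq> V"
    using m m_eq by (metis keys_add_nat le_sup_iff monomials_of_degree_iff)
  ultimately show ?thesis using u by (auto simp: shifts_def monomials_of_degree_iff)
qed

lemma shifted_coeff_pure_point:
  assumes "u \<in> V"
  shows "shifted_coeff pure_point (u, k) m = (if k + single u (d u) = m then 1 else 0)"
proof -
  let ?p = "single u (d u)"
  have p: "?p \<in> Mon (d u)" using assms by (rule monomials_of_degree_single)
  have "shifted_coeff pure_point (u, k) m =
    (\<Sum>l\<in>Mon (d u). if l = ?p then (if k + ?p = m then 1 else 0) else 0)"
    unfolding shifted_coeff_def by (intro sum.cong) (auto simp: pure_point_def pure_def)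
  then show ?thesis using p finite_Mon by simp
qed

text \<open>For the pure powers the replacement of \<open>x\<^sub>u ^ d u\<close> by
  \<open>F u\<close> changes nothing, so the matrix is the identity.\<close>

lemma macaulay_minor_pure_point:
  assumes v: "v \<in> V"
  shows "minor macaulay_degree (macaulay_row v) pure_point = 1"
proof -
  have "minor macaulay_degree (macaulay_row v) pure_point =
    det_on (Mon macaulay_degree) (\<lambda>m m'. if m = m' then 1 else (0 :: 'a))"
    unfolding minor_def
  proof (rule det_on_cong)
    fix m m' assume m: "m \<in> Mon macaulay_degree"
    obtain u where "u \<in> V" "macaulay_row v m = (u, m - single u (d u))"
      "d u \<le> lookup m u" using macaulay_row_cases[OF v m] by blast
    then show "shifted_coeff pure_point (macaulay_row v m) m' = (if m = m' then 1 else (0 :: 'a))"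
      by (simp add: shifted_coeff_pure_point monomial_diff_add)
  qed
  then show ?thesis by (simp add: det_on_identity finite_Mon)
qed

text \<open>The total degree fixes the exponent of \<open>v\<close>, so a monomial is determined by
  its other exponents, and these are bounded by \<open>d\<close>.\<close>

lemma card_reduced_monomials:
  assumes v: "v \<in> V"
  shows "card {m \<in> Mon q. \<forall>w\<in>V - {v}. lookup m w < d w} \<le> (\<Prod>w\<in>V - {v}. d w)"
proof -
  let ?M = "{m \<in> Mon q. \<forall>w\<in>V - {v}. lookup m w < d w}"
  let ?f = "\<lambda>m. restrict (lookup m) (V - {v})"
  have "inj_on ?f ?M"
  proof (rule inj_onI)
    fix m m' assume m: "m \<in> ?M" "m' \<in> ?M" and eq: "?f m = ?f m'"
    have eq': "lookup m w = lookup m' w" if "w \<in> V - {v}" for w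
      using fun_cong[OF eq, of w] that by simp
    have sum: "q = lookup k v + (\<Sum>w\<in>V - {v}. lookup k w)" if "k \<in> ?M" for k
    proof -
      have "q = (\<Sum>w\<in>V. lookup k w)"
        using that finite_V mdeg_superset[of V k] by (auto simp: monomials_of_degree_iff)
      then show ?thesis using v finite_V by (simp add: sum.remove)
    qed
    have "(\<Sum>w\<in>V - {v}. lookup m w) = (\<Sum>w\<in>V - {v}. lookup m' w)"
      using eq' by (intro sum.cong) auto
    then have eqv: "lookup m v = lookup m' v"
      using sum[OF m(1)] sum[OF m(2)] by linarith
    have zero: "lookup k w = 0" if "k \<in> ?M" "w \<notin> V" for k w
      using that by (metis (no_types, lifting) in_keys_iff mem_Collect_eq monomials_of_degree_iff subsetD)
    have "lookup m w = lookup m' w" for w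
    proof (cases "w \<in> V")
      case True
      then show ?thesis using eq'[of w] eqv by (cases "w = v") simp_all
    next
      case False
      show ?thesis unfolding zero[OF m(1) False] zero[OF m(2) False] ..
    qed
    then show "m = m'" by (rule poly_mapping_eqI)
  qed
  moreover have "?f ` ?M \<subseteq> (\<Pi>\<^sub>E w\<in>V - {v}. {..<d w})" by (auto split: if_splits)
  ultimately have "card ?M \<le> card (\<Pi>\<^sub>E w\<in>V - {v}. {..<d w})"
    using finite_V by (intro card_inj_on_le) (auto intro!: finite_PiE)
  then show ?thesis using finite_V by (simp add: card_PiE)
qed

text \<open>Each row taken from \<open>F v\<close> contributes at most 1 to the degree. Such rows
  belong to the monomials divisible by no \<open>x\<^sub>w ^ d w\<close> with
  \<open>w \<noteq> v\<close>, as \<open>v\<close> is chosen last.\<close>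

lemma degree_grading_macaulay:
  assumes v: "v \<in> V"
  shows "degree (grading v (minor macaulay_degree (macaulay_row v) mvar)) \<le> (\<Prod>w\<in>V - {v}. d w)"
proof -
  let ?M = "Mon macaulay_degree"
  let ?y = "\<lambda>k. if fst k = v then [:0, mvar k :: ('v coeff_index, int) mpoly:] else [:mvar k:]"
  have "grading v (minor macaulay_degree (macaulay_row v) mvar) = minor macaulay_degree (macaulay_row v) ?y"
    unfolding grading_def by (rule eval_int_minor)
  then have "degree (grading v (minor macaulay_degree (macaulay_row v) mvar)) \<le>
    (\<Sum>m\<in>?M. if fst (macaulay_row v m) = v then 1 else 0)"
    unfolding minor_def
  proof (simp only:, intro degree_det_on_le finite_Mon)
    fix m m' :: "'v monomial"
    have "degree (if snd r + k = m' then ?y (fst r, k) else 0) \<le> (if fst r = v then 1 else 0)" for r k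
      by auto
    then show "degree (shifted_coeff ?y (macaulay_row v m) m') \<le> (if fst (macaulay_row v m) = v then 1 else 0)"
      unfolding shifted_coeff_def by (intro degree_sum_le finite_Mon) blast
  qed
  also have "\<dots> = card {m\<in>?M. fst (macaulay_row v m) = v}"
    using finite_Mon by (simp add: sum.If_cases Int_def)
  also have "{m\<in>?M. fst (macaulay_row v m) = v} = {m \<in> ?M. \<forall>w\<in>V - {v}. lookup m w < d w}"
  proof (intro Collect_cong conj_cong refl)
    fix m assume "m \<in> ?M"
    with v show "fst (macaulay_row v m) = v \<longleftrightarrow> (\<forall>w\<in>V - {v}. lookup m w < d w)"
      using macaulay_row_cases by (metis fst_conv)
  qed
  also have "card \<dots> \<le> (\<Prod>w\<in>V - {v}. d w)" by (rule card_reduced_monomials[OF v])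
  finally show ?thesis .
qed

end

section \<open>The projective Nullstellensatz\<close>

text \<open>Gaussian elimination: one equation is solved for an unknown \<open>t0\<close> with
  nonzero coefficient, and both are removed.\<close>

lemma underdetermined_system:
  fixes A :: "'t \<Rightarrow> 'k \<Rightarrow> 'a::field"
  assumes "finite K" "finite T" "card T > card K"
  shows "\<exists>\<mu>. (\<exists>t\<in>T. \<mu> t \<noteq> 0) \<and> (\<forall>k\<in>K. (\<Sum>t\<in>T. \<mu> t * A t k) = 0)"
  using assms
proof (induction K arbitrary: T A)
  case empty
  then have "T \<noteq> {}" by auto
  then show ?case by (auto intro!: exI[of _ "\<lambda>_. 1"])
next
  case (insert k K)
  show ?case
  proof (cases "\<forall>t\<in>T. A t k = 0")
    case True
    obtain \<mu> where "\<exists>t\<in>T. \<mu> t \<noteq> 0" "\<forall>k\<in>K. (\<Sum>t\<in>T. \<mu> t * A t k) = 0"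
      using insert.IH[of T A] insert.prems insert.hyps by (metis Suc_lessD card_insert_disjoint)
    then show ?thesis using True by (intro exI[of _ \<mu>]) auto
  next
    case False
    then obtain t0 where t0: "t0 \<in> T" "A t0 k \<noteq> 0" by blast
    define A' where "A' t j = A t j - A t k / A t0 k * A t0 j" for t j
    have "card (T - {t0}) > card K" using insert t0 by simp
    then obtain \<mu> where \<mu>: "\<exists>t\<in>T - {t0}. \<mu> t \<noteq> 0" "\<And>j. j \<in> K \<Longrightarrow> (\<Sum>t\<in>T - {t0}. \<mu> t * A' t j) = 0"
      using insert.IH[of "T - {t0}" A'] insert.prems by auto
    define \<nu> where "\<nu> = \<mu>(t0 := - (\<Sum>t\<in>T - {t0}. \<mu> t * A t k) / A t0 k)"
    have sum: "(\<Sum>t\<in>T. \<nu> t * A t j) = (\<Sum>t\<in>T - {t0}. \<mu> t * A' t j)" for j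
    proof -
      have "(\<Sum>t\<in>T. \<nu> t * A t j) = \<nu> t0 * A t0 j + (\<Sum>t\<in>T - {t0}. \<nu> t * A t j)"
        using t0 insert.prems by (simp add: sum.remove)
      also have "(\<Sum>t\<in>T - {t0}. \<nu> t * A t j) = (\<Sum>t\<in>T - {t0}. \<mu> t * A t j)"
        by (intro sum.cong) (auto simp: \<nu>_def)
      also have "\<nu> t0 * A t0 j = - (\<Sum>t\<in>T - {t0}. \<mu> t * (A t k / A t0 k * A t0 j))"
        by (simp add: \<nu>_def sum_distrib_right sum_divide_distrib mult.assoc)
      finally show ?thesis by (simp add: A'_def algebra_simps sum_subtractf)
    qed
    have "A' t k = 0" for t using t0 by (simp add: A'_def)
    then have "\<forall>j\<in>insert k K. (\<Sum>t\<in>T. \<nu> t * A t j) = 0"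
      using \<mu>(2) by (auto simp: sum)
    moreover have "\<exists>t\<in>T. \<nu> t \<noteq> 0" using \<mu>(1) by (auto simp: \<nu>_def)
    ultimately show ?thesis by blast
  qed
qed

abbreviation const :: "'a::zero \<Rightarrow> ('v, 'a) mpoly" where
  "const c \<equiv> single 0 c"

abbreviation eval_at :: "('v \<Rightarrow> 'a::comm_ring_1) \<Rightarrow> ('v, 'a) mpoly \<Rightarrow> 'a" where
  "eval_at \<equiv> mpoly_eval (\<lambda>c. c)"

lemma coeff_hom_const: "coeff_hom (const :: 'a::comm_ring_1 \<Rightarrow> ('v, 'a) mpoly)"
  by unfold_locales (auto simp: single_add mult_single)

interpretation eval_at_hom: coeff_hom "eval_at x" for x :: "'v \<Rightarrow> 'a::comm_ring_1"
  by (rule eval_id.coeff_hom_mpoly_eval)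

section \<open>Maximal ideals and the affine Nullstellensatz\<close>

locale mpoly_ideal =
  fixes V :: "'v set" and J :: "('v, complex) mpoly set"
  assumes fin: "finite V" and subset: "J \<subseteq> mpolys V" and zero: "0 \<in> J"
    and add: "p \<in> J \<Longrightarrow> q \<in> J \<Longrightarrow> p + q \<in> J"
    and mult: "p \<in> J \<Longrightarrow> q \<in> mpolys V \<Longrightarrow> q * p \<in> J"
begin

lemma uminus: "p \<in> J \<Longrightarrow> - p \<in> J"
  using mult[of p "- 1"] mpolys_uminus[OF mpolys_one, of V] by simp

lemma diff: "p \<in> J \<Longrightarrow> q \<in> J \<Longrightarrow> p - q \<in> J"
  using add[of p "- q"] uminus[of q] by simp

lemma sum: "(\<And>i. i \<in> A \<Longrightarrow> f i \<in> J) \<Longrightarrow> sum f A \<in> J"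
  by (induction A rule: infinite_finite_induct) (auto intro: zero add)

lemma const_mem: "const c \<in> mpolys V"
  by (rule mpolys_single) auto

lemma unit_const: "c \<noteq> 0 \<Longrightarrow> const c * const (inverse c) = (1 :: ('v, complex) mpoly)"
  by (simp add: mult_single)

end

locale maximal_mpoly_ideal = mpoly_ideal V M
  for V :: "'v set" and M +
  assumes proper: "1 \<notin> M"
    and maximal: "mpoly_ideal V I \<Longrightarrow> M \<subseteq> I \<Longrightarrow> 1 \<notin> I \<Longrightarrow> I = M"
begin

lemma const_notin: "c \<noteq> 0 \<Longrightarrow> const c \<notin> M"
  using mult[of "const c" "const (inverse c)"] unit_const[of c] proper const_mem
  by (auto simp: mult.commute)

lemma inverse_mod:
  assumes "f \<in> mpolys V" "f \<notin> M"
  obtains g where "g \<in> mpolys V" "1 - g * f \<in> M"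
proof -
  define I where "I = {g * f + m | g m. g \<in> mpolys V \<and> m \<in> M}"
  have "mpoly_ideal V I"
  proof
    show "I \<subseteq> mpolys V" unfolding I_def using assms(1) subset by (auto intro!: mpolys_add mpolys_mult)
    have "0 * f + 0 \<in> I" unfolding I_def using mpolys_zero zero by blast
    then show "0 \<in> I" by simp
    fix p q assume p: "p \<in> I"
    then obtain g m where gm: "g \<in> mpolys V" "m \<in> M" "p = g * f + m" unfolding I_def by blast
    show "p + q \<in> I" if "q \<in> I"
    proof -
      from that obtain g' m' where "g' \<in> mpolys V" "m' \<in> M" "q = g' * f + m'" unfolding I_def by blast
      with gm have "p + q = (g + g') * f + (m + m')" "g + g' \<in> mpolys V" "m + m' \<in> M"
        by (auto simp: algebra_simps intro: mpolys_add add)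
      then show ?thesis unfolding I_def by blast
    qed
    show "q * p \<in> I" if "q \<in> mpolys V"
    proof -
      have "q * p = (q * g) * f + q * m" "q * g \<in> mpolys V" "q * m \<in> M"
        using gm that by (auto simp: distrib_left mult.assoc intro: mpolys_mult mult)
      then show ?thesis unfolding I_def by blast
    qed
  qed (rule fin)
  moreover have "M \<subseteq> I"
  proof
    fix m assume "m \<in> M"
    then have "0 * f + m \<in> I" unfolding I_def using mpolys_zero by blast
    then show "m \<in> I" by simp
  qed
  moreover have "I \<noteq> M"
  proof -
    have "1 * f + 0 \<in> I" unfolding I_def using mpolys_one zero by blast
    then show ?thesis using assms(2) by auto
  qed
  ultimately have "1 \<in> I" using maximal by blast
  then obtain g m where "g \<in> mpolys V" "m \<in> M" "1 = g * f + m" unfolding I_def by blast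
  moreover from this(3) have "1 - g * f = m" by (metis add_diff_cancel_left')
  ultimately show ?thesis using that by blast
qed

lemma prime:
  assumes "a \<in> mpolys V" "b \<in> mpolys V" "a * b \<in> M"
  shows "a \<in> M \<or> b \<in> M"
proof (rule disjCI)
  assume "b \<notin> M"
  then obtain g where g: "g \<in> mpolys V" "1 - g * b \<in> M" using inverse_mod assms by blast
  have "a * (1 - g * b) + g * (a * b) \<in> M"
    by (rule add[OF mult[OF g(2) assms(1)] mult[OF assms(3) g(1)]])
  then show "a \<in> M" by (simp add: algebra_simps)
qed

definition at_var :: "'v \<Rightarrow> complex poly \<Rightarrow> ('v, complex) mpoly" where
  "at_var v p = poly (map_poly const p) (mvar v)"

lemma at_var_pCons: "at_var v (pCons a p) = const a + mvar v * at_var v p"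
  by (cases "a = 0 \<and> p = 0") (auto simp: at_var_def map_poly_pCons)

interpretation at_var: coeff_hom "at_var v" for v
  unfolding at_var_def by (rule coeff_hom.coeff_hom_poly_map_poly[OF coeff_hom_const])

lemma at_var_smult: "at_var v (smult c p) = const c * at_var v p"
  using at_var.h_mult[of v "[:c:]" p] by (simp add: at_var_pCons at_var.h_zero)

lemma at_var_mem: "v \<in> V \<Longrightarrow> at_var v p \<in> mpolys V"
  by (induction p)
    (auto simp: at_var.h_zero at_var_pCons intro!: mpolys_zero mpolys_add mpolys_mult mpolys_mvar const_mem)

text \<open>Over the complex numbers the polynomial splits into linear factors; a maximal ideal is
  prime and contains no nonzero constant, so it contains one of them.\<close>

lemma linear_factor_mem:
  assumes v: "v \<in> V" and p: "p \<noteq> 0" "at_var v p \<in> M"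
  shows "\<exists>a. at_var v [:-a, 1:] \<in> M"
  using p
proof (induction "degree p" arbitrary: p rule: less_induct)
  case less
  show ?case
  proof (cases "degree p = 0")
    case True
    then obtain c where "p = [:c:]" using degree_eq_zeroE by blast
    then show ?thesis using less const_notin[of c] by (simp add: at_var_pCons at_var.h_zero)
  next
    case False
    then obtain r where "poly p r = 0"
      using fundamental_theorem_of_algebra_alt[of p] by (metis degree_pCons_0)
    then obtain q where q: "p = [:-r, 1:] * q" by (metis dvdE poly_eq_0_iff_dvd)
    then have "q \<noteq> 0" using less by auto
    then have "degree q < degree p" unfolding q by (subst degree_mult_eq) auto
    moreover have "at_var v [:-r, 1:] \<in> M \<or> at_var v q \<in> M"
      using less(3) at_var_mem[OF v] prime unfolding q at_var.h_mult by blast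
    ultimately show ?thesis using less(1) \<open>q \<noteq> 0\<close> by blast
  qed
qed

text \<open>Amitsur's trick: if no \<open>x - a\<close> lay in \<open>M\<close>, the uncountably many inverses of the \<open>x - a\<close> modulo
  \<open>M\<close> would be linearly dependent, since polynomials form a space of countable dimension.\<close>

lemma linear_mem:
  assumes v: "v \<in> V"
  shows "\<exists>a. mvar v - const a \<in> M"
proof (rule ccontr)
  assume none: "\<not> ?thesis"
  have lin: "at_var v [:-a, 1:] = mvar v - const a" for a
    by (simp add: single_uminus at_var_pCons at_var.h_zero at_var.h_one[unfolded one_pCons])
  have "\<exists>g. g \<in> mpolys V \<and> 1 - g * (mvar v - const t) \<in> M" for t
    using none inverse_mod[of "mvar v - const t"] v by (metis mpolys_diff mpolys_mvar const_mem)
  then obtain g where g: "\<And>t. g t \<in> mpolys V" "\<And>t. 1 - g t * (mvar v - const t) \<in> M"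
    by metis
  \<comment> \<open>Countably many sets, sorted by the degree of the chosen inverse, cover an
    uncountable field, so one of them is infinite.\<close>
  define D where "D k = {t. \<forall>m\<in>keys (g t). mdeg m \<le> k}" for k
  have "t \<in> D (Max (insert 0 (mdeg ` keys (g t))))" for t
    unfolding D_def by auto
  then have "(\<Union>k. D k) = UNIV" by blast
  then have "\<not> countable (\<Union>k. D k)" using uncountable_UNIV_complex by simp
  moreover have "countable (\<Union>k. D k)" if "\<And>k. finite (D k)"
    by (rule countable_UN) (use that countable_finite in auto)
  ultimately obtain k where "infinite (D k)" by blast
  define K where "K = (\<Union>j\<le>k. monomials_of_degree V j)"
  have finK: "finite K" unfolding K_def using finite_monomials_of_degree fin by blast
  obtain T where T: "T \<subseteq> D k" "finite T" "card T = Suc (card K)"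
    using infinite_arbitrarily_large[OF \<open>infinite (D k)\<close>] by metis
  \<comment> \<open>There is one inverse more than there are monomials of degree at most
    \<open>k\<close>, which forces a linear relation.\<close>
  obtain \<mu> where \<mu>: "\<exists>t\<in>T. \<mu> t \<noteq> 0" "\<And>m. m \<in> K \<Longrightarrow> (\<Sum>t\<in>T. \<mu> t * lookup (g t) m) = 0"
    using underdetermined_system[OF finK T(2), of "\<lambda>t. lookup (g t)"] T(3) by auto
  have keysK: "keys (g t) \<subseteq> K" if "t \<in> T" for t
    using that T(1) g(1)[of t] by (auto simp: K_def D_def mpolys_iff monomials_of_degree_iff)
  have rel: "(\<Sum>t\<in>T. const (\<mu> t) * g t) = 0"
  proof (rule poly_mapping_eqI)
    fix m
    have "const a * p = Poly_Mapping.map ((*) a) p" for a and p :: "('v, complex) mpoly"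
      by (simp add: mult_map_scale_conv_mult)
    then have "lookup (\<Sum>t\<in>T. const (\<mu> t) * g t) m = (\<Sum>t\<in>T. \<mu> t * lookup (g t) m)"
      by (auto simp: lookup_sum Poly_Mapping.map.rep_eq when_def intro!: sum.cong)
    also have "\<dots> = 0"
    proof (cases "m \<in> K")
      case False
      then have "lookup (g t) m = 0" if "t \<in> T" for t
        using keysK[OF that] by (meson in_keys_iff subsetD)
      then show ?thesis by simp
    qed (use \<mu> in auto)
    finally show "lookup (\<Sum>t\<in>T. const (\<mu> t) * g t) m = lookup 0 m" by simp
  qed
  define P where "P S = (\<Prod>t\<in>S. [:- t, 1:])" for S :: "complex set"
  \<comment> \<open>The relation between the inverses of the \<open>x - t\<close>, multiplied by
    their common denominator \<open>P T\<close>.\<close>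
  define p where "p = (\<Sum>t\<in>T. smult (\<mu> t) (P (T - {t})))"
  have PT: "at_var v (P T) = (mvar v - const t) * at_var v (P (T - {t}))" if "t \<in> T" for t
    unfolding P_def using that T(2)
    by (subst prod.remove[of T t]) (simp_all only: at_var.h_mult lin)
  \<comment> \<open>The subtracted sum is zero by the relation. It is inserted so that each term
    acquires the factor \<open>1 - g t * (mvar v - const t)\<close>, which lies in
    \<open>M\<close>.\<close>
  have "at_var v p = (\<Sum>t\<in>T. const (\<mu> t) * at_var v (P (T - {t}))) - at_var v (P T) * (\<Sum>t\<in>T. const (\<mu> t) * g t)"
    unfolding p_def rel by (simp add: at_var.h_sum at_var_smult)
  also have "\<dots> = (\<Sum>t\<in>T. const (\<mu> t) * at_var v (P (T - {t})) - at_var v (P T) * (const (\<mu> t) * g t))"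
    by (simp add: sum_distrib_left sum_subtractf)
  also have "\<dots> = (\<Sum>t\<in>T. (const (\<mu> t) * at_var v (P (T - {t}))) * (1 - g t * (mvar v - const t)))"
    by (intro sum.cong refl) (simp add: PT algebra_simps)
  also have "\<dots> \<in> M"
    using v by (intro sum mult g mpolys_mult const_mem at_var_mem)
  finally have pM: "at_var v p \<in> M" .
  have "p \<noteq> 0"
  proof -
    obtain t0 where t0: "t0 \<in> T" "\<mu> t0 \<noteq> 0" using \<mu>(1) by blast
    \<comment> \<open>At \<open>t0\<close> every other summand contains the factor
      \<open>t0 - t0\<close>.\<close>
    have "poly p t0 = (\<Sum>t\<in>T. \<mu> t * (\<Prod>s\<in>T - {t}. t0 - s))"
      by (simp add: p_def P_def poly_sum poly_prod)
    also have "\<dots> = \<mu> t0 * (\<Prod>s\<in>T - {t0}. t0 - s) + (\<Sum>t\<in>T - {t0}. \<mu> t * (\<Prod>s\<in>T - {t}. t0 - s))"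
      using t0 T(2) by (simp add: sum.remove)
    also have "(\<Sum>t\<in>T - {t0}. \<mu> t * (\<Prod>s\<in>T - {t}. t0 - s)) = 0"
      using t0 T(2) by (intro sum.neutral ballI) (auto intro!: prod_zero bexI[of _ t0])
    finally have "poly p t0 \<noteq> 0" using t0 T(2) by (auto)
    then show ?thesis by auto
  qed
  then show False using linear_factor_mem[OF v _ pM] none lin by auto
qed

text \<open>Modulo \<open>M\<close> each variable is a constant, hence each polynomial is congruent
  to its value at the point \<open>x\<close> of these constants. For an element of \<open>M\<close>
  this value is a constant in \<open>M\<close>, that is, 0.\<close>

lemma ex_common_zero: "\<exists>x. \<forall>p\<in>M. eval_at x p = 0"
proof -
  obtain x where x: "\<And>v. v \<in> V \<Longrightarrow> mvar v - const (x v) \<in> M"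
    using linear_mem by metis
  interpret c: coeff_hom "const :: complex \<Rightarrow> ('v, complex) mpoly" by (rule coeff_hom_const)
  define E where "E = {p \<in> mpolys V. p - const (eval_at x p) \<in> M}"
  have E_mult: "p * q \<in> E" if "p \<in> E" "q \<in> E" for p q
  proof -
    have "p * q - const (eval_at x (p * q)) =
      q * (p - const (eval_at x p)) + const (eval_at x p) * (q - const (eval_at x q))"
      by (simp add: algebra_simps eval_id.mpoly_eval_mult c.h_mult)
    also have "\<dots> \<in> M" using that by (intro add mult) (auto simp: E_def const_mem)
    finally show ?thesis using that by (auto simp: E_def intro: mpolys_mult)
  qed
  have E_add: "p + q \<in> E" if "p \<in> E" "q \<in> E" for p q
  proof -
    have "p + q - const (eval_at x (p + q)) = (p - const (eval_at x p)) + (q - const (eval_at x q))"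
      by (simp add: algebra_simps eval_id.mpoly_eval_add c.h_add)
    also have "\<dots> \<in> M" using that by (intro add) (auto simp: E_def)
    finally show ?thesis using that by (auto simp: E_def intro: mpolys_add)
  qed
  have E_const: "const a \<in> E" for a by (simp add: E_def const_mem zero)
  have E_var: "mvar v \<in> E" if "v \<in> V" for v
    using x[OF that] that by (simp add: E_def mpolys_mvar)
  have E_one: "1 \<in> E" using E_const[of 1] by simp
  have E_power: "p ^ n \<in> E" if "p \<in> E" for p n
    by (induction n) (auto simp: E_one E_mult that)
  have E_prod: "prod f A \<in> E" if "\<And>i. i \<in> A \<Longrightarrow> f i \<in> E" for f :: "'v \<Rightarrow> _" and A
    using that by (induction A rule: infinite_finite_induct) (auto simp: E_one E_mult)
  have E_sum: "sum f A \<in> E" if "\<And>i. i \<in> A \<Longrightarrow> f i \<in> E" for f :: "'v monomial \<Rightarrow> _" and A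
    using that E_const[of 0] by (induction A rule: infinite_finite_induct) (auto simp: E_add)
  have E_all: "p \<in> E" if "p \<in> mpolys V" for p
  proof -
    have "(\<Sum>m\<in>keys p. const (lookup p m) * monomial_eval mvar m) \<in> E"
      unfolding monomial_eval_def using that
      by (intro E_sum E_mult E_const E_prod E_power E_var) (auto simp: mpolys_iff)
    also have "(\<Sum>m\<in>keys p. const (lookup p m) * monomial_eval mvar m) = p"
      unfolding single_eq_monomial_eval_mvar[symmetric] by (rule poly_mapping_sum_single[symmetric])
    finally show ?thesis .
  qed
  have "eval_at x p = 0" if "p \<in> M" for p
  proof -
    have "p - const (eval_at x p) \<in> M" using E_all that subset by (auto simp: E_def)
    then have "p - (p - const (eval_at x p)) \<in> M" by (rule diff[OF that])
    then show ?thesis using const_notin by auto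
  qed
  then show ?thesis by blast
qed

end

text \<open>By Zorn's lemma \<open>J\<close> lies in a maximal ideal: the union of a chain of ideals
  is an ideal, and it omits 1 if all members do.\<close>

theorem weak_nullstellensatz:
  assumes "mpoly_ideal V J" "1 \<notin> J"
  shows "\<exists>x. \<forall>p\<in>J. eval_at x p = 0"
proof -
  interpret mpoly_ideal V J by fact
  let ?\<A> = "{I. mpoly_ideal V I \<and> J \<subseteq> I \<and> 1 \<notin> I}"
  have "\<exists>M\<in>?\<A>. \<forall>I\<in>?\<A>. M \<subseteq> I \<longrightarrow> I = M"
  proof (rule subset_Zorn_nonempty)
    show "?\<A> \<noteq> {}" using assms by blast
    fix \<C> assume ne: "\<C> \<noteq> {}" and chain: "subset.chain ?\<A> \<C>"
    then have sub: "\<C> \<subseteq> ?\<A>" by (auto simp: subset_chain_def)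
    have "mpoly_ideal V (\<Union>\<C>)"
    proof
      show "finite V" by (rule fin)
      show "\<Union>\<C> \<subseteq> mpolys V" using sub mpoly_ideal.subset by blast
      show "0 \<in> \<Union>\<C>" using ne sub mpoly_ideal.zero by fastforce
      show "p + q \<in> \<Union>\<C>" if pq: "p \<in> \<Union>\<C>" "q \<in> \<Union>\<C>" for p q
      proof -
        obtain I I' where I: "I \<in> \<C>" "I' \<in> \<C>" "p \<in> I" "q \<in> I'" using pq by blast
        then have "I \<subseteq> I' \<or> I' \<subseteq> I" using chain by (auto simp: subset_chain_def)
        then have "p \<in> I' \<and> q \<in> I' \<or> p \<in> I \<and> q \<in> I" using I by blast
        then show ?thesis using I sub mpoly_ideal.add by blast
      qed
      show "q * p \<in> \<Union>\<C>" if "p \<in> \<Union>\<C>" "q \<in> mpolys V" for p q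
        using that sub mpoly_ideal.mult by blast
    qed
    then show "\<Union>\<C> \<in> ?\<A>" using ne sub by blast
  qed
  then obtain M where M: "M \<in> ?\<A>" "\<forall>I\<in>?\<A>. M \<subseteq> I \<longrightarrow> I = M" ..
  interpret M: maximal_mpoly_ideal V M
    using M by (intro maximal_mpoly_ideal.intro maximal_mpoly_ideal_axioms.intro) blast+
  show ?thesis using M.ex_common_zero M(1) by blast
qed

section \<open>From affine to projective zeros\<close>

context form_system
begin

definition form_of :: "('v coeff_index \<Rightarrow> 'b::comm_ring_1) \<Rightarrow> 'v \<Rightarrow> ('v, 'b) mpoly" where
  "form_of y u = (\<Sum>l\<in>Mon (d u). single l (y (u, l)))"

text \<open>The degree \<open>q\<close> part of the ideal generated by the forms, that is, the span
  of the rows of the Macaulay matrix.\<close>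

inductive_set span_shifts :: "('v coeff_index \<Rightarrow> complex) \<Rightarrow> nat \<Rightarrow> ('v, complex) mpoly set"
  for y q where
  zero: "0 \<in> span_shifts y q"
| add: "p \<in> span_shifts y q \<Longrightarrow> (u, k) \<in> shifts q \<Longrightarrow>
    p + single k c * form_of y u \<in> span_shifts y q"

lemma span_shifts_add:
  assumes "p \<in> span_shifts y q" "p' \<in> span_shifts y q"
  shows "p + p' \<in> span_shifts y q"
  using assms(2)
proof induction
  case (add p' u k c)
  then have "(p + p') + single k c * form_of y u \<in> span_shifts y q"
    by (intro span_shifts.add)
  then show ?case by (simp add: add.assoc)
qed (use assms in auto)

lemma shifts_mult:
  assumes "(u, k) \<in> shifts q" "l \<in> Mon e"
  shows "(u, l + k) \<in> shifts (e + q)"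
proof -
  have "l + k \<in> Mon (e + (q - d u))"
    using assms by (intro monomials_of_degree_add) (auto simp: shifts_def)
  moreover have "e + (q - d u) = e + q - d u" using assms by (auto simp: shifts_def)
  ultimately show ?thesis using assms by (auto simp: shifts_def)
qed

lemma span_shifts_mult:
  assumes "p \<in> span_shifts y q" "l \<in> Mon e"
  shows "single l a * p \<in> span_shifts y (e + q)"
  using assms(1)
proof induction
  case (add p u k c)
  have "single l a * p + single (l + k) (a * c) * form_of y u \<in> span_shifts y (e + q)"
    using add shifts_mult assms(2) by (intro span_shifts.add)
  then show ?case by (simp add: distrib_left mult.assoc[symmetric] mult_single)
qed (auto intro: span_shifts.zero)

lemma lookup_shift_form:
  "lookup (single k c * form_of y u) m = c * shifted_coeff y (u, k) m"
  by (simp add: form_of_def sum_distrib_left mult_single lookup_sum lookup_single shifted_coeff_def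
      when_def if_distrib cong: if_cong)

lemma span_shifts_coeffs:
  assumes "p \<in> span_shifts y q"
  shows "\<exists>g. \<forall>m. lookup p m = (\<Sum>r\<in>shifts q. g r * shifted_coeff y r m)"
  using assms
proof induction
  case zero
  then show ?case by (intro exI[of _ "\<lambda>_. 0"]) simp
next
  case (add p u k c)
  then obtain g where g: "\<And>m. lookup p m = (\<Sum>r\<in>shifts q. g r * shifted_coeff y r m)"
    by blast
  have "lookup (p + single k c * form_of y u) m =
    (\<Sum>r\<in>shifts q. (g r + (if r = (u, k) then c else 0)) * shifted_coeff y r m)" for m
    using add(2) finite_shifts
    by (simp add: lookup_add lookup_shift_form g distrib_right sum.distrib if_distrib[of "\<lambda>x. x * _"] cong: if_cong)
  then show ?case by (intro exI[of _ "\<lambda>r. g r + (if r = (u, k) then c else 0)"]) blast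
qed

text \<open>Each monomial is filled up with \<open>x\<^sub>i\<close> to degree \<open>q\<close>.
  Monomials of larger degree stay as they are by truncated subtraction, so only large
  \<open>q\<close> are meaningful.\<close>

definition homogenize :: "'v \<Rightarrow> nat \<Rightarrow> ('v, complex) mpoly \<Rightarrow> ('v, complex) mpoly" where
  "homogenize i q p = (\<Sum>m\<in>keys p.
     single (m + single i (q - mdeg m)) (lookup p m))"

lemma homogenize_superset:
  assumes "finite S" "keys p \<subseteq> S"
  shows "homogenize i q p = (\<Sum>m\<in>S.
     single (m + single i (q - mdeg m)) (lookup p m))"
  unfolding homogenize_def using assms
  by (intro sum.mono_neutral_left) (auto simp: in_keys_iff)

lemma homogenize_zero [simp]: "homogenize i q 0 = 0"
  by (simp add: homogenize_def)

lemma homogenize_single [simp]: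
  "homogenize i q (single m c) = single (m + single i (q - mdeg m)) c"
  by (subst homogenize_superset[of "{m}"]) auto

lemma homogenize_add: "homogenize i q (p + p') = homogenize i q p + homogenize i q p'"
proof -
  let ?S = "keys p \<union> keys p'"
  have "keys (p + p') \<subseteq> ?S" by (rule keys_add)
  then show ?thesis
    by (simp add: homogenize_superset[of ?S] lookup_add single_add sum.distrib)
qed

lemma homogenize_sum: "homogenize i q (sum f A) = (\<Sum>j\<in>A. homogenize i q (f j))"
  by (induction A rule: infinite_finite_induct) (auto simp: homogenize_add)

lemma homogenize_mult:
  "homogenize i (mdeg k + q) (single k c * p) = single k c * homogenize i q p"
proof -
  have "homogenize i (mdeg k + q) (single k c * (\<Sum>m\<in>keys p. single m (lookup p m)))
    = single k c * homogenize i q p"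
    unfolding homogenize_def[of i q p]
    by (simp add: sum_distrib_left mult_single homogenize_sum mdeg_add add.assoc)
  then show ?thesis by (simp flip: poly_mapping_sum_single)
qed

text \<open>The affine ideal of the chart \<open>x\<^sub>i = 1\<close>, described through
  homogeneous elements. The condition for all large \<open>q\<close> is stable under sums and
  multiples.\<close>

definition saturation :: "'v \<Rightarrow> ('v coeff_index \<Rightarrow> complex) \<Rightarrow> ('v, complex) mpoly set" where
  "saturation i y = {p \<in> mpolys V. \<exists>q0. \<forall>q\<ge>q0. homogenize i q p \<in> span_shifts y q}"

lemma saturation_add:
  assumes "p \<in> saturation i y" "p' \<in> saturation i y"
  shows "p + p' \<in> saturation i y"
proof -
  obtain q0 q1 where "\<And>q. q \<ge> q0 \<Longrightarrow> homogenize i q p \<in> span_shifts y q"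
    "\<And>q. q \<ge> q1 \<Longrightarrow> homogenize i q p' \<in> span_shifts y q"
    using assms unfolding saturation_def by blast
  then have "homogenize i q (p + p') \<in> span_shifts y q" if "q \<ge> max q0 q1" for q
    using that by (auto simp: homogenize_add intro: span_shifts_add)
  moreover have "p + p' \<in> mpolys V" using assms unfolding saturation_def by (auto intro: mpolys_add)
  ultimately show ?thesis unfolding saturation_def by blast
qed

lemma ideal_saturation: "mpoly_ideal V (saturation i y)"
proof
  show zero: "0 \<in> saturation i y"
    by (auto simp: saturation_def mpolys_zero intro: span_shifts.zero)
  fix p p' assume p: "p \<in> saturation i y"
  show "p' * p \<in> saturation i y" if p': "p' \<in> mpolys V"
  proof -
    obtain q0 where q0: "\<And>q. q \<ge> q0 \<Longrightarrow> homogenize i q p \<in> span_shifts y q"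
      using p unfolding saturation_def by blast
    have single: "single k c * p \<in> saturation i y" if k: "keys k \<subseteq> V" for k c
    proof -
      have "homogenize i q (single k c * p) \<in> span_shifts y q" if "q \<ge> mdeg k + q0" for q
      proof -
        have q: "q = mdeg k + (q - mdeg k)" and "q - mdeg k \<ge> q0" using that by auto
        then have "single k c * homogenize i (q - mdeg k) p \<in> span_shifts y (mdeg k + (q - mdeg k))"
          using q0 k by (intro span_shifts_mult) (auto simp: monomials_of_degree_iff)
        then show ?thesis using homogenize_mult[of i k "q - mdeg k" c p] q by simp
      qed
      moreover have "single k c * p \<in> mpolys V"
        using k p by (intro mpolys_mult mpolys_single) (auto simp: saturation_def)
      ultimately show ?thesis unfolding saturation_def by blast
    qed
    have "(\<Sum>m\<in>S. single m (f m) * p) \<in> saturation i y"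
      if "finite S" "\<And>m. m \<in> S \<Longrightarrow> keys m \<subseteq> V" for S f
      using that by (induction S) (auto intro!: saturation_add single zero)
    from this[OF finite_keys, of p' "lookup p'"] show ?thesis
      using p' by (simp add: mpolys_iff sum_distrib_right[symmetric] poly_mapping_sum_single[symmetric])
  qed
  show "p + q \<in> saturation i y" if "q \<in> saturation i y" for q
    using p that by (rule saturation_add)
qed (auto intro: finite_V simp: saturation_def)

lemma eval_at_form_of: "eval_at x (form_of y u) = form_val y u x"
  by (simp add: form_of_def form_val_def eval_id.mpoly_eval_sum)

text \<open>If 1 were missing from the affine ideal, that ideal would have a zero with
  \<open>x\<^sub>i = 1\<close>, which is a nonzero common zero of the forms. Hence 1 lies in it, and
  its homogenization is \<open>x\<^sub>i ^ q\<close>.\<close>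

lemma pure_power_in_span:
  assumes nz: "\<not> has_zero y" and i: "i \<in> V"
  shows "\<exists>q0. \<forall>q\<ge>q0. single (single i q) 1 \<in> span_shifts y q"
proof -
  have "1 \<in> saturation i y"
  proof (rule ccontr)
    assume "1 \<notin> saturation i y"
    then obtain x where x: "\<And>p. p \<in> saturation i y \<Longrightarrow> eval_at x p = 0"
      using weak_nullstellensatz[OF ideal_saturation] by blast
    have "form_of y u \<in> saturation i y" if u: "u \<in> V" for u
    proof -
      have "homogenize i q (form_of y u) \<in> span_shifts y q" if "q \<ge> d u" for q
      proof -
        have "homogenize i q (form_of y u) = 0 + single (single i (q - d u)) 1 * form_of y u"
          unfolding form_of_def homogenize_sum sum_distrib_left mult_single homogenize_single
          by (auto intro!: sum.cong simp: monomials_of_degree_iff add.commute)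
        also have "\<dots> \<in> span_shifts y q"
          using that u i by (intro span_shifts.add span_shifts.zero) (auto simp: shifts_def monomials_of_degree_single)
        finally show ?thesis .
      qed
      moreover have "form_of y u \<in> mpolys V"
        unfolding form_of_def by (intro mpolys_sum mpolys_single) (auto simp: monomials_of_degree_iff)
      ultimately show ?thesis unfolding saturation_def by blast
    qed
    then have "is_zero y x" unfolding is_zero_def using x by (simp flip: eval_at_form_of)
    moreover have "mvar i + - 1 \<in> saturation i y"
    proof -
      \<comment> \<open>Both terms become \<open>x\<^sub>i ^ q\<close>. Thus
        \<open>x\<^sub>i - 1\<close> belongs to the ideal, and the normalization
        \<open>x\<^sub>i = 1\<close> needs no elimination of the variable.\<close>
      have "homogenize i q (mvar i + - 1) = 0" if "q \<ge> 1" for q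
      proof -
        have "- 1 = (single 0 (- 1) :: ('v, complex) mpoly)" by (simp add: single_uminus)
        moreover have "single i (Suc 0) + single i (q - Suc 0) = single i q"
          using that by (simp flip: single_add)
        ultimately show ?thesis
          unfolding homogenize_add mvar_def by (simp flip: single_add)
      qed
      moreover have "mvar i + - 1 \<in> (mpolys V :: ('v, complex) mpoly set)"
        using i by (intro mpolys_add mpolys_mvar mpolys_uminus mpolys_one)
      ultimately show ?thesis unfolding saturation_def using span_shifts.zero by force
    qed
    from x[OF this] have "x i = 1" using eval_id.mpoly_eval_add[of x "mvar i" "- 1"]
      eval_at_hom.h_minus[of x 1] by simp
    ultimately show False using nz has_zeroI[of y x i] i by simp
  qed
  then obtain q0 where "\<And>q. q \<ge> q0 \<Longrightarrow> homogenize i q (const 1) \<in> span_shifts y q"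
    unfolding saturation_def by auto
  then show ?thesis unfolding homogenize_single by auto
qed

text \<open>In large degree every monomial is divisible by a power of a variable that lies in the
  span of the rows. The rows then generate all monomials, and some maximal minor is nonzero.\<close>

theorem projective_nullstellensatz:
  assumes nz: "\<not> has_zero y"
  shows "\<exists>q f. (\<forall>m\<in>Mon q. f m \<in> shifts q) \<and> minor q f y \<noteq> 0"
proof -
  obtain Q where Q: "\<And>i q. i \<in> V \<Longrightarrow> q \<ge> Q i \<Longrightarrow> single (single i q) 1 \<in> span_shifts y q"
    using pure_power_in_span[OF nz] by metis
  \<comment> \<open>Above the sum of the bounds, some exponent of each monomial reaches its own
    bound.\<close>
  define q where "q = (\<Sum>i\<in>V. Q i) + 1"
  have span: "single m 1 \<in> span_shifts y q" if m: "m \<in> Mon q" for m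
  proof -
    have deg: "q = (\<Sum>i\<in>V. lookup m i)"
      using m mdeg_superset[of V m] finite_V by (auto simp: monomials_of_degree_iff)
    have "\<exists>i\<in>V. lookup m i \<ge> Q i"
    proof (rule ccontr)
      assume "\<not> ?thesis"
      then have "(\<Sum>i\<in>V. lookup m i) \<le> (\<Sum>i\<in>V. Q i)" by (intro sum_mono) (meson nat_le_linear)
      then show False using deg by (simp add: q_def)
    qed
    then obtain i where i: "i \<in> V" "lookup m i \<ge> Q i" by blast
    let ?e = "lookup m i"
    let ?k = "m - single i ?e"
    have m_eq: "?k + single i ?e = m"
      by (rule poly_mapping_eqI) (auto simp: lookup_add lookup_minus lookup_single when_def)
    have "mdeg ?k + ?e = q"
      using m m_eq by (metis mdeg_add mdeg_single monomials_of_degree_iff)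
    moreover have "keys ?k \<subseteq> V"
      using m m_eq by (metis keys_add_nat le_sup_iff monomials_of_degree_iff)
    moreover have "single (single i ?e) 1 \<in> span_shifts y ?e"
      using Q i by blast
    ultimately have "single ?k 1 * single (single i ?e) 1 \<in> span_shifts y q"
      using span_shifts_mult[of _ y ?e ?k "mdeg ?k" 1] by (auto simp: monomials_of_degree_iff)
    then show ?thesis unfolding mult_single m_eq by simp
  qed
  have "\<exists>g. \<forall>m'. lookup (single m 1) m' =
      (\<Sum>r\<in>shifts q. g r * shifted_coeff y r m')" if "m \<in> Mon q" for m
    using span_shifts_coeffs[OF span[OF that]] .
  then obtain g where "\<And>m m'. m \<in> Mon q \<Longrightarrow> lookup (single m 1) m' =
      (\<Sum>r\<in>shifts q. g m r * shifted_coeff y r m')" by metis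
  then have "\<exists>f. (\<forall>m\<in>Mon q. f m \<in> shifts q) \<and> minor q f y \<noteq> 0"
    by (intro nonzero_minor[of q g y]) (simp add: lookup_single when_def)
  then show ?thesis by blast
qed

end

section \<open>Existence and uniqueness of the resultant\<close>

lemma (in subring_of) prime_in_uminus:
  assumes "prime_in A p"
  shows "prime_in A (- p)"
proof -
  have dvd: "dvd_in A (- p) a \<longleftrightarrow> dvd_in A p a" for a
    unfolding dvd_in_def by (metis minus_mult_commute minus_minus uminus_mem)
  show ?thesis using assms uminus_mem unfolding prime_in_def unit_in_def dvd by auto
qed

context form_system
begin

lemma vanishing_add: "vanishing G \<Longrightarrow> vanishing H \<Longrightarrow> vanishing (G + H)"
  by (simp add: vanishing_def eval_int.mpoly_eval_add)

lemma vanishing_mult: "vanishing G \<Longrightarrow> vanishing (H * G)"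
  by (simp add: vanishing_def eval_int.mpoly_eval_mult)

lemma not_vanishing_one: "\<not> vanishing 1"
proof -
  have "is_zero (\<lambda>_. 0 :: complex) (\<lambda>_. 1)" by (simp add: is_zero_def form_val_def)
  then have "has_zero (\<lambda>_. 0)" using nonempty_V has_zeroI by fastforce
  then show ?thesis by (auto simp: vanishing_def)
qed

lemma vanishing_prime_factor:
  assumes "a \<in> prime_products (mpolys CV)" "vanishing a"
  shows "\<exists>p. prime_in (mpolys CV) p \<and> vanishing p \<and> dvd_in (mpolys CV) p a"
  using assms
proof (induction rule: prime_products.induct)
  case (unit u)
  then obtain c where "1 = u * c" unfolding unit_in_def dvd_in_def by blast
  then have "vanishing 1" using vanishing_mult[OF unit(2), of c] by (simp add: mult.commute)
  then show ?case using not_vanishing_one by blast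
next
  case (mult p a)
  interpret S: subring_of "mpolys CV :: ('v coeff_index, int) mpoly set" by (rule subring_mpolys)
  from mult.prems have "vanishing p \<or> vanishing a" by (rule vanishing_prime)
  then show ?case
  proof
    assume "vanishing p"
    then show ?thesis
      using mult.hyps S.prime_products_mem unfolding dvd_in_def by blast
  next
    assume "vanishing a"
    then obtain q where q: "prime_in (mpolys CV) q" "vanishing q" "dvd_in (mpolys CV) q a"
      using mult.IH by blast
    moreover have "p \<in> mpolys CV" using mult.hyps by (auto simp: prime_in_def)
    ultimately show ?thesis using S.dvd_in_mult2 by blast
  qed
qed

text \<open>Otherwise elimination of the coefficient \<open>?t\<close> of a pure power gives a
  nonzero combination of \<open>R\<close> and \<open>G\<close> without this coefficient; it still
  vanishes on all systems with a zero, which is impossible.\<close>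

lemma vanishing_dvd:
  assumes R: "prime_in (mpolys CV) R" "vanishing R" and G: "G \<in> mpolys CV" "vanishing G"
  shows "dvd_in (mpolys CV) R G"
proof (rule ccontr)
  assume ndvd: "\<not> ?thesis"
  obtain i where i: "i \<in> V" using nonempty_V by blast
  let ?t = "pure i i"
  have CV: "insert ?t (CV - {?t}) = CV" using pure_in_CV[OF i i] by blast
  have "R \<noteq> 0" using R by (auto simp: prime_in_def)
  then have "R \<notin> mpolys (CV - {?t})" using vanishing_free_of_pure[OF i _ R(2)] by blast
  then obtain u v r where "r \<in> mpolys (CV - {?t})" "r \<noteq> 0" "u * R + v * G = r"
    using mpolys_elimination[of "CV - {?t}" ?t R G] finite_CV R G ndvd unfolding CV by auto
  moreover from this(3) have "vanishing r" using R G by (auto intro: vanishing_add vanishing_mult)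
  ultimately show False using vanishing_free_of_pure[OF i] by blast
qed

text \<open>A prime factor of a Macaulay determinant. The determinant has value 1 at the pure
  powers, so the factor has an integer unit as value there, and its sign can be adjusted.\<close>

lemma ex_vanishing_prime:
  obtains R where "prime_in (mpolys CV) R" "vanishing R" "eval_int pure_point R = (1 :: int)"
proof -
  interpret F: factorial_subring "mpolys CV :: ('v coeff_index, int) mpoly set"
    by (rule factorial_mpolys[OF finite_CV])
  obtain v where v: "v \<in> V" using nonempty_V by blast
  define D where "D = (minor macaulay_degree (macaulay_row v) mvar :: ('v coeff_index, int) mpoly)"
  have D1: "eval_int pure_point D = (1 :: int)"
    unfolding D_def eval_int_minor by (rule macaulay_minor_pure_point[OF v])
  have "D \<in> mpolys CV" "vanishing D"
    unfolding D_def using macaulay_row_shifts[OF v] by (auto intro: minor_mpolys vanishing_minor)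
  moreover have "D \<noteq> 0" using D1 by (metis eval_int.mpoly_eval_zero zero_neq_one)
  ultimately obtain p where p: "prime_in (mpolys CV) p" "vanishing p" "dvd_in (mpolys CV) p D"
    using F.factor vanishing_prime_factor by blast
  then obtain q where "D = p * q" by (auto simp: dvd_in_def)
  then have "eval_int pure_point p * eval_int pure_point q = (1 :: int)"
    using D1 by (simp add: eval_int.mpoly_eval_mult del: of_int_eq_id)
  then have "eval_int pure_point p = (1 :: int) \<or> eval_int pure_point p = (- 1 :: int)"
    by (metis zmult_eq_1_iff)
  moreover have "eval_int pure_point (- p) = - (eval_int pure_point p :: int)"
    by (rule eval_int_hom.h_minus)
  moreover have "vanishing (- p)" using vanishing_mult[OF p(2), of "- 1"] by simp
  ultimately show ?thesis using that p F.prime_in_uminus by force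
qed

lemma eval_int_int: "mpoly_eval (\<lambda>c. c) x G = (eval_int x G :: int)"
  by (simp add: mpoly_eval_def)

lemma form_val_form_coeffs:
  assumes "F v \<in> forms V (d v)"
  shows "form_val (form_coeffs F) v x = mpoly_eval (\<lambda>c. c) x (F v)"
  using assms eval_id.mpoly_eval_superset[OF finite_Mon, of "F v" "d v" x]
  by (simp add: form_val_def form_coeffs_def forms_def)

lemma is_zero_form_coeffs:
  assumes "\<And>v. v \<in> V \<Longrightarrow> F v \<in> forms V (d v)"
  shows "is_zero (form_coeffs F) x \<longleftrightarrow> (\<forall>v\<in>V. mpoly_eval (\<lambda>c. c) x (F v) = 0)"
  by (simp add: is_zero_def form_val_form_coeffs assms)

lemma form_of_forms: "form_of y v \<in> forms V (d v)"
proof -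
  have "keys (\<Sum>l\<in>S. single l (y (v, l))) \<subseteq> S" if "finite S" for S
    using that
  proof (induction S)
    case (insert l S)
    then show ?case
      using keys_add[of "single l (y (v, l))" "\<Sum>l\<in>S. single l (y (v, l))"]
      by (auto split: if_splits)
  qed simp
  then show ?thesis using finite_Mon by (simp add: form_of_def forms_def)
qed

lemma form_coeffs_form_of: "k \<in> CV \<Longrightarrow> form_coeffs (form_of y) k = y k"
  using finite_Mon
  by (auto simp: form_coeffs_def form_of_def coeff_vars_def lookup_sum lookup_single when_def)

lemma form_coeffs_pure_power: "form_coeffs (\<lambda>v. pure_power v (d v)) = pure_point"
  by (auto simp: fun_eq_iff form_coeffs_def pure_power_def pure_point_def pure_def lookup_single when_def)

text \<open>On the line from \<open>y0\<close> to any other point, \<open>u\<close> becomes a unit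
  among complex polynomials in one variable, hence constant.\<close>

lemma unit_mpoly_eq_one:
  fixes u w :: "('v coeff_index, int) mpoly"
  assumes "u * w = 1" "eval_int y0 u = (1 :: complex)"
  shows "u = 1"
proof (rule ccontr)
  assume "u \<noteq> 1"
  then obtain y where y: "eval_int y (u - 1) \<noteq> (0 :: complex)"
    using eval_int_nonzero[of "u - 1"] by auto
  define Y where "Y k = [:y0 k, y k - y0 k:]" for k
  have "eval_int Y u * eval_int Y w = 1"
    using assms(1) by (metis eval_int.mpoly_eval_mult eval_int.mpoly_eval_one)
  then have "degree (eval_int Y u) = 0"
    by (metis add_is_0 degree_1 degree_mult_eq mult_zero_left mult_zero_right zero_neq_one)
  then have "poly (eval_int Y u) 1 = poly (eval_int Y u) 0"
    by (metis degree_eq_zeroE mult_zero_right poly_pCons poly_0 add_0_right)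
  then have "eval_int y u = eval_int y0 u" by (simp add: poly_eval_int Y_def)
  then show False using y assms(2) by (simp add: eval_int_hom.h_diff)
qed

lemma ex_resultant:
  obtains R where "is_resultant_poly V d R"
    "\<And>R'. is_resultant_poly V d R' \<Longrightarrow> R' = R"
    "\<And>G. G \<in> mpolys CV \<Longrightarrow> vanishing G \<Longrightarrow> \<exists>H. G = R * H"
proof -
  obtain R where R: "prime_in (mpolys CV) R" "vanishing R" "eval_int pure_point R = (1 :: int)"
    by (rule ex_vanishing_prime)
  interpret U: subring_of "UNIV :: ('v coeff_index, int) mpoly set" by unfold_locales auto
  have unit_UNIV: "unit_in UNIV a \<longleftrightarrow> a dvd 1" for a :: "('v coeff_index, int) mpoly"
    by (simp add: unit_in_def dvd_in_def dvd_def)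
  have "prime_in UNIV R" using R(1) by (rule prime_in_mpolys_UNIV)
  then have nu: "R \<noteq> 0" "\<not> R dvd 1" unfolding prime_in_def unit_UNIV by blast+
  have irr: "irreducible R"
    using nu U.prime_in_irreducible[OF \<open>prime_in UNIV R\<close>] unfolding unit_UNIV
    by (intro irreducibleI) blast+
  have zero_iff: "eval_int y R = 0 \<longleftrightarrow> has_zero y" for y :: "'v coeff_index \<Rightarrow> complex"
  proof
    assume 0: "eval_int y R = 0"
    show "has_zero y"
    proof (rule ccontr)
      assume "\<not> has_zero y"
      then obtain q f where qf: "\<forall>m\<in>Mon q. f m \<in> shifts q" "minor q f y \<noteq> 0"
        using projective_nullstellensatz by blast
      \<comment> \<open>A nonzero value of a multiple of \<open>R\<close> contradicts
        \<open>eval_int y R = 0\<close>.\<close>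
      then have "dvd_in (mpolys CV) R (minor q f mvar)"
        using vanishing_dvd[OF R(1,2) minor_mpolys vanishing_minor] by blast
      then obtain H where H: "minor q f mvar = R * H" by (auto simp: dvd_in_def)
      have "minor q f y = eval_int y R * eval_int y H"
        using arg_cong[OF H, of "eval_int y"] by (simp add: eval_int_minor eval_int.mpoly_eval_mult)
      then show False using qf 0 by simp
    qed
  qed (use R in \<open>auto simp: vanishing_def\<close>)
  have pure_eval: "mpoly_eval (\<lambda>c. c) (form_coeffs (\<lambda>v. pure_power v (d v))) G = eval_int pure_point G"
    for G :: "('v coeff_index, int) mpoly"
    unfolding form_coeffs_pure_power by (rule eval_int_int)
  show ?thesis
  proof (rule that[of R])
    show "is_resultant_poly V d R"
      unfolding is_resultant_poly_def
    proof (intro conjI allI impI irr)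
      show "mpoly_vars R \<subseteq> CV" using R(1) by (auto simp: prime_in_def mpolys_def)
      show "mpoly_eval (\<lambda>c. c) (form_coeffs (\<lambda>v. pure_power v (d v))) R = 1"
        unfolding pure_eval by (rule R(3))
      fix F :: "'v \<Rightarrow> ('v, complex) mpoly" assume "\<forall>v\<in>V. F v \<in> forms V (d v)"
      then show "eval_int (form_coeffs F) R = 0 \<longleftrightarrow> has_nonzero_common_zero V F"
        unfolding zero_iff has_zero_def has_nonzero_common_zero_def
        using is_zero_form_coeffs[of F] by auto
    qed
    show "\<exists>H. G = R * H" if "G \<in> mpolys CV" "vanishing G" for G
      using vanishing_dvd[OF R(1,2) that] by (auto simp: dvd_in_def)
    fix R' assume R': "is_resultant_poly V d R'"
    have vars: "R' \<in> mpolys CV" using R' by (auto simp: is_resultant_poly_def mpolys_def)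
    have "vanishing R'"
      unfolding vanishing_def
    proof (intro allI impI)
      fix y :: "'v coeff_index \<Rightarrow> complex" assume "has_zero y"
      \<comment> \<open>\<open>form_of y\<close> keeps only the coefficients indexed by
        \<open>CV\<close>; neither the zeros nor \<open>R'\<close> depend on the other values of
        \<open>y\<close>.\<close>
      moreover have "is_zero (form_coeffs (form_of y)) x \<longleftrightarrow> is_zero y x" for x
        unfolding is_zero_def
        by (intro ball_cong refl arg_cong2[where f = "(=)"] form_val_cong form_coeffs_form_of)
          (auto simp: coeff_vars_def)
      ultimately have "has_nonzero_common_zero V (form_of y)"
        unfolding has_zero_def has_nonzero_common_zero_def
        using is_zero_form_coeffs[of "form_of y"] form_of_forms by metis
      then have "eval_int (form_coeffs (form_of y)) R' = 0"
        using R' form_of_forms unfolding is_resultant_poly_def by blast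
      moreover have "eval_int (form_coeffs (form_of y)) R' = eval_int y R'"
        using vars by (intro mpoly_eval_cong form_coeffs_form_of) (auto simp: mpolys_def)
      ultimately show "eval_int y R' = 0" by simp
    qed
    then obtain u where u: "R' = R * u"
      using vanishing_dvd[OF R(1,2) vars] by (auto simp: dvd_in_def)
    have "irreducible R'" using R' by (simp add: is_resultant_poly_def)
    then have "u dvd 1" using irreducibleD[of R' R u] u nu by blast
    then obtain w where w: "u * w = 1" by (metis dvdE)
    have "eval_int pure_point R' = (1 :: int)"
      using R' unfolding is_resultant_poly_def pure_eval by blast
    then have "eval_int pure_point u = (1 :: int)"
      using R(3) by (simp add: u eval_int.mpoly_eval_mult del: of_int_eq_id)
    then have "of_int (eval_int pure_point u :: int) = (1 :: complex)" by simp
    then have "eval_int (\<lambda>k. of_int (pure_point k)) u = (1 :: complex)"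
      by (simp add: eval_int.hom_eval_int del: of_int_eq_id)
    then show "R' = R" using unit_mpoly_eq_one[OF w] u by simp
  qed
qed

section \<open>The resultant of the system: zeros, normalization, degree bound\<close>

definition res :: "('v coeff_index, int) mpoly" where
  "res = resultant_poly V d"

lemma is_resultant_res: "is_resultant_poly V d res"
  and res_dvd: "G \<in> mpolys CV \<Longrightarrow> vanishing G \<Longrightarrow> \<exists>H. G = res * H"
proof -
  obtain R where R: "is_resultant_poly V d R" "\<And>R'. is_resultant_poly V d R' \<Longrightarrow> R' = R"
    "\<And>G. G \<in> mpolys CV \<Longrightarrow> vanishing G \<Longrightarrow> \<exists>H. G = R * H"
    by (rule ex_resultant) blast
  have "res = R" unfolding res_def resultant_poly_def using R(1,2) by (rule the_equality)
  then show "is_resultant_poly V d res" "G \<in> mpolys CV \<Longrightarrow> vanishing G \<Longrightarrow> \<exists>H. G = res * H"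
    using R(1,3) unfolding \<open>res = R\<close> by blast+
qed

lemma res_mpolys: "res \<in> mpolys CV"
  using is_resultant_res by (auto simp: is_resultant_poly_def mpolys_def)

lemma res_zero_iff: "eval_int y res = 0 \<longleftrightarrow> has_zero y"
proof -
  have "eval_int (form_coeffs (form_of y)) res = 0 \<longleftrightarrow> has_nonzero_common_zero V (form_of y)"
    using is_resultant_res form_of_forms unfolding is_resultant_poly_def by blast
  moreover have "eval_int (form_coeffs (form_of y)) res = eval_int y res"
    using res_mpolys by (intro mpoly_eval_cong form_coeffs_form_of) (auto simp: mpolys_def)
  moreover have "has_nonzero_common_zero V (form_of y) \<longleftrightarrow> has_zero y"
    unfolding has_zero_def has_nonzero_common_zero_def is_zero_def eval_at_form_of ..
  ultimately show ?thesis by simp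
qed

lemma res_pure_point: "eval_int pure_point res = (1 :: complex)"
proof -
  have "eval_int pure_point res = (1 :: int)"
    using is_resultant_res unfolding is_resultant_poly_def form_coeffs_pure_power eval_int_int by blast
  then have "of_int (eval_int pure_point res :: int) = (1 :: complex)" by simp
  then have "eval_int (\<lambda>k. of_int (pure_point k)) res = (1 :: complex)"
    by (simp add: eval_int.hom_eval_int del: of_int_eq_id)
  moreover have "(\<lambda>k. of_int (pure_point k)) = (pure_point :: _ \<Rightarrow> complex)"
    by (auto simp: pure_point_def)
  ultimately show ?thesis by simp
qed

lemma res_nonzero: "res \<noteq> 0"
  using res_pure_point by auto

text \<open>The resultant divides the Macaulay determinant that favours \<open>v\<close>, and
  degrees add up in a product of nonzero polynomials.\<close>

lemma degree_grading_res:
  assumes v: "v \<in> V"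
  shows "degree (grading v res) \<le> (\<Prod>w\<in>V - {v}. d w)"
proof -
  let ?D = "minor macaulay_degree (macaulay_row v) mvar :: ('v coeff_index, int) mpoly"
  obtain H where H: "?D = res * H"
    using res_dvd[OF minor_mpolys vanishing_minor] macaulay_row_shifts[OF v] by blast
  have "eval_int pure_point ?D = (1 :: int)"
    unfolding eval_int_minor by (rule macaulay_minor_pure_point[OF v])
  then have "?D \<noteq> 0" by (metis eval_int.mpoly_eval_zero zero_neq_one)
  moreover have grading_1: "poly (grading v G) 1 = G" for G
  proof -
    have "poly (grading v G) 1 = eval_int mvar G"
      unfolding grading_def coeff_hom.hom_eval_int[OF coeff_hom_poly] by (intro mpoly_eval_cong) auto
    then show ?thesis by (simp add: eval_int_mvar)
  qed
  moreover have "grading v ?D = grading v res * grading v H"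
    unfolding H grading_def by (rule eval_int.mpoly_eval_mult)
  ultimately have "degree (grading v ?D) = degree (grading v res) + degree (grading v H)"
    by (metis degree_mult_eq mult_zero_left mult_zero_right poly_0)
  then show ?thesis using degree_grading_macaulay[OF v] by simp
qed

end

section \<open>Homogeneity and the Poisson formula\<close>

lemma coeff_prod_top:
  fixes f :: "'i \<Rightarrow> 'a::comm_ring_1 poly"
  assumes "finite S" "\<And>i. i \<in> S \<Longrightarrow> degree (f i) \<le> e i"
  shows "degree (prod f S) \<le> sum e S \<and> coeff (prod f S) (sum e S) = (\<Prod>i\<in>S. coeff (f i) (e i))"
  using assms
proof (induction S)
  case (insert i S)
  let ?p = "f i" and ?q = "prod f S" and ?a = "e i" and ?b = "sum e S"
  have p: "degree ?p \<le> ?a" and q: "degree ?q \<le> ?b" "coeff ?q ?b = (\<Prod>i\<in>S. coeff (f i) (e i))"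
    using insert by auto
  have "coeff (?p * ?q) (?a + ?b) = (\<Sum>k\<le>?a + ?b. coeff ?p k * coeff ?q (?a + ?b - k))"
    by (rule coeff_mult)
  also have "\<dots> = (\<Sum>k\<in>{?a}. coeff ?p k * coeff ?q (?a + ?b - k))"
  proof (intro sum.mono_neutral_right ballI)
    fix k assume k: "k \<in> {..?a + ?b} - {?a}"
    show "coeff ?p k * coeff ?q (?a + ?b - k) = 0"
    proof (cases "k > ?a")
      case True
      then show ?thesis using p by (simp add: coeff_eq_0)
    next
      case False
      then have "?a + ?b - k > ?b" using k by auto
      then show ?thesis using q by (simp add: coeff_eq_0)
    qed
  qed auto
  finally have "coeff (?p * ?q) (?a + ?b) = coeff ?p ?a * coeff ?q ?b" by simp
  moreover have "degree (?p * ?q) \<le> ?a + ?b"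
    using degree_mult_le[of ?p ?q] p q by linarith
  ultimately show ?case using insert q by simp
qed simp

lemma coeff_power_top:
  fixes p :: "'a::comm_ring_1 poly"
  assumes "degree p \<le> e"
  shows "degree (p ^ n) \<le> n * e \<and> coeff (p ^ n) (n * e) = coeff p e ^ n"
  using coeff_prod_top[of "{..<n}" "\<lambda>_. p" "\<lambda>_. e"] assms by simp

lemma complex_poly_only_zero_root:
  assumes "\<And>s. s \<noteq> 0 \<Longrightarrow> poly p s \<noteq> (0 :: complex)"
  shows "p = monom (lead_coeff p) (degree p)"
proof -
  obtain root where p: "smult (lead_coeff p) (\<Prod>i<degree p. [:- root i, 1:]) = p"
    by (rule complex_poly_decompose')
  have "root i = 0" if "i < degree p" for i
  proof (rule ccontr)
    assume "root i \<noteq> 0"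
    then have "poly (smult (lead_coeff p) (\<Prod>i<degree p. [:- root i, 1:])) (root i) \<noteq> 0"
      unfolding p by (rule assms)
    then show False using that by (auto simp: poly_prod)
  qed
  then have "(\<Prod>i<degree p. [:- root i, 1:]) = [:0, 1:] ^ degree p" by simp
  then show ?thesis using p by (simp add: monom_altdef)
qed

text \<open>Powers of a single number \<open>z\<close> suffice as weights: the difference of the
  sums for two distinct points is a nonzero polynomial in \<open>z\<close>, and only finitely many
  pairs have to be separated.\<close>

lemma ex_separating_weights:
  fixes P :: "('v \<Rightarrow> complex) set"
  assumes "finite V" "finite P" "\<And>x x'. x \<in> P \<Longrightarrow> x' \<in> P \<Longrightarrow> x \<noteq> x' \<Longrightarrow> \<exists>u\<in>V. x u \<noteq> x' u"
  shows "\<exists>w. inj_on (\<lambda>x. \<Sum>u\<in>V. w u * x u) P"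
proof -
  obtain idx :: "'v \<Rightarrow> nat" where idx: "inj_on idx V"
    using finite_imp_inj_to_nat_seg[OF assms(1)] by blast
  define p where "p x x' = (\<Sum>u\<in>V. monom (x u - x' u) (idx u))" for x x' :: "'v \<Rightarrow> complex"
  let ?Q = "{(x, x'). x \<in> P \<and> x' \<in> P \<and> x \<noteq> x'}"
  have fin: "finite ?Q" by (rule finite_subset[of _ "P \<times> P"]) (use assms in auto)
  have "p x x' \<noteq> 0" if x: "x \<in> P" "x' \<in> P" "x \<noteq> x'" for x x'
  proof -
    obtain u where u: "u \<in> V" "x u \<noteq> x' u" using assms(3) x by blast
    have "coeff (p x x') (idx u) = (\<Sum>v\<in>V. if v = u then x v - x' v else 0)"
      unfolding p_def coeff_sum using idx u by (intro sum.cong) (auto dest: inj_onD)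
    then show ?thesis using u assms(1) by auto
  qed
  then have "(\<Prod>(x, x')\<in>?Q. p x x') \<noteq> 0" using fin by auto
  then obtain z where "poly (\<Prod>(x, x')\<in>?Q. p x x') z \<noteq> 0" using poly_all_0_iff_0 by blast
  then have z: "poly (p x x') z \<noteq> 0" if "x \<in> P" "x' \<in> P" "x \<noteq> x'" for x x'
    using fin that by (auto simp: poly_prod split_def)
  have "poly (p x x') z = (\<Sum>u\<in>V. z ^ idx u * x u) - (\<Sum>u\<in>V. z ^ idx u * x' u)" for x x'
    by (simp add: p_def poly_sum poly_monom algebra_simps sum_subtractf)
  then have "inj_on (\<lambda>x. \<Sum>u\<in>V. z ^ idx u * x u) P"
    using z by (intro inj_onI) (metis cancel_comm_monoid_add_class.diff_cancel)
  then show ?thesis by (intro exI[of _ "\<lambda>u. z ^ idx u"])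
qed

lemma poly_eq_of_nonzero_roots:
  fixes p q r :: "complex poly"
  assumes "r \<noteq> 0" "\<And>s. poly r s \<noteq> 0 \<Longrightarrow> poly p s = poly q s"
  shows "p = q"
proof -
  have "poly ((p - q) * r) s = 0" for s using assms(2)[of s] by auto
  then have "(p - q) * r = 0" using poly_all_0_iff_0 by blast
  then show ?thesis using assms(1) by auto
qed

section \<open>Homogeneity in the coefficients of one form\<close>

context form_system
begin

definition group_degree :: "'v \<Rightarrow> ('v coeff_index) monomial \<Rightarrow> nat" where
  "group_degree v m = (\<Sum>k\<in>keys m. if fst k = v then lookup m k else 0)"

lemma grading_single: "grading v (single m c) = monom (single m c) (group_degree v m)"
proof -
  have "monomial_eval (\<lambda>k. if fst k = v then [:0, mvar k:] else [:mvar k:]) m =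
    (\<Prod>k\<in>keys m. monom (mvar k ^ lookup m k :: ('v coeff_index, int) mpoly)
      (if fst k = v then lookup m k else 0))"
    unfolding monomial_eval_def
    by (intro prod.cong refl) (auto simp: monom_power monom_0[symmetric] monom_Suc[symmetric] simp flip: One_nat_def)
  also have "\<dots> = monom (monomial_eval mvar m) (group_degree v m)"
  proof -
    have "(\<Prod>k\<in>S. monom (f k) (e k)) = monom (prod f S) (sum e S)" if "finite S"
      for S and f :: "'v coeff_index \<Rightarrow> ('v coeff_index, int) mpoly" and e
      using that by (induction S) (auto simp: mult_monom)
    then show ?thesis by (simp add: monomial_eval_def group_degree_def)
  qed
  finally have "grading v (single m c) = of_int c * monom (monomial_eval mvar m) (group_degree v m)"
    unfolding grading_def by simp
  also have "of_int c * monom (monomial_eval mvar m) (group_degree v m) =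
      monom (of_int c * monomial_eval mvar m :: ('v coeff_index, int) mpoly) (group_degree v m)"
    by (simp add: of_int_poly smult_monom)
  finally show ?thesis by (simp add: single_eq_monomial_eval_mvar[of m c] single_zero_int)
qed

lemma coeff_grading:
  "coeff (grading v G) j = (\<Sum>m\<in>keys G. if group_degree v m = j then single m (lookup G m) else 0)"
proof -
  have "grading v G = (\<Sum>m\<in>keys G. grading v (single m (lookup G m)))"
    unfolding grading_def eval_int.mpoly_eval_sum[symmetric] by (simp flip: poly_mapping_sum_single)
  then show ?thesis by (simp add: grading_single coeff_sum)
qed

lemma lookup_coeff_grading:
  "lookup (coeff (grading v G) j) m = (if group_degree v m = j then lookup G m else 0)"
proof -
  have "lookup (coeff (grading v G) j) m =
    (\<Sum>m'\<in>keys G. if m' = m then (if group_degree v m = j then lookup G m else 0) else 0)"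
    unfolding coeff_grading lookup_sum by (intro sum.cong) (auto simp: lookup_single)
  then show ?thesis by (simp add: in_keys_iff)
qed

lemma group_degree_le:
  assumes "m \<in> keys G"
  shows "group_degree v m \<le> degree (grading v G)"
proof (rule le_degree)
  have "lookup (coeff (grading v G) (group_degree v m)) m \<noteq> 0"
    using assms by (simp add: lookup_coeff_grading in_keys_iff)
  then show "coeff (grading v G) (group_degree v m) \<noteq> 0" by auto
qed

definition scale_group :: "'v \<Rightarrow> complex \<Rightarrow> ('v coeff_index \<Rightarrow> complex) \<Rightarrow> 'v coeff_index \<Rightarrow> complex" where
  "scale_group v s y k = (if fst k = v then s * y k else y k)"

lemma has_zero_scale_group:
  assumes "s \<noteq> 0"
  shows "has_zero (scale_group v s y) \<longleftrightarrow> has_zero y"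
proof -
  have "form_val (scale_group v s y) u x = (if u = v then s else 1) * form_val y u x" for u x
    by (auto simp: form_val_def scale_group_def sum_distrib_left mult.assoc)
  then have "form_val (scale_group v s y) u x = 0 \<longleftrightarrow> form_val y u x = 0" for u x
    using assms by simp
  then show ?thesis unfolding has_zero_def is_zero_def by simp
qed

lemma eval_scale_group:
  "eval_int (scale_group v s y) G = poly (\<Sum>j\<le>degree (grading v G). monom (eval_int y (coeff (grading v G) j)) j) s"
proof -
  have me: "monomial_eval (scale_group v s y) m = s ^ group_degree v m * monomial_eval y m" for m
    unfolding monomial_eval_def group_degree_def power_sum prod.distrib[symmetric]
    by (intro prod.cong refl) (auto simp: scale_group_def power_mult_distrib)
  have "poly (\<Sum>j\<le>degree (grading v G). monom (eval_int y (coeff (grading v G) j)) j) s =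
    (\<Sum>j\<le>degree (grading v G). \<Sum>m\<in>keys G.
       if group_degree v m = j then of_int (lookup G m) * monomial_eval y m * s ^ j else 0)"
    by (simp add: poly_sum poly_monom coeff_grading eval_int.mpoly_eval_sum sum_distrib_right
        if_distrib[of "eval_int y"] if_distrib[of "\<lambda>x. x * _"] cong: if_cong)
  also have "\<dots> = (\<Sum>m\<in>keys G. of_int (lookup G m) * monomial_eval y m * s ^ group_degree v m)"
    using group_degree_le by (subst sum.swap) (auto intro!: sum.cong)
  also have "\<dots> = eval_int (scale_group v s y) G"
    unfolding mpoly_eval_altdef me by (intro sum.cong) (auto simp: mult_ac)
  finally show ?thesis by simp
qed

text \<open>Multiplying \<open>F v\<close> by \<open>s \<noteq> 0\<close> keeps the common zeros.
  Where \<open>res\<close> is nonzero, its value as a polynomial in \<open>s\<close> thus has no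
  root except possibly 0 and is a monomial. Two nonzero graded parts would both be nonzero at some
  such point.\<close>

lemma res_homogeneous:
  obtains e where "\<And>m. m \<in> keys res \<Longrightarrow> group_degree v m = e"
proof -
  let ?c = "\<lambda>j. coeff (grading v res) j"
  have one: "\<exists>e. \<forall>j. j \<noteq> e \<longrightarrow> eval_int y (?c j) = 0" if y: "eval_int y res \<noteq> 0" for y :: "'v coeff_index \<Rightarrow> complex"
  proof -
    define p where "p = (\<Sum>j\<le>degree (grading v res). monom (eval_int y (?c j)) j)"
    have "poly p s \<noteq> 0" if "s \<noteq> 0" for s
      using y has_zero_scale_group[OF that]
      unfolding p_def eval_scale_group[symmetric] res_zero_iff by blast
    then obtain a e where "p = monom a e" using complex_poly_only_zero_root by blast
    then have "coeff p j = 0" if "j \<noteq> e" for j using that by simp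
    moreover have "coeff p j = eval_int y (?c j)" for j
      by (simp add: p_def coeff_sum coeff_eq_0)
    ultimately show ?thesis by auto
  qed
  have uniq: "j = k" if "?c j \<noteq> 0" "?c k \<noteq> 0" for j k
  proof (rule ccontr)
    assume "j \<noteq> k"
    have "?c j * ?c k * res \<noteq> 0" using that res_nonzero by simp
    then obtain y :: "'v coeff_index \<Rightarrow> complex" where "eval_int y (?c j * ?c k * res) \<noteq> 0"
      using eval_int_nonzero by blast
    then have "eval_int y (?c j) \<noteq> 0" "eval_int y (?c k) \<noteq> 0" "eval_int y res \<noteq> 0"
      by (auto simp: eval_int.mpoly_eval_mult)
    then show False using one \<open>j \<noteq> k\<close> by metis
  qed
  have nz: "?c (group_degree v m) \<noteq> 0" if "m \<in> keys res" for m
  proof -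
    have "lookup (?c (group_degree v m)) m \<noteq> 0"
      using that by (simp add: lookup_coeff_grading in_keys_iff)
    then show ?thesis by auto
  qed
  obtain m0 where "m0 \<in> keys res" using res_nonzero by (metis keys_eq_empty ex_in_conv)
  then show ?thesis using that uniq nz by metis
qed

definition res_degree :: "'v \<Rightarrow> nat" where
  "res_degree v = (SOME e. \<forall>m\<in>keys res. group_degree v m = e)"

lemma group_degree_res: "m \<in> keys res \<Longrightarrow> group_degree v m = res_degree v"
proof -
  have "\<exists>e. \<forall>m\<in>keys res. group_degree v m = e" using res_homogeneous by metis
  then have "\<forall>m\<in>keys res. group_degree v m = res_degree v"
    unfolding res_degree_def by (rule someI_ex)
  then show "m \<in> keys res \<Longrightarrow> group_degree v m = res_degree v" by blast
qed

lemma res_degree_le: "v \<in> V \<Longrightarrow> res_degree v \<le> (\<Prod>w\<in>V - {v}. d w)"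
proof -
  assume v: "v \<in> V"
  obtain m where m: "m \<in> keys res" using res_nonzero by (metis keys_eq_empty ex_in_conv)
  then show ?thesis
    using group_degree_le[OF m, of v] group_degree_res[OF m] degree_grading_res[OF v] by simp
qed

text \<open>The resultant as a polynomial in \<open>s\<close> when \<open>F v\<close> has the
  coefficients \<open>z + s q\<close> and the other forms are taken from \<open>y\<close>.\<close>

definition pencil :: "'v \<Rightarrow> ('v coeff_index \<Rightarrow> complex) \<Rightarrow> ('v coeff_index \<Rightarrow> complex) \<Rightarrow>
    ('v coeff_index \<Rightarrow> complex) \<Rightarrow> complex poly" where
  "pencil v z q y = eval_int (\<lambda>k. if fst k = v then [:z k, q k:] else [:y k:]) res"

definition put_group :: "'v \<Rightarrow> ('v coeff_index \<Rightarrow> complex) \<Rightarrow> ('v coeff_index \<Rightarrow> complex) \<Rightarrow>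
    'v coeff_index \<Rightarrow> complex" where
  "put_group v z y k = (if fst k = v then z k else y k)"

lemma poly_pencil: "poly (pencil v z q y) s = eval_int (put_group v (\<lambda>k. z k + s * q k) y) res"
  unfolding pencil_def poly_eval_int by (intro mpoly_eval_cong) (auto simp: put_group_def)

text \<open>Every monomial of \<open>res\<close> has the same degree in the coefficients of
  \<open>F v\<close>, so only the direction \<open>q\<close> contributes to the top power of
  \<open>s\<close>.\<close>

lemma pencil_top:
  "degree (pencil v z q y) \<le> res_degree v \<and> coeff (pencil v z q y) (res_degree v) = eval_int (put_group v q y) res"
proof -
  let ?Y = "\<lambda>k. if fst k = v then [:z k, q k:] else [:y k:]"
  have top: "degree (monomial_eval ?Y m) \<le> res_degree v \<and>
      coeff (monomial_eval ?Y m) (res_degree v) = monomial_eval (put_group v q y) m"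
    if m: "m \<in> keys res" for m
  proof -
    let ?e = "\<lambda>k. if fst k = v then lookup m k else 0"
    have *: "degree (?Y k ^ lookup m k) \<le> ?e k \<and>
      coeff (?Y k ^ lookup m k) (?e k) = put_group v q y k ^ lookup m k" for k
      using coeff_power_top[of "?Y k" "if fst k = v then 1 else 0" "lookup m k"]
      by (auto simp: put_group_def)
    have "degree (monomial_eval ?Y m) \<le> group_degree v m \<and>
      coeff (monomial_eval ?Y m) (group_degree v m) = (\<Prod>k\<in>keys m. coeff (?Y k ^ lookup m k) (?e k))"
      unfolding monomial_eval_def group_degree_def using * by (intro coeff_prod_top) auto
    then show ?thesis
      unfolding group_degree_res[OF m] monomial_eval_def[of "put_group v q y"] using * by simp
  qed
  have "degree (of_int (lookup res m) * monomial_eval ?Y m) \<le> res_degree v"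
    if "m \<in> keys res" for m
    using top[OF that] degree_mult_le[of "of_int (lookup res m)" "monomial_eval ?Y m"] by simp
  then have "degree (pencil v z q y) \<le> res_degree v"
    unfolding pencil_def mpoly_eval_altdef by (intro degree_sum_le) auto
  moreover have "coeff (of_int c * p) j = of_int c * coeff p j" for c j and p :: "complex poly"
    by (simp add: of_int_poly)
  then have "coeff (pencil v z q y) (res_degree v) = eval_int (put_group v q y) res"
    unfolding pencil_def mpoly_eval_altdef coeff_sum using top by (intro sum.cong) auto
  ultimately show ?thesis by blast
qed

lemma form_val_put_group: "form_val (put_group v z y) u x = (if u = v then form_val z v x else form_val y u x)"
  by (auto simp: form_val_def put_group_def)

lemma form_val_pure_point:
  assumes "v \<in> V"
  shows "form_val pure_point v x = x v ^ d v"
proof -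
  have "form_val pure_point v x = (\<Sum>m\<in>Mon (d v). if m = single v (d v) then monomial_eval x m else 0)"
    unfolding form_val_def by (intro sum.cong) (auto simp: pure_point_def pure_def)
  then show ?thesis using finite_Mon assms by (simp add: monomials_of_degree_single)
qed

lemma form_val_add_smult: "form_val (\<lambda>k. z k + s * q k) v x = form_val z v x + s * form_val q v x"
  by (simp add: form_val_def sum.distrib sum_distrib_left distrib_right mult.assoc)

lemma form_val_diff: "form_val (\<lambda>k. z k - q k) v x = form_val z v x - form_val q v x"
  by (simp add: form_val_def sum_subtractf left_diff_distrib)

lemma form_val_smult: "form_val (\<lambda>k. s * q k) v x = s * form_val q v x"
  by (simp add: form_val_def sum_distrib_left mult.assoc)

lemma poly_from_distinct_roots:
  fixes p :: "complex poly"
  assumes "finite S" "degree p \<le> card S" "\<And>a. a \<in> S \<Longrightarrow> poly p a = 0"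
  shows "p = smult (coeff p (card S)) (\<Prod>a\<in>S. [:- a, 1:])"
proof -
  let ?q = "\<Prod>a\<in>S. [:- a, 1:]"
  have q: "degree ?q \<le> card S" "coeff ?q (card S) = 1"
    using coeff_prod_top[of S "\<lambda>a. [:- a, 1:]" "\<lambda>_. 1"] assms(1) by auto
  let ?r = "p - smult (coeff p (card S)) ?q"
  have "?r = 0"
  proof (rule ccontr)
    assume nz: "?r \<noteq> 0"
    have "degree ?r \<le> card S" using q assms by (intro degree_diff_le) (auto intro: order_trans[OF degree_smult_le])
    moreover have "coeff ?r (card S) = 0" using q by simp
    ultimately have "degree ?r < card S" using nz by (metis le_neq_implies_less leading_coeff_0_iff)
    moreover have "S \<subseteq> {x. poly ?r x = 0}" using assms by (auto simp: poly_prod)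
    then have "card S \<le> card {x. poly ?r x = 0}" using nz poly_roots_finite by (intro card_mono) blast
    ultimately show False using card_poly_roots_bound[OF nz] by simp
  qed
  then show ?thesis by simp
qed

text \<open>A linear change of \<open>F v\<close> by the pure power turns the values at the common zeros of the other forms
  into roots of a polynomial in one variable; for generic \<open>F v\<close> they are distinct and the degree
  bound leaves no room for other factors.\<close>

lemma poisson_formula:
  fixes y :: "'v coeff_index \<Rightarrow> complex"
  assumes v: "v \<in> V" and fin: "finite P" and card: "card P = (\<Prod>w\<in>V - {v}. d w)"
    and one: "\<And>x. x \<in> P \<Longrightarrow> x v = 1"
    and zero: "\<And>x u. x \<in> P \<Longrightarrow> u \<in> V - {v} \<Longrightarrow> form_val y u x = 0"
    and distinct: "\<And>x x'. x \<in> P \<Longrightarrow> x' \<in> P \<Longrightarrow> x \<noteq> x' \<Longrightarrow> \<exists>u\<in>V. x u \<noteq> x' u"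
  shows "eval_int y res = eval_int (put_group v pure_point y) res * (\<Prod>x\<in>P. form_val y v x)"
    and "eval_int (put_group v pure_point y) res \<noteq> 0 \<Longrightarrow> res_degree v = (\<Prod>w\<in>V - {v}. d w)"
proof -
  \<comment> \<open>The coefficient of \<open>s ^ card P\<close> in the pencil, the same for all
    \<open>z\<close>. The value 0 covers a degree of \<open>res\<close> below \<open>card P\<close>,
    which is not excluded yet.\<close>
  define \<kappa> where "\<kappa> = (if res_degree v = card P then eval_int (put_group v pure_point y) res else 0)"
  have dle: "res_degree v \<le> card P" using res_degree_le[OF v] card by simp
  have coeffK: "coeff (pencil v z pure_point y) (card P) = \<kappa>" for z
    using pencil_top[of v z pure_point y] dle by (auto simp: \<kappa>_def coeff_eq_0)
  have val_pure: "form_val pure_point v x = 1" if "x \<in> P" for x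
    using one[OF that] by (simp add: form_val_pure_point v)
  have root: "eval_int (put_group v z y) res = 0" if "x \<in> P" "form_val z v x = 0" for z x
  proof -
    have "is_zero (put_group v z y) x" using that zero by (auto simp: is_zero_def form_val_put_group)
    then show ?thesis unfolding res_zero_iff using v one[OF that(1)] by (intro has_zeroI) auto
  qed
  have generic: "eval_int (put_group v z y) res = \<kappa> * (\<Prod>x\<in>P. form_val z v x)"
    if inj: "inj_on (\<lambda>x. form_val z v x) P" for z
  proof -
    let ?S = "(\<lambda>x. - form_val z v x) ` P" and ?p = "pencil v z pure_point y"
    have inj': "inj_on (\<lambda>x. - form_val z v x) P" using inj by (auto simp: inj_on_def)
    have cS: "card ?S = card P" using inj' by (rule card_image)
    have "?p = smult (coeff ?p (card ?S)) (\<Prod>a\<in>?S. [:- a, 1:])"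
    proof (rule poly_from_distinct_roots)
      show "degree ?p \<le> card ?S" using pencil_top[of v z pure_point y] dle cS by simp
      fix a assume "a \<in> ?S"
      then obtain x where x: "x \<in> P" "a = - form_val z v x" by blast
      have "form_val (\<lambda>k. z k + a * pure_point k) v x = 0"
        unfolding form_val_add_smult using x val_pure by simp
      then show "poly ?p a = 0"
        unfolding poly_pencil by (rule root[OF x(1)])
    qed (use fin in simp)
    then have "poly ?p 0 = \<kappa> * (\<Prod>a\<in>?S. - a)"
      using coeffK cS by (metis (no_types, lifting) mult_zero_left poly_prod poly_smult poly_pCons poly_0 add_0_right prod.cong)
    then show ?thesis unfolding poly_pencil using inj' by (simp add: prod.reindex)
  qed
  obtain w where w: "inj_on (\<lambda>x. \<Sum>u\<in>V. w u * x u) P"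
    using ex_separating_weights[OF finite_V fin distinct] by blast
  \<comment> \<open>The form \<open>x\<^sub>v ^ (d v - 1)\<close> times the weighted sum of the
    variables: it takes distinct values on \<open>P\<close>, where
    \<open>x\<^sub>v = 1\<close>.\<close>
  define z0 where "z0 k = (\<Sum>u\<in>V. if snd k = single v (d v - 1) + single u 1 then w u else 0)"
    for k :: "'v coeff_index"
  have "form_val z0 v x = (\<Sum>u\<in>V. w u * x u)" if x: "x \<in> P" for x
  proof -
    have mem: "single v (d v - 1) + single u (1::nat) \<in> Mon (d v)" if "u \<in> V" for u
      using monomials_of_degree_add[OF monomials_of_degree_single[OF v, of "d v - 1"]
          monomials_of_degree_single[OF that, of 1]] d_pos[OF v] by simp
    have "form_val z0 v x = (\<Sum>u\<in>V. \<Sum>m\<in>Mon (d v).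
        if m = single v (d v - 1) + single u 1 then w u * monomial_eval x m else 0)"
      unfolding form_val_def z0_def sum_distrib_right by (subst sum.swap) (auto intro!: sum.cong)
    also have "\<dots> = (\<Sum>u\<in>V. w u * monomial_eval x (single v (d v - 1) + single u 1))"
      using mem finite_Mon by (intro sum.cong refl) simp
    finally show ?thesis using one[OF x] by (simp add: monomial_eval_add)
  qed
  then have inj0: "inj_on (\<lambda>x. form_val z0 v x) P" using w by (simp add: inj_on_def)
  \<comment> \<open>On the line from \<open>z\<close> to \<open>z0\<close> both sides are
    polynomials in \<open>s\<close> that agree wherever the values on \<open>P\<close> are distinct,
    hence also at \<open>s = 0\<close>.\<close>
  have all: "eval_int (put_group v z y) res = \<kappa> * (\<Prod>x\<in>P. form_val z v x)" for z
  proof -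
    let ?f = "\<lambda>x. [:form_val z v x, form_val z0 v x - form_val z v x:]"
    let ?Q = "{(x, x'). x \<in> P \<and> x' \<in> P \<and> x \<noteq> x'}"
    let ?r = "\<Prod>(x, x')\<in>?Q. ?f x - ?f x'"
    let ?z = "\<lambda>s k. z k + s * (z0 k - z k)"
    have finQ: "finite ?Q" by (rule finite_subset[of _ "P \<times> P"]) (use fin in auto)
    have pf: "poly (?f x) s = form_val (?z s) v x" for x s
      unfolding form_val_add_smult form_val_diff by simp
    have "?f x - ?f x' \<noteq> 0" if "x \<in> P" "x' \<in> P" "x \<noteq> x'" for x x'
    proof
      assume "?f x - ?f x' = 0"
      then have "poly (?f x) 1 = poly (?f x') 1" by (metis eq_iff_diff_eq_0)
      then show False using inj0 that by (auto dest: inj_onD)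
    qed
    then have r0: "?r \<noteq> 0" using finQ by auto
    have "pencil v z (\<lambda>k. z0 k - z k) y = smult \<kappa> (\<Prod>x\<in>P. ?f x)"
    proof (rule poly_eq_of_nonzero_roots[OF r0])
      fix s assume s: "poly ?r s \<noteq> 0"
      have "inj_on (\<lambda>x. form_val (?z s) v x) P"
      proof (rule inj_onI, rule ccontr)
        fix x x' assume x: "x \<in> P" "x' \<in> P" "form_val (?z s) v x = form_val (?z s) v x'" "x \<noteq> x'"
        then have "poly (?f x - ?f x') s = 0" unfolding poly_diff pf by simp
        then have "poly ?r s = 0" using x finQ unfolding poly_prod by (intro prod_zero) force+
        then show False using s by simp
      qed
      then show "poly (pencil v z (\<lambda>k. z0 k - z k) y) s = poly (smult \<kappa> (\<Prod>x\<in>P. ?f x)) s"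
        unfolding poly_pencil poly_smult poly_prod pf by (rule generic)
    qed
    then have "poly (pencil v z (\<lambda>k. z0 k - z k) y) 0 = poly (smult \<kappa> (\<Prod>x\<in>P. ?f x)) 0" by simp
    then show ?thesis unfolding poly_pencil poly_smult poly_prod by simp
  qed
  \<comment> \<open>All values of the pure power on \<open>P\<close> are 1. If the resultant there
    is nonzero, the first case in the definition of \<kappa> holds, which is the claim on the
    degree.\<close>
  have \<kappa>: "eval_int (put_group v pure_point y) res = \<kappa>" using all[of pure_point] by (simp add: val_pure)
  have "put_group v y y = y" by (auto simp: put_group_def)
  then show "eval_int y res = eval_int (put_group v pure_point y) res * (\<Prod>x\<in>P. form_val y v x)"
    using all[of y] \<kappa> by simp
  show "res_degree v = (\<Prod>w\<in>V - {v}. d w)" if "eval_int (put_group v pure_point y) res \<noteq> 0"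
    using that \<kappa> card by (auto simp: \<kappa>_def split: if_splits)
qed

end

lemma forms_single: "m \<in> monomials_of_degree V k \<Longrightarrow> single m c \<in> forms V k"
  by (auto simp: forms_def)

lemma forms_diff: "p \<in> forms V k \<Longrightarrow> q \<in> forms V k \<Longrightarrow> p - q \<in> forms V k"
  for p :: "('v, 'a::comm_ring_1) mpoly"
  by (auto simp: forms_def in_keys_iff lookup_minus subset_iff) (metis diff_0 neg_equal_0_iff_equal diff_zero)

lemma forms_sum: "(\<And>i. i \<in> A \<Longrightarrow> f i \<in> forms V k) \<Longrightarrow> sum f A \<in> forms V k"
proof (induction A rule: infinite_finite_induct)
  case (insert i A)
  then show ?case using keys_add[of "f i" "sum f A"] by (auto simp: forms_def)
qed (auto simp: forms_def)

context form_system
begin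

lemma no_zeroI:
  assumes "\<And>x u. is_zero y x \<Longrightarrow> u \<in> V \<Longrightarrow> x u = 0"
  shows "\<not> has_zero y"
  using assms unfolding has_zero_def by blast

text \<open>The system \<open>x\<^sub>u ^ d - x\<^sub>v ^ d\<close> attains the degree bound.\<close>

lemma res_degree_eq:
  assumes v: "v \<in> V"
  shows "res_degree v = (\<Prod>w\<in>V - {v}. d w)"
proof -
  define y :: "'v coeff_index \<Rightarrow> complex" where
    "y = form_coeffs (\<lambda>u. single (single u (d u)) 1 -
       single (single v (d u)) 1)"
  have val: "form_val y u x = x u ^ d u - x v ^ d u" if "u \<in> V" for u x
    unfolding y_def using that v
    by (subst form_val_form_coeffs)
      (auto intro!: forms_diff forms_single monomials_of_degree_single simp: eval_at_hom.h_diff)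
  \<comment> \<open>Tuples of roots of unity as points with \<open>x\<^sub>v = 1\<close>; the value
    0 outside \<open>V\<close> makes distinct points differ inside \<open>V\<close>.\<close>
  define pt where "pt f u = (if u = v then 1 else if u \<in> V then f u else 0)" for f :: "'v \<Rightarrow> complex" and u
  define S where "S = (\<Pi>\<^sub>E u\<in>V - {v}. {z :: complex. z ^ d u = 1})"
  have inj: "inj_on pt S"
  proof (rule inj_onI)
    fix f g assume "f \<in> S" "g \<in> S" "pt f = pt g"
    then have "f u = g u" if "u \<in> V - {v}" for u using that by (auto simp: pt_def dest!: fun_cong[of _ _ u])
    then show "f = g" using \<open>f \<in> S\<close> \<open>g \<in> S\<close> unfolding S_def by (intro PiE_ext)
  qed
  have "finite {z :: complex. z ^ d u = 1}" if "u \<in> V" for u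
    using d_pos[OF that] by (intro finite_roots_unity) simp
  then have "finite S" unfolding S_def using finite_V by (intro finite_PiE) auto
  have "card {z :: complex. z ^ d u = 1} = d u" if "u \<in> V" for u
    using d_pos[OF that] by (rule card_roots_unity_eq)
  then have cardS: "card S = (\<Prod>w\<in>V - {v}. d w)"
    unfolding S_def using finite_V by (simp add: card_PiE)
  show ?thesis
  proof (rule poisson_formula(2)[OF v, of "pt ` S" y])
    show "finite (pt ` S)" "card (pt ` S) = (\<Prod>w\<in>V - {v}. d w)"
      using \<open>finite S\<close> cardS inj by (auto simp: card_image)
    show "x v = 1" if "x \<in> pt ` S" for x using that by (auto simp: pt_def)
    show "form_val y u x = 0" if "x \<in> pt ` S" "u \<in> V - {v}" for x u
    proof -
      obtain f where f: "f \<in> S" "x = pt f" using \<open>x \<in> pt ` S\<close> by blast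
      have "u \<in> V" "x u = f u" "x v = 1" using \<open>u \<in> V - {v}\<close> f(2) by (auto simp: pt_def)
      moreover have "f u ^ d u = 1" using f(1) \<open>u \<in> V - {v}\<close> unfolding S_def by (auto dest: PiE_mem)
      ultimately show ?thesis unfolding val[OF \<open>u \<in> V\<close>] by simp
    qed
    show "\<exists>u\<in>V. x u \<noteq> x' u" if "x \<in> pt ` S" "x' \<in> pt ` S" "x \<noteq> x'" for x x'
    proof (rule ccontr)
      assume "\<not> ?thesis"
      moreover have "x u = x' u" if "u \<notin> V" for u
        using \<open>x \<in> pt ` S\<close> \<open>x' \<in> pt ` S\<close> v \<open>u \<notin> V\<close> unfolding pt_def by fastforce
      ultimately show False using that(3) by (metis ext)
    qed
    \<comment> \<open>With \<open>F v\<close> replaced by \<open>x\<^sub>v ^ d v\<close>, a common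
      zero has \<open>x\<^sub>v = 0\<close> and then all other coordinates 0.\<close>
    show "eval_int (put_group v pure_point y) res \<noteq> 0"
      unfolding res_zero_iff
    proof (rule no_zeroI)
      fix x u assume z: "is_zero (put_group v pure_point y) x" and u: "u \<in> V"
      have "x v ^ d v = 0" using z v by (auto simp: is_zero_def form_val_put_group form_val_pure_point)
      then have xv: "x v = 0" by simp
      have "u \<noteq> v \<Longrightarrow> x u ^ d u - x v ^ d u = 0"
        using z u val[OF u, of x] by (auto simp: is_zero_def form_val_put_group)
      then show "x u = 0" using xv d_pos[OF u] by (cases "u = v") (auto simp: power_0_left)
    qed
  qed
qed

text \<open>By homogeneity in each group of coefficients, with the exact degrees as
  exponents.\<close>

lemma res_scale:
  "eval_int (\<lambda>k. c (fst k) * y k) res = (\<Prod>v\<in>V. c v ^ (\<Prod>w\<in>V - {v}. d w)) * (eval_int y res :: complex)"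
proof -
  have "monomial_eval (\<lambda>k. c (fst k) * y k) m = (\<Prod>v\<in>V. c v ^ (\<Prod>w\<in>V - {v}. d w)) * monomial_eval y m"
    if m: "m \<in> keys res" for m
  proof -
    have fstV: "fst k \<in> V" if "k \<in> keys m" for k
    proof -
      have "keys m \<subseteq> CV" using res_mpolys m by (auto simp: mpolys_iff)
      then show ?thesis using that by (auto simp: coeff_vars_def)
    qed
    have "(\<Prod>v\<in>V. c v ^ (\<Prod>w\<in>V - {v}. d w)) = (\<Prod>v\<in>V. c v ^ group_degree v m)"
      using group_degree_res[OF m] res_degree_eq by (intro prod.cong) auto
    also have "\<dots> = (\<Prod>v\<in>V. \<Prod>k\<in>keys m. if fst k = v then c v ^ lookup m k else 1)"
      unfolding group_degree_def power_sum by (intro prod.cong) auto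
    also have "\<dots> = (\<Prod>k\<in>keys m. c (fst k) ^ lookup m k)"
      using fstV finite_V by (subst prod.swap) (simp add: prod.delta)
    finally show ?thesis
      by (simp add: monomial_eval_def power_mult_distrib prod.distrib)
  qed
  then show ?thesis
    unfolding mpoly_eval_altdef sum_distrib_left by (intro sum.cong refl) (simp add: mult_ac)
qed

text \<open>A polynomial in \<open>s\<close> without roots is constant.\<close>

lemma res_constant_on_line:
  assumes "\<And>s. \<not> has_zero (\<lambda>k. y0 k + s * (y1 k - y0 k))"
  shows "eval_int y1 res = eval_int y0 res"
proof -
  define p where "p = eval_int (\<lambda>k. [:y0 k, y1 k - y0 k:]) res"
  have p: "poly p s = eval_int (\<lambda>k. y0 k + s * (y1 k - y0 k)) res" for s
    by (simp add: p_def poly_eval_int)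
  then have "\<not> (\<exists>s. poly p s = 0)" using assms by (simp add: res_zero_iff)
  then obtain a where "p = [:a:]" using fundamental_theorem_of_algebra_alt[of p] by auto
  then have "poly p 1 = poly p 0" by simp
  then show ?thesis unfolding p by simp
qed

end

section \<open>The sunflower hypergraph\<close>

text \<open>A linear order on the vertices induces orders on coefficient indices and monomials,
  through which the polynomials in the coefficients form an integral domain.\<close>

instantiation sunflower_vertex :: linorder
begin

fun vertex_code :: "sunflower_vertex \<Rightarrow> nat \<times> nat" where
  "vertex_code (Seed q) = (0, q)"
| "vertex_code (Petal i j) = (Suc i, j)"

definition less_eq_sunflower_vertex :: "sunflower_vertex \<Rightarrow> sunflower_vertex \<Rightarrow> bool" where
  "x \<le> y \<longleftrightarrow> vertex_code x \<le> vertex_code y"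

definition less_sunflower_vertex :: "sunflower_vertex \<Rightarrow> sunflower_vertex \<Rightarrow> bool" where
  "x < y \<longleftrightarrow> vertex_code x < vertex_code y"

instance
proof
  fix x y z :: sunflower_vertex
  have inj: "vertex_code x = vertex_code y \<Longrightarrow> x = y"
    by (cases x; cases y) auto
  show "x < y \<longleftrightarrow> x \<le> y \<and> \<not> y \<le> x" "x \<le> x" "x \<le> y \<or> y \<le> x"
    by (auto simp: less_eq_sunflower_vertex_def less_sunflower_vertex_def)
  show "x \<le> y \<Longrightarrow> y \<le> z \<Longrightarrow> x \<le> z"
    unfolding less_eq_sunflower_vertex_def by (rule order_trans)
  show "x \<le> y \<Longrightarrow> y \<le> x \<Longrightarrow> x = y"
    unfolding less_eq_sunflower_vertex_def using inj by simp
qed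

end

text \<open>Sort the functions by their support: there are \<open>card A choose r\<close> supports
  of size \<open>r\<close>, each carrying \<open>b ^ r\<close> functions.\<close>

lemma prod_PiE_nonzero_count:
  fixes \<phi> :: "nat \<Rightarrow> complex"
  assumes "finite A" "finite U" "0 \<in> U" "card U = Suc b"
  shows "(\<Prod>g\<in>A \<rightarrow>\<^sub>E U. \<phi> (card {i\<in>A. g i \<noteq> 0})) = (\<Prod>r=0..card A. \<phi> r ^ ((card A choose r) * b ^ r))"
proof -
  let ?supp = "\<lambda>g. {i\<in>A. g i \<noteq> 0}"
  have fin: "finite (A \<rightarrow>\<^sub>E U)" using assms by (intro finite_PiE) auto
  have cardS: "card {g \<in> A \<rightarrow>\<^sub>E U. ?supp g = S} = b ^ card S" if S: "S \<subseteq> A" for S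
  proof -
    have "{g \<in> A \<rightarrow>\<^sub>E U. ?supp g = S} = (\<Pi>\<^sub>E i\<in>A. if i \<in> S then U - {0} else {0})"
      using S assms(3) by (auto simp: PiE_iff set_eq_iff split: if_splits)
    also have "card \<dots> = (\<Prod>i\<in>A. if i \<in> S then b else 1)"
      using assms by (subst card_PiE) (auto intro!: prod.cong)
    also have "\<dots> = (\<Prod>i\<in>S. b)"
      using assms(1) S by (simp add: prod.If_cases Int_absorb1)
    finally show ?thesis by simp
  qed
  have "(\<Prod>g\<in>A \<rightarrow>\<^sub>E U. \<phi> (card (?supp g))) =
      (\<Prod>S\<in>Pow A. \<Prod>g\<in>{g \<in> A \<rightarrow>\<^sub>E U. ?supp g = S}. \<phi> (card (?supp g)))"
    by (rule prod.group[symmetric]) (use assms fin in auto)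
  also have "\<dots> = (\<Prod>S\<in>Pow A. \<phi> (card S) ^ (b ^ card S))"
    using cardS by (intro prod.cong refl) simp
  also have "\<dots> = (\<Prod>r\<in>{0..card A}. \<Prod>S\<in>{S\<in>Pow A. card S = r}. \<phi> (card S) ^ (b ^ card S))"
    by (rule prod.group[symmetric]) (use assms card_mono in auto)
  also have "\<dots> = (\<Prod>r=0..card A. \<phi> r ^ ((card A choose r) * b ^ r))"
  proof (intro prod.cong refl)
    fix r
    have "(\<Prod>S\<in>{S\<in>Pow A. card S = r}. \<phi> (card S) ^ (b ^ card S)) = (\<Prod>S\<in>{S\<in>Pow A. card S = r}. \<phi> r ^ b ^ r)"
      by (intro prod.cong) auto
    also have "\<dots> = \<phi> r ^ ((card A choose r) * b ^ r)"
      using n_subsets[OF assms(1), of r] by (simp add: Pow_def power_mult[symmetric] mult.commute)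
    finally show "(\<Prod>S\<in>{S\<in>Pow A. card S = r}. \<phi> (card S) ^ (b ^ card S)) = \<phi> r ^ ((card A choose r) * b ^ r)" .
  qed
  finally show ?thesis .
qed

section \<open>The forms of the sunflower at a complex value of \<lambda>\<close>

locale sunflower_system =
  fixes n :: nat
  assumes n_pos: "n \<ge> 1"
begin

definition W :: "sunflower_vertex set" where
  "W = insert (Seed 1) ((\<lambda>(i, j). Petal i j) ` ({1..n} \<times> {1, 2}))"

lemma petal_set: "{Suc 0..2} = {1, 2 :: nat}" by auto

lemma fst_sunflower: "fst (sunflower n 1 3) = W"
  by (auto simp: sunflower_def seeds_def petal_def W_def petal_set image_iff)

lemma W_cases:
  assumes "w \<in> W"
  obtains "w = Seed 1" | i where "i \<in> {1..n}" "w = Petal i 1" | i where "i \<in> {1..n}" "w = Petal i 2"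
  using assms by (auto simp: W_def)

sublocale form_system W "\<lambda>_. 2"
  by unfold_locales (auto simp: W_def)

lemma card_W: "card W = 2 * n + 1"
proof -
  have "card ((\<lambda>(i, j). Petal i j) ` ({1..n} \<times> {1, 2 :: nat})) = 2 * n"
    by (subst card_image) (auto simp: inj_on_def card_cartesian_product)
  then show ?thesis unfolding W_def by (subst card_insert_disjoint) auto
qed

lemma res_group_degree: "w \<in> W \<Longrightarrow> (\<Prod>u\<in>W - {w}. 2 :: nat) = 4 ^ n"
  using finite_V by (simp add: card_W power_mult)

definition edge :: "nat \<Rightarrow> sunflower_vertex set" where
  "edge i = {Seed 1, Petal i 1, Petal i 2}"

lemma snd_sunflower: "snd (sunflower n 1 3) = edge ` {1..n}"
  by (auto simp: sunflower_def seeds_def petal_def edge_def petal_set)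

lemma inj_edge: "inj_on edge A"
  by (rule inj_onI) (auto simp: edge_def doubleton_eq_iff)

text \<open>The characteristic form with \<lambda> specialized to the complex number \<mu>.\<close>

definition sunflower_form :: "complex \<Rightarrow> sunflower_vertex \<Rightarrow> (sunflower_vertex, complex) mpoly" where
  "sunflower_form \<mu> v = single (single v 2) \<mu> -
     (\<Sum>e\<in>{e \<in> edge ` {1..n}. v \<in> e}. single (\<Sum>u\<in>e - {v}. single u 1) 1)"

lemma sunflower_form_simps:
  "sunflower_form \<mu> (Seed 1) = single (single (Seed 1) 2) \<mu> -
     (\<Sum>i\<in>{1..n}. single (single (Petal i 1) 1 + single (Petal i 2) 1) 1)"
  "i \<in> {1..n} \<Longrightarrow> sunflower_form \<mu> (Petal i 1) = single (single (Petal i 1) 2) \<mu> -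
     single (single (Seed 1) 1 + single (Petal i 2) 1) 1"
  "i \<in> {1..n} \<Longrightarrow> sunflower_form \<mu> (Petal i 2) = single (single (Petal i 2) 2) \<mu> -
     single (single (Seed 1) 1 + single (Petal i 1) 1) 1"
proof -
  have "{e \<in> edge ` {1..n}. Seed 1 \<in> e} = edge ` {1..n}" by (auto simp: edge_def)
  moreover have "edge i - {Seed 1} = {Petal i 1, Petal i 2}" for i by (auto simp: edge_def)
  ultimately show "sunflower_form \<mu> (Seed 1) = single (single (Seed 1) 2) \<mu> -
     (\<Sum>i\<in>{1..n}. single (single (Petal i 1) 1 + single (Petal i 2) 1) 1)"
    by (simp add: sunflower_form_def sum.reindex[OF inj_edge])
next
  assume i: "i \<in> {1..n}"
  have "{e \<in> edge ` {1..n}. Petal i 1 \<in> e} = {edge i}" "{e \<in> edge ` {1..n}. Petal i 2 \<in> e} = {edge i}"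
    using i by (auto simp: edge_def)
  moreover have "edge i - {Petal i 1} = {Seed 1, Petal i 2}" "edge i - {Petal i 2} = {Seed 1, Petal i 1}"
    by (auto simp: edge_def)
  ultimately show "sunflower_form \<mu> (Petal i 1) = single (single (Petal i 1) 2) \<mu> -
     single (single (Seed 1) 1 + single (Petal i 2) 1) 1"
    "sunflower_form \<mu> (Petal i 2) = single (single (Petal i 2) 2) \<mu> -
     single (single (Seed 1) 1 + single (Petal i 1) 1) 1"
    by (simp_all add: sunflower_form_def)
qed

lemma product_monomial: "u \<in> W \<Longrightarrow> w \<in> W \<Longrightarrow>
    single u 1 + single w 1 \<in> monomials_of_degree W 2"
  using monomials_of_degree_add[OF monomials_of_degree_single monomials_of_degree_single, of u W w 1 1]
  by (simp add: numeral_2_eq_2)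

lemma petal_mem: "i \<in> {1..n} \<Longrightarrow> Petal i 1 \<in> W" "i \<in> {1..n} \<Longrightarrow> Petal i 2 \<in> W" "Seed 1 \<in> W"
  by (auto simp: W_def image_iff)

lemma sunflower_form_forms: "v \<in> W \<Longrightarrow> sunflower_form \<mu> v \<in> forms W 2"
  by (erule W_cases)
    (auto simp only: sunflower_form_simps intro!: forms_diff forms_sum forms_single product_monomial
      monomials_of_degree_single petal_mem)

definition sunflower_point :: "complex \<Rightarrow> sunflower_vertex coeff_index \<Rightarrow> complex" where
  "sunflower_point \<mu> = form_coeffs (sunflower_form \<mu>)"

lemma form_val_sunflower:
  "form_val (sunflower_point \<mu>) (Seed 1) x = \<mu> * x (Seed 1) ^ 2 - (\<Sum>i\<in>{1..n}. x (Petal i 1) * x (Petal i 2))"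
  "i \<in> {1..n} \<Longrightarrow> form_val (sunflower_point \<mu>) (Petal i 1) x = \<mu> * x (Petal i 1) ^ 2 - x (Seed 1) * x (Petal i 2)"
  "i \<in> {1..n} \<Longrightarrow> form_val (sunflower_point \<mu>) (Petal i 2) x = \<mu> * x (Petal i 2) ^ 2 - x (Seed 1) * x (Petal i 1)"
proof -
  have val: "form_val (sunflower_point \<mu>) v x = eval_at x (sunflower_form \<mu> v)" if "v \<in> W" for v
    unfolding sunflower_point_def by (rule form_val_form_coeffs) (rule sunflower_form_forms[OF that])
  note eval = eval_at_hom.h_diff eval_at_hom.h_sum eval_id.mpoly_eval_single monomial_eval_add
    monomial_eval_single power_one_right mult_1
  show "form_val (sunflower_point \<mu>) (Seed 1) x = \<mu> * x (Seed 1) ^ 2 - (\<Sum>i\<in>{1..n}. x (Petal i 1) * x (Petal i 2))"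
    unfolding val[OF petal_mem(3)] sunflower_form_simps(1) eval ..
  show "form_val (sunflower_point \<mu>) (Petal i 1) x = \<mu> * x (Petal i 1) ^ 2 - x (Seed 1) * x (Petal i 2)"
    if i: "i \<in> {1..n}"
    unfolding val[OF petal_mem(1)[OF i]] sunflower_form_simps(2)[OF i] eval ..
  show "form_val (sunflower_point \<mu>) (Petal i 2) x = \<mu> * x (Petal i 2) ^ 2 - x (Seed 1) * x (Petal i 1)"
    if i: "i \<in> {1..n}"
    unfolding val[OF petal_mem(2)[OF i]] sunflower_form_simps(3)[OF i] eval ..
qed

text \<open>Deforming the terms \<open>x\<^sub>0 x\<^sub>i\<^sub>,\<^sub>j\<close> to zero does not create common zeros.\<close>

lemma res_sunflower_at_infinity:
  assumes "\<mu> \<noteq> 0"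
  shows "eval_int (put_group (Seed 1) pure_point (sunflower_point \<mu>)) res = \<mu> ^ (2 * n * 4 ^ n)"
proof -
  define c where "c w = (if w = Seed 1 then 1 else \<mu>)" for w
  \<comment> \<open>The system of pure powers with factor \<mu> at the petal vertices; its resultant
    follows from the normalization by scaling.\<close>
  define y0 where "y0 k = c (fst k) * pure_point k" for k :: "sunflower_vertex coeff_index"
  define y1 where "y1 = put_group (Seed 1) pure_point (sunflower_point \<mu>)"
  have y0: "form_val y0 w x = c w * x w ^ 2" if "w \<in> W" for w x
  proof -
    have "form_val y0 w x = form_val (\<lambda>k. c w * pure_point k) w x"
      by (simp add: form_val_def y0_def)
    then show ?thesis using that by (simp add: form_val_smult form_val_pure_point)
  qed
  have "eval_int y1 res = eval_int y0 res"
  proof (rule res_constant_on_line, rule no_zeroI)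
    fix s x w
    assume z: "is_zero (\<lambda>k. y0 k + s * (y1 k - y0 k)) x" and w: "w \<in> W"
    have val: "form_val y0 u x + s * (form_val y1 u x - form_val y0 u x) = 0" if "u \<in> W" for u
      using z that by (simp add: is_zero_def form_val_add_smult form_val_diff)
    \<comment> \<open>The form of the seed is \<open>x\<^sub>0 ^ 2\<close> along the whole line.
      Once \<open>x\<^sub>0 = 0\<close>, the petal forms reduce to \<mu> times a square.\<close>
    have x0: "x (Seed 1) = 0"
      using val[OF petal_mem(3)] petal_mem(3)
      by (simp add: y0 y1_def form_val_put_group form_val_pure_point c_def)
    show "x w = 0"
      using w
    proof (cases rule: W_cases)
      case (2 i)
      then show ?thesis using val[OF w] w assms x0
        by (simp add: y0 y1_def form_val_put_group form_val_sunflower c_def del: One_nat_def)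
    next
      case (3 i)
      then show ?thesis using val[OF w] w assms x0
        by (simp add: y0 y1_def form_val_put_group form_val_sunflower c_def del: One_nat_def)
    qed (use x0 in simp)
  qed
  also have "eval_int y0 res = (\<Prod>w\<in>W. c w ^ (\<Prod>u\<in>W - {w}. 2)) * eval_int pure_point res"
    unfolding y0_def by (rule res_scale)
  also have "eval_int pure_point res = (1 :: complex)" by (rule res_pure_point)
  also have "(\<Prod>w\<in>W. c w ^ (\<Prod>u\<in>W - {w}. 2)) = (\<Prod>w\<in>W. c w ^ (4 ^ n))"
    by (intro prod.cong refl arg_cong2[where f = "(^)"] res_group_degree)
  also have "\<dots> = (\<Prod>w\<in>W - {Seed 1}. \<mu> ^ (4 ^ n))"
    using finite_V petal_mem(3) by (simp add: prod.remove c_def)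
  also have "\<dots> = \<mu> ^ (2 * n * 4 ^ n)"
    using finite_V petal_mem(3) by (simp add: card_W power_mult[symmetric] mult.commute)
  finally show ?thesis by (simp add: y1_def)
qed

text \<open>The first petal coordinates: for \<open>x\<^sub>0 = 1\<close> the petal equations read
  \<open>\<mu> a\<^sup>2 = b\<close> and \<open>\<mu> b\<^sup>2 = a\<close>, and eliminating
  \<open>b\<close> gives this equation for \<open>a\<close>.\<close>

definition roots :: "complex \<Rightarrow> complex set" where
  "roots \<mu> = {u. \<mu> ^ 3 * u ^ 4 = u}"

lemma roots_eq:
  assumes "\<mu> \<noteq> 0"
  shows "roots \<mu> = insert 0 ((\<lambda>z. z / \<mu>) ` {z. z ^ 3 = 1})"
proof -
  have "\<mu> ^ 3 * u ^ 4 = u \<longleftrightarrow> u = 0 \<or> (\<mu> * u) ^ 3 = 1" for u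
  proof -
    have "\<mu> ^ 3 * u ^ 4 - u = u * ((\<mu> * u) ^ 3 - 1)" by (simp add: algebra_simps power_mult_distrib eval_nat_numeral)
    then show ?thesis by (metis eq_iff_diff_eq_0 mult_eq_0_iff)
  qed
  moreover have "(\<mu> * u) ^ 3 = 1 \<longleftrightarrow> u \<in> (\<lambda>z. z / \<mu>) ` {z. z ^ 3 = 1}" for u
    using assms by (auto simp: image_iff intro!: exI[of _ "\<mu> * u"])
  ultimately show ?thesis unfolding roots_def by blast
qed

lemma roots_facts:
  assumes "\<mu> \<noteq> 0"
  shows "finite (roots \<mu>)" "card (roots \<mu>) = Suc 3" "0 \<in> roots \<mu>"
proof -
  have fin: "finite {z :: complex. z ^ 3 = 1}" by (rule finite_roots_unity) simp
  have card: "card {z :: complex. z ^ 3 = 1} = 3" by (rule card_roots_unity_eq) simp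
  show "finite (roots \<mu>)" "0 \<in> roots \<mu>" using fin roots_eq[OF assms] by auto
  have "0 \<notin> (\<lambda>z. z / \<mu>) ` {z. z ^ 3 = 1}" using assms by auto
  moreover have "card ((\<lambda>z. z / \<mu>) ` {z. z ^ 3 = 1}) = 3"
    using assms card by (subst card_image) (auto simp: inj_on_def)
  ultimately show "card (roots \<mu>) = Suc 3" unfolding roots_eq[OF assms] using fin by simp
qed

text \<open>A zero is determined by the first coordinate \<open>g i\<close> of each petal; the
  second one is then given by the form of the first vertex.\<close>

fun zero_point :: "complex \<Rightarrow> (nat \<Rightarrow> complex) \<Rightarrow> sunflower_vertex \<Rightarrow> complex" where
  "zero_point \<mu> g (Seed q) = 1"
| "zero_point \<mu> g (Petal i j) = (if j = 1 then g i else \<mu> * g i ^ 2)"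

lemma res_sunflower:
  assumes "\<mu> \<noteq> 0"
  shows "eval_int (sunflower_point \<mu>) res =
    \<mu> ^ (2 * n * 4 ^ n) * (\<Prod>r=0..n. (\<mu> - of_nat r / \<mu> ^ 2) ^ ((n choose r) * 3 ^ r))"
proof -
  define S where "S = {1..n} \<rightarrow>\<^sub>E roots \<mu>"
  let ?P = "zero_point \<mu> ` S"
  have root: "\<mu> ^ 3 * g i ^ 4 = g i" if "g \<in> S" "i \<in> {1..n}" for g i
    using that by (auto simp: S_def PiE_iff roots_def)
  have sep: "\<exists>u\<in>W. zero_point \<mu> g u \<noteq> zero_point \<mu> g' u" if "g \<in> S" "g' \<in> S" "g \<noteq> g'" for g g'
  proof -
    have "\<exists>i\<in>{1..n}. g i \<noteq> g' i"
    proof (rule ccontr)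
      assume "\<not> ?thesis"
      then have "g = g'" using that(1,2) unfolding S_def by (intro PiE_ext[of g _ _ g']) auto
      then show False using that(3) by blast
    qed
    then obtain i where "i \<in> {1..n}" "g i \<noteq> g' i" by blast
    then show ?thesis using petal_mem by (intro bexI[of _ "Petal i 1"]) auto
  qed
  then have inj: "inj_on (zero_point \<mu>) S" by (metis inj_onI)
  have "finite S" unfolding S_def using roots_facts[OF assms] by (intro finite_PiE) auto
  have "card S = 4 ^ n" unfolding S_def using roots_facts[OF assms] by (simp add: card_PiE)
  have "eval_int (sunflower_point \<mu>) res =
    eval_int (put_group (Seed 1) pure_point (sunflower_point \<mu>)) res *
    (\<Prod>x\<in>?P. form_val (sunflower_point \<mu>) (Seed 1) x)"
  proof (rule poisson_formula(1)[OF petal_mem(3)])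
    show "finite ?P" using \<open>finite S\<close> by simp
    show "card ?P = (\<Prod>w\<in>W - {Seed 1}. 2)"
      using inj \<open>card S = 4 ^ n\<close> res_group_degree[OF petal_mem(3)] by (simp add: card_image)
    show "x (Seed 1) = 1" if "x \<in> ?P" for x using that by auto
    show "\<exists>u\<in>W. x u \<noteq> x' u" if "x \<in> ?P" "x' \<in> ?P" "x \<noteq> x'" for x x'
    proof -
      obtain g g' where "g \<in> S" "g' \<in> S" "x = zero_point \<mu> g" "x' = zero_point \<mu> g'"
        using \<open>x \<in> ?P\<close> \<open>x' \<in> ?P\<close> by blast
      then show ?thesis using sep[of g g'] \<open>x \<noteq> x'\<close> by auto
    qed
    fix x u assume "x \<in> ?P" and u: "u \<in> W - {Seed 1}"
    then obtain g where g: "g \<in> S" "x = zero_point \<mu> g" by blast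
    from u have "u \<in> W" by simp
    then show "form_val (sunflower_point \<mu>) u x = 0"
    proof (cases rule: W_cases)
      case (2 i)
      then show ?thesis using g by (simp add: form_val_sunflower del: One_nat_def)
    next
      case (3 i)
      have "\<mu> * (\<mu> * g i ^ 2) ^ 2 = \<mu> ^ 3 * g i ^ 4"
        by (simp add: power_mult_distrib eval_nat_numeral)
      then show ?thesis using 3 g root[OF g(1) 3(1)] by (simp add: form_val_sunflower del: One_nat_def)
    next
      case 1
      then show ?thesis using u by blast
    qed
  qed
  also have "(\<Prod>x\<in>?P. form_val (sunflower_point \<mu>) (Seed 1) x) =
    (\<Prod>g\<in>S. \<mu> - of_nat (card {i\<in>{1..n}. g i \<noteq> 0}) / \<mu> ^ 2)"
    unfolding prod.reindex[OF inj] o_def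
  proof (intro prod.cong refl)
    fix g assume g: "g \<in> S"
    \<comment> \<open>The product of the two coordinates is \<open>\<mu> * g i ^ 3\<close>, and
      \<open>(\<mu> * g i) ^ 3 = 1\<close> on a nonzero petal.\<close>
    have "zero_point \<mu> g (Petal i 1) * zero_point \<mu> g (Petal i 2) = (if g i \<noteq> 0 then 1 / \<mu> ^ 2 else 0)"
      if i: "i \<in> {1..n}" for i
    proof (cases "g i = 0")
      case False
      have "g i * (\<mu> ^ 3 * g i ^ 3) = g i * 1" using root[OF g i] by (simp add: eval_nat_numeral mult_ac)
      then have "\<mu> ^ 3 * g i ^ 3 = 1" using False by (metis mult_left_cancel)
      then have "(g i * (\<mu> * g i ^ 2)) * \<mu> ^ 2 = 1" by (simp add: eval_nat_numeral mult_ac)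
      then show ?thesis using False assms by (simp add: eq_divide_eq)
    qed auto
    then have "(\<Sum>i\<in>{1..n}. zero_point \<mu> g (Petal i 1) * zero_point \<mu> g (Petal i 2)) =
      (\<Sum>i\<in>{1..n}. if g i \<noteq> 0 then 1 / \<mu> ^ 2 else 0)" by (intro sum.cong refl)
    also have "\<dots> = of_nat (card {i\<in>{1..n}. g i \<noteq> 0}) / \<mu> ^ 2"
      by (simp add: sum.If_cases Int_def)
    finally show "form_val (sunflower_point \<mu>) (Seed 1) (zero_point \<mu> g) =
      \<mu> - of_nat (card {i\<in>{1..n}. g i \<noteq> 0}) / \<mu> ^ 2"
      unfolding form_val_sunflower(1) by simp
  qed
  also have "\<dots> = (\<Prod>r=0..n. (\<mu> - of_nat r / \<mu> ^ 2) ^ ((n choose r) * 3 ^ r))"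
    unfolding S_def using prod_PiE_nonzero_count[OF finite_atLeastAtMost roots_facts(1,3,2)[OF assms],
        of "\<lambda>r. \<mu> - of_nat r / \<mu> ^ 2" 1 n] by simp
  finally show ?thesis unfolding res_sunflower_at_infinity[OF assms] .
qed

lemma sum_exponents: "(\<Sum>r=0..n. (n choose r) * 3 ^ r) = 4 ^ n"
  using binomial[of 3 1 n] by (simp add: atMost_atLeast0)

text \<open>Clearing denominators costs \<open>\<mu>\<^sup>2\<close> for each of the
  \<open>4 ^ n\<close> zeros, counted with \<open>sum_exponents\<close>. These are taken from the
  power of \<mu> in front; \<open>n \<ge> 1\<close> makes the subtraction in the exponent
  exact.\<close>

lemma res_sunflower':
  assumes "\<mu> \<noteq> 0"
  shows "eval_int (sunflower_point \<mu>) res =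
    \<mu> ^ ((2 * n - 2) * 4 ^ n) * (\<Prod>r=0..n. (\<mu> ^ 3 - of_nat r) ^ ((n choose r) * 3 ^ r))"
proof -
  have "(\<Prod>r=0..n. (\<mu> - of_nat r / \<mu> ^ 2) ^ ((n choose r) * 3 ^ r)) * \<mu> ^ (2 * 4 ^ n) =
    (\<Prod>r=0..n. (\<mu> - of_nat r / \<mu> ^ 2) ^ ((n choose r) * 3 ^ r)) *
    (\<Prod>r=0..n. (\<mu> ^ 2) ^ ((n choose r) * 3 ^ r))"
    unfolding sum_exponents[symmetric] power_mult power_sum by simp
  also have "\<dots> = (\<Prod>r=0..n. (\<mu> ^ 3 - of_nat r) ^ ((n choose r) * 3 ^ r))"
    unfolding prod.distrib[symmetric] power_mult_distrib[symmetric] using assms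
    by (intro prod.cong refl arg_cong2[where f = "(^)"]) (simp add: field_simps eval_nat_numeral)
  finally have *: "(\<Prod>r=0..n. (\<mu> - of_nat r / \<mu> ^ 2) ^ ((n choose r) * 3 ^ r)) * \<mu> ^ (2 * 4 ^ n) =
    (\<Prod>r=0..n. (\<mu> ^ 3 - of_nat r) ^ ((n choose r) * 3 ^ r))" .
  have "2 * n * 4 ^ n = (2 * n - 2) * 4 ^ n + 2 * 4 ^ n"
    using n_pos by (cases n) auto
  then have "\<mu> ^ (2 * n * 4 ^ n) = \<mu> ^ ((2 * n - 2) * 4 ^ n) * \<mu> ^ (2 * 4 ^ n)"
    by (simp only: power_add)
  then show ?thesis unfolding res_sunflower[OF assms] *[symmetric] by (simp only: mult_ac)
qed

end

theorem theorem6: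
  fixes n :: nat
  assumes "n \<ge> 1"
  shows "hypergraph_char_poly 3 (sunflower n 1 3) =
    [:0, 1:] ^ ((2 * n - 2) * 4 ^ n) *
    (\<Prod>r = 0..n. ([:0, 1:] ^ 3 - of_nat r) ^ ((n choose r) * 3 ^ r))"
    (is "?L = ?R")
proof -
  interpret sunflower_system n by unfold_locales (rule assms)
  let ?h = "\<lambda>\<mu> p. poly (map_poly (of_int :: int \<Rightarrow> complex) p) \<mu>"
  have "?h \<mu> ?L = ?h \<mu> ?R" if "\<mu> \<noteq> 0" for \<mu>
  proof -
    interpret h: coeff_hom "?h \<mu>" by (rule eval_int.coeff_hom_poly_map_poly)
    have X: "?h \<mu> [:0, 1:] = \<mu>" by (simp add: map_poly_pCons)
    \<comment> \<open>\<open>res\<close> has integer coefficients, so specializing \<lambda> may be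
      done in the forms before the resultant is taken.\<close>
    have "?h \<mu> (form_coeffs (char_form 3 (sunflower n 1 3)) k) = sunflower_point \<mu> k" for k
    proof -
      obtain v m where k: "k = (v, m)" by fastforce
      have single: "?h \<mu> (lookup (single m' c) m) = lookup (single m' (?h \<mu> c)) m"
        for m' c by (simp add: lookup_single when_def h.h_zero)
      show ?thesis
        unfolding k sunflower_point_def form_coeffs_def char_form_def sunflower_form_def snd_sunflower
          case_prod_conv lookup_minus lookup_sum h.h_diff h.h_sum single X h.h_one by simp
    qed
    then have "?h \<mu> ?L = eval_int (sunflower_point \<mu>) res"
      unfolding hypergraph_char_poly_def multi_resultant_def fst_sunflower res_def h.hom_eval_int by simp
    also have "\<dots> = ?h \<mu> ?R"
      unfolding res_sunflower'[OF that] h.h_mult h.h_power h.h_prod h.h_diff X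
      using h.hom_of_int[of "int r" for r] by simp
    finally show ?thesis .
  qed
  \<comment> \<open>The value \<mu> = 0 is left out by means of the auxiliary polynomial
    \<open>[:0, 1:]\<close>; agreement at all other points already gives equality.\<close>
  then have eq: "map_poly (of_int :: int \<Rightarrow> complex) ?L = map_poly of_int ?R"
    by (intro poly_eq_of_nonzero_roots[of "[:0, 1:]"]) auto
  show ?thesis
  proof (rule poly_eqI)
    fix i
    have "of_int (coeff ?L i) = (of_int (coeff ?R i) :: complex)"
      using arg_cong[OF eq, of "\<lambda>p. coeff p i"] unfolding coeff_map_poly[of of_int, OF of_int_0] .
    then show "coeff ?L i = coeff ?R i" by simp
  qed
qed

end
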